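(* Let $X\subset\mathbb R^2$ be a closed unbounded definable set of dimension at most $1$ and let $h:X\to\mathbb R^2$ be a coercive definable embedding. Let $m=\deg(\infty,X)$, and let the points $p\in\mathbb R^2\setminus X$, $q\in\mathbb R^2\setminus h(X)$ be chosen as described in the context. Then $h$ extends to a definable homeomorphism of $\mathbb R^2$ if and only if $\operatorname{ord}(h,\infty)\in\{\pm1\}$ and the map $g_{p,q}:\phi_p(X)\cup\{0\}\to\mathbb R^2$, $$g_{p,q}(x)=\begin{cases}\phi_q\circ h\circ\phi_p^{-1}(x),& x\ne0,\\ 0,& x=0,\end{cases}$$ extends to a definable homeomorphism of $\mathbb R^2$. In the case $m=2$, the latter means that at least one of the two choices of the pair $(p,q)$ described in the context gives a map $g_{p,q}$ admitting such an extension.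
   Context: Fix an o-minimal structure expanding $(\mathbb R,+,\cdot)$; "definable" means definable in it. An embedding is a continuous injective map. $h$ is coercive if $\|x\|\to\infty$ (with $x\in X$) implies $\|h(x)\|\to\infty$. $\mathbb B_R$ is the open disk of radius $R$ centered at $0$. For $a\in\mathbb R^2$ let $\phi_a:\mathbb R^2\setminus\{a\}\to\mathbb R^2$, $\phi_a(x)=\frac{x-a}{\|x-a\|^2}$, which is a homeomorphism onto $\mathbb R^2\setminus\{0\}$. Degree at infinity: for all sufficiently large $R$ the homeomorphism type of $X\setminus\mathbb B_R$ is constant; $m=\deg(\infty,X)$ is the number of its connected components $X_1^\infty,\dots,X_m^\infty$ (the branches at infinity). Cyclic order at infinity ($m\ge3$): a Jordan curve around $\infty$ is a definable simple closed curve $\gamma\subset\mathbb R^2\setminus\mathbb B_R$ meeting each $X_i^\infty$ in exactly one point $p_i$. Put $X_i^\infty<X_j^\infty$ ($i\neq j$) iff $p_j$ is the first of the points $\{p_1,\dots,p_m\}\setminus\{p_i\}$ met when traversing $\gamma$ counterclockwise from $p_i$; this is independent of $\gamma$. The branches at infinity of $h(X)$ are the germs at infinity of $h(X_1^\infty),\dots,h(X_m^\infty)$, ordered in the same way. $\operatorname{ord}(h,\infty)=1$ if $X_i^\infty<X_j^\infty\Rightarrow h(X_i^\infty)<h(X_j^\infty)$ for all $i\ne j$; $\operatorname{ord}(h,\infty)=-1$ if $X_i^\infty<X_j^\infty\Rightarrow h(X_j^\infty)<h(X_i^\infty)$ for all $i\neq j$; $\operatorname{ord}(h,\infty)=0$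 otherwise. For $m\le2$ the condition $\operatorname{ord}(h,\infty)\in\{\pm1\}$ is regarded as automatically satisfied. Choice of $p,q$: the connected components at infinity of $\mathbb R^2\setminus X$ are the connected components of $\mathbb R^2\setminus(X\cup\overline{\mathbb B}_R)$ for $R$ large (there are $m$ of them), and similarly for $h(X)$. - $m=1$: let $U_1$, $V_1$ be the unique components at infinity of $\mathbb R^2\setminus X$ and $\mathbb R^2\setminus h(X)$; choose $p\in U_1$, $q\in V_1$. - $m=2$: let $U_1,U_2$ and $V_1,V_2$ be the components at infinity of $\mathbb R^2\setminus X$ and $\mathbb R^2\setminus h(X)$. Two choices of pairs are considered: $p\in U_1,q\in V_1$; and $p\in U_1,q\in V_2$. - $m\ge3$: index the branches so that $X_1^\infty<X_2^\infty<\cdots<X_m^\infty$ (indices mod $m$), and let $U_i$ be the component at infinity of $\mathbb R^2\setminus X$ bounded by $X_i^\infty$ and $X_{i+1}^\infty$. If $\operatorname{ord}(h,\infty)\in\{\pm1\}$, then $h(X_i^\infty)$ and $h(X_{i+1}^\infty)$ are consecutive, and $V_i$ denotes the component at infinity of $\mathbb R^2\setminus h(X)$ bounded by them. Pick some $i\in\{1,\dots,m\}$ and choose $p\in U_i$, $q\in V_i$. *)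

theory Defs
  imports "HOL-Complex_Analysis.Complex_Analysis"
begin

section \<open>O-minimal structures expanding the real field\<close>

text \<open>A point of \<open>\<real>\<^sup>n\<close> is a function \<open>nat \<Rightarrow> real\<close> that is extensional on \<open>{..<n}\<close>. On this set the
  product topology of \<open>nat \<Rightarrow> real\<close> induces the Euclidean topology.\<close>

abbreviation Rn :: "nat \<Rightarrow> (nat \<Rightarrow> real) set" where
  "Rn n \<equiv> {..<n} \<rightarrow>\<^sub>E UNIV"

text \<open>\<open>S n\<close> is the collection of the definable subsets of \<open>\<real>\<^sup>n\<close>. Since the last axiom puts every
  singleton into \<open>S 1\<close>, definability is definability with parameters.\<close>

locale o_minimal_field_expansion =
  fixes S :: "nat \<Rightarrow> (nat \<Rightarrow> real) set set"
  assumes subset_Rn: "A \<in> S n \<Longrightarrow> A \<subseteq> Rn n"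
    and Rn_mem: "Rn n \<in> S n"
    and Un_mem: "A \<in> S n \<Longrightarrow> B \<in> S n \<Longrightarrow> A \<union> B \<in> S n"
    and Diff_mem: "A \<in> S n \<Longrightarrow> Rn n - A \<in> S n"
    and times_right_mem: "A \<in> S n \<Longrightarrow> {x \<in> Rn (Suc n). restrict x {..<n} \<in> A} \<in> S (Suc n)"
    and times_left_mem: "A \<in> S n \<Longrightarrow> {x \<in> Rn (Suc n). (\<lambda>i\<in>{..<n}. x (Suc i)) \<in> A} \<in> S (Suc n)"
    and diagonal_mem: "i < n \<Longrightarrow> j < n \<Longrightarrow> {x \<in> Rn n. x i = x j} \<in> S n"
    and projection_mem: "A \<in> S (Suc n) \<Longrightarrow> (\<lambda>x. restrict x {..<n}) ` A \<in> S n"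
    and add_mem: "{x \<in> Rn 3. x 0 + x 1 = x 2} \<in> S 3"
    and mult_mem: "{x \<in> Rn 3. x 0 * x 1 = x 2} \<in> S 3"
    and o_minimality: "S 1 = {A. A \<subseteq> Rn 1 \<and>
          (\<exists>\<I>. finite \<I> \<and> (\<forall>I\<in>\<I>. is_interval I) \<and> (\<lambda>x. x 0) ` A = \<Union>\<I>)}"

definition graph_on :: "nat \<Rightarrow> (nat \<Rightarrow> real) set \<Rightarrow> ((nat \<Rightarrow> real) \<Rightarrow> real) \<Rightarrow> (nat \<Rightarrow> real) set" where
  "graph_on n C f = {x \<in> Rn (Suc n). restrict x {..<n} \<in> C \<and> x n = f (restrict x {..<n})}"

text \<open>The continuous definable functions \<open>C \<rightarrow> \<real>\<close>, \<open>C \<subseteq> \<real>\<^sup>n\<close>, together with the constants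
  \<open>\<plusminus>\<infinity>\<close>: these are the admissible bounds in the construction of cells.\<close>

definition cell_bound :: "(nat \<Rightarrow> (nat \<Rightarrow> real) set set) \<Rightarrow> nat \<Rightarrow> (nat \<Rightarrow> real) set \<Rightarrow>
    ((nat \<Rightarrow> real) \<Rightarrow> ereal) \<Rightarrow> bool" where
  "cell_bound S n C f \<longleftrightarrow>
     (\<forall>x\<in>C. f x = - \<infinity>) \<or> (\<forall>x\<in>C. f x = \<infinity>) \<or>
     (\<exists>g. continuous_on C g \<and> graph_on n C g \<in> S (Suc n) \<and> (\<forall>x\<in>C. f x = ereal (g x)))"

text \<open>\<open>cell S i C\<close>: the set \<open>C\<close> is an \<open>(i\<^sub>1, \<dots>, i\<^sub>n)\<close>-cell in \<open>\<real>\<^sup>n\<close>, where \<open>n = length i\<close>.\<close>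

inductive cell :: "(nat \<Rightarrow> (nat \<Rightarrow> real) set set) \<Rightarrow> nat list \<Rightarrow> (nat \<Rightarrow> real) set \<Rightarrow> bool"
  for S where
  point: "cell S [] (Rn 0)"
| graph: "cell S i C \<Longrightarrow> continuous_on C f \<Longrightarrow> graph_on (length i) C f \<in> S (Suc (length i)) \<Longrightarrow>
    cell S (i @ [0]) (graph_on (length i) C f)"
| band: "cell S i C \<Longrightarrow> n = length i \<Longrightarrow> cell_bound S n C f \<Longrightarrow> cell_bound S n C g \<Longrightarrow>
    \<forall>x\<in>C. f x < g x \<Longrightarrow>
    cell S (i @ [1]) {x \<in> Rn (Suc n). restrict x {..<n} \<in> C \<and>
      f (restrict x {..<n}) < ereal (x n) \<and> ereal (x n) < g (restrict x {..<n})}"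

text \<open>The dimension of \<open>A \<subseteq> \<real>\<^sup>n\<close> is the maximum of \<open>i\<^sub>1 + \<dots> + i\<^sub>n\<close> over all the
  \<open>(i\<^sub>1, \<dots>, i\<^sub>n)\<close>-cells contained in \<open>A\<close>, and \<open>-\<infinity>\<close> (the supremum of the empty set in
  \<open>ereal\<close>) if \<open>A\<close> is empty.\<close>

definition odim :: "(nat \<Rightarrow> (nat \<Rightarrow> real) set set) \<Rightarrow> nat \<Rightarrow> (nat \<Rightarrow> real) set \<Rightarrow> ereal" where
  "odim S n A = (SUP i \<in> {i. length i = n \<and> (\<exists>C. cell S i C \<and> C \<subseteq> A)}. ereal (real (sum_list i)))"


section \<open>Definable subsets and maps of the plane\<close>

text \<open>The plane \<open>\<real>\<^sup>2\<close> is the type \<open>complex\<close>, for which the library has winding numbers.\<close>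

definition coords :: "complex set \<Rightarrow> (nat \<Rightarrow> real) set" where
  "coords X = {x \<in> Rn 2. Complex (x 0) (x 1) \<in> X}"

definition definable_set :: "(nat \<Rightarrow> (nat \<Rightarrow> real) set set) \<Rightarrow> complex set \<Rightarrow> bool" where
  "definable_set S X \<longleftrightarrow> coords X \<in> S 2"

definition definable_map ::
    "(nat \<Rightarrow> (nat \<Rightarrow> real) set set) \<Rightarrow> complex set \<Rightarrow> (complex \<Rightarrow> complex) \<Rightarrow> bool" where
  "definable_map S X f \<longleftrightarrow>
     {x \<in> Rn 4. Complex (x 0) (x 1) \<in> X \<and> f (Complex (x 0) (x 1)) = Complex (x 2) (x 3)} \<in> S 4"

definition extends_to_definable_homeomorphism ::
    "(nat \<Rightarrow> (nat \<Rightarrow> real) set set) \<Rightarrow> complex set \<Rightarrow> (complex \<Rightarrow> complex) \<Rightarrow> bool" where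
  "extends_to_definable_homeomorphism S X f \<longleftrightarrow>
     (\<exists>F G. homeomorphism UNIV UNIV F G \<and> definable_map S UNIV F \<and> (\<forall>x\<in>X. F x = f x))"

definition coercive_on :: "complex set \<Rightarrow> (complex \<Rightarrow> complex) \<Rightarrow> bool" where
  "coercive_on X h \<longleftrightarrow> filterlim h at_infinity (inf at_infinity (principal X))"


section \<open>Branches at infinity and their cyclic order\<close>

definition deg_infinity :: "complex set \<Rightarrow> nat" where
  "deg_infinity X = (THE m. \<forall>\<^sub>F R in at_top.
     finite (components (X - ball 0 R)) \<and> card (components (X - ball 0 R)) = m)"

definition same_germ :: "complex set \<Rightarrow> complex set \<Rightarrow> bool" where
  "same_germ A B \<longleftrightarrow> (\<forall>\<^sub>F r in at_top. A - ball 0 r = B - ball 0 r)"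

definition jordan_curve_around_infinity ::
    "(nat \<Rightarrow> (nat \<Rightarrow> real) set set) \<Rightarrow> complex set \<Rightarrow> real \<Rightarrow> (real \<Rightarrow> complex) \<Rightarrow> bool" where
  "jordan_curve_around_infinity S X R \<gamma> \<longleftrightarrow>
     simple_path \<gamma> \<and> pathfinish \<gamma> = pathstart \<gamma> \<and> definable_set S (path_image \<gamma>) \<and>
     path_image \<gamma> \<subseteq> - ball 0 R \<and>
     (\<forall>C \<in> components (X - ball 0 R). \<exists>!z. z \<in> C \<inter> path_image \<gamma>)"

definition counterclockwise :: "(real \<Rightarrow> complex) \<Rightarrow> bool" where
  "counterclockwise \<gamma> \<longleftrightarrow> (\<forall>z \<in> inside (path_image \<gamma>). winding_number \<gamma> z = 1)"

text \<open>\<open>precedes S X A B\<close> is the relation \<open>A < B\<close> for the branches at infinity of \<open>X\<close> whose germs are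
  represented by the sets \<open>A\<close> and \<open>B\<close>. The curve is parametrised so that it starts at its point on
  the first branch. As the relation does not depend on the curve, it is enough to ask for one.\<close>

definition precedes ::
    "(nat \<Rightarrow> (nat \<Rightarrow> real) set set) \<Rightarrow> complex set \<Rightarrow> complex set \<Rightarrow> complex set \<Rightarrow> bool" where
  "precedes S X A B \<longleftrightarrow> (\<forall>\<^sub>F R in at_top.
     \<exists>C \<in> components (X - ball 0 R). \<exists>D \<in> components (X - ball 0 R).
       C \<noteq> D \<and> same_germ A C \<and> same_germ B D \<and>
       (\<exists>\<gamma>. jordan_curve_around_infinity S X R \<gamma> \<and> counterclockwise \<gamma> \<and> pathstart \<gamma> \<in> C \<and>
          (\<exists>t. 0 < t \<and> t < 1 \<and> \<gamma> t \<in> D \<and> (\<forall>s. 0 < s \<and> s < t \<longrightarrow> \<gamma> s \<notin> X))))"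

definition ord_infinity ::
    "(nat \<Rightarrow> (nat \<Rightarrow> real) set set) \<Rightarrow> complex set \<Rightarrow> (complex \<Rightarrow> complex) \<Rightarrow> int" where
  "ord_infinity S X h =
     (if \<forall>\<^sub>F R in at_top. \<forall>A \<in> components (X - ball 0 R). \<forall>B \<in> components (X - ball 0 R).
           A \<noteq> B \<longrightarrow> precedes S X A B \<longrightarrow> precedes S (h ` X) (h ` A) (h ` B)
      then 1
      else if \<forall>\<^sub>F R in at_top. \<forall>A \<in> components (X - ball 0 R). \<forall>B \<in> components (X - ball 0 R).
           A \<noteq> B \<longrightarrow> precedes S X A B \<longrightarrow> precedes S (h ` X) (h ` B) (h ` A)
      then - 1
      else 0)"


section \<open>The maps \<open>g\<^bsub>p,q\<^esub>\<close> and the choice of \<open>p\<close> and \<open>q\<close>\<close>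

definition phi :: "complex \<Rightarrow> complex \<Rightarrow> complex" where
  "phi a x = (x - a) /\<^sub>R (norm (x - a))\<^sup>2"

definition g_map :: "(complex \<Rightarrow> complex) \<Rightarrow> complex \<Rightarrow> complex \<Rightarrow> complex \<Rightarrow> complex" where
  "g_map h p q x = (if x = 0 then 0 else phi q (h (inv_into (- {p}) (phi p) x)))"

definition complement_components :: "complex set \<Rightarrow> real \<Rightarrow> complex set set" where
  "complement_components X R = components (- (X \<union> cball 0 R))"

text \<open>\<open>U\<close> is bounded by the branches \<open>A\<close> and \<open>B\<close>: near infinity, its frontier is \<open>A \<union> B\<close>.\<close>

definition bounded_by_branches :: "complex set \<Rightarrow> complex set \<Rightarrow> complex set \<Rightarrow> bool" where
  "bounded_by_branches U A B \<longleftrightarrow> same_germ (frontier U) (A \<union> B)"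

text \<open>\<open>choice_pq S X h R R' P\<close>: the set \<open>P\<close> consists of the pair \<open>(p, q)\<close> (of the two pairs, if the
  degree is 2) chosen by means of the components of the complements of \<open>X\<close> outside the radius \<open>R\<close>
  and of \<open>h ` X\<close> outside the radius \<open>R'\<close>. In the case \<open>many\<close>, the \<open>i\<close>-th component for \<open>h ` X\<close>
  is specified only if the order of \<open>h\<close> at infinity is \<open>1\<close> or \<open>-1\<close>; otherwise \<open>q\<close> is any point
  outside \<open>h ` X\<close>.\<close>

inductive choice_pq :: "(nat \<Rightarrow> (nat \<Rightarrow> real) set set) \<Rightarrow> complex set \<Rightarrow> (complex \<Rightarrow> complex) \<Rightarrow>
    real \<Rightarrow> real \<Rightarrow> (complex \<times> complex) set \<Rightarrow> bool"
  for S X h R R' where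
  one:
    "deg_infinity X = 1 \<Longrightarrow>
     U \<in> complement_components X R \<Longrightarrow> V \<in> complement_components (h ` X) R' \<Longrightarrow>
     p \<in> U \<Longrightarrow> q \<in> V \<Longrightarrow>
     choice_pq S X h R R' {(p, q)}"
| two:
    "deg_infinity X = 2 \<Longrightarrow>
     U \<in> complement_components X R \<Longrightarrow>
     V1 \<in> complement_components (h ` X) R' \<Longrightarrow> V2 \<in> complement_components (h ` X) R' \<Longrightarrow>
     V1 \<noteq> V2 \<Longrightarrow>
     p1 \<in> U \<Longrightarrow> q1 \<in> V1 \<Longrightarrow> p2 \<in> U \<Longrightarrow> q2 \<in> V2 \<Longrightarrow>
     choice_pq S X h R R' {(p1, q1), (p2, q2)}"
| many:
    "deg_infinity X = m \<Longrightarrow> 3 \<le> m \<Longrightarrow>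
     bij_betw B {..<m} (components (X - ball 0 R)) \<Longrightarrow>
     \<forall>j<m. precedes S X (B j) (B (Suc j mod m)) \<Longrightarrow>
     i < m \<Longrightarrow>
     U \<in> complement_components X R \<Longrightarrow> bounded_by_branches U (B i) (B (Suc i mod m)) \<Longrightarrow>
     p \<in> U \<Longrightarrow> q \<notin> h ` X \<Longrightarrow>
     ord_infinity S X h \<in> {1, - 1} \<longrightarrow>
       (\<exists>V \<in> complement_components (h ` X) R'.
          bounded_by_branches V (h ` B i) (h ` B (Suc i mod m)) \<and> q \<in> V) \<Longrightarrow>
     choice_pq S X h R R' {(p, q)}"

end

theory Submission
  imports Defs
begin

text \<open>If \<open>g\<^bsub>p,q\<^esub>\<close> extends to a homeomorphism \<open>K\<close>, then \<open>\<phi>\<^sub>q\<^sup>-\<^sup>1 \<circ> K \<circ> \<phi>\<^sub>p\<close>, completed by \<open>p \<mapsto> q\<close>, extends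
  \<open>h\<close>; this works for all \<open>p \<notin> X\<close> and \<open>q\<close>. Conversely, an extension \<open>H\<close> of \<open>h\<close> with \<open>H p = q\<close> gives
  the extension \<open>\<phi>\<^sub>q \<circ> H \<circ> \<phi>\<^sub>p\<^sup>-\<^sup>1\<close> of \<open>g\<^bsub>p,q\<^esub>\<close>, and \<open>H p = q\<close> can be achieved by definable
  perturbations with support in the complement of \<open>h ` X\<close> as soon as \<open>H p\<close> and \<open>q\<close> lie in the same
  component of this complement.

  To compare these components, note that by o-minimality \<open>X\<close> is a finite union of disjoint
  rays \<open>r \<mapsto> r exp (\<i> \<theta>\<^sub>k r)\<close> outside a large disk. Indeed, if the circles of arbitrarily large radius
  met \<open>X\<close> in infinitely many points, or in a point near which \<open>X\<close> is not a continuous section of the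
  norm, then all large radii would do so, and rational approximation would cover them by countably
  many definable sets; one of these would contain an interval, contrary to the dimension bound or
  to the choice of the point. So the norm restricts to a finite covering map near infinity. Its
  sections are the rays, and the components at
  infinity of the complement are the sectors between consecutive rays. A homeomorphism maps sectors
  to sectors up to germs at infinity, hence it maps adjacent rays to adjacent rays. A
  permutation of a cyclic arrangement of at least three rays that preserves adjacency also preserves
  or reverses the cyclic order, which gives \<open>ord (h, \<infinity>) = \<plusminus>1\<close> and singles out the sector containing
  \<open>q\<close>.\<close>

section \<open>Definable predicates and maps\<close>

text \<open>The obstacle is to get the rays from the axioms alone. Both possible failures, an
  infinite section by a circle and a point near which \<open>X\<close> is no section, are written as
  first-order conditions on the radius, because for such conditions arbitrarily large implies all
  large. This dictates two encodings: circles are parametrised by rational functions, since the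
  trigonometric ones need not be definable, and a good point is described by an isolating disk
  instead of a function. Rational constants are admissible as parameters, so fixing the end points
  of an arc or the data of a disk stays inside the structure. The arguments of the rays are merely
  continuous; from the covering on, the reasoning is topological. Definability returns with the
  circles that witness the cyclic order and with the perturbation that moves \<open>H p\<close> to
  \<open>q\<close>, hence its semialgebraic tent shape. The degrees differ in what identifies the
  image of a sector: with one ray there is only one sector; with two, both sectors have the same
  pair of bounding rays, so either can be the image; from three on, the bounding rays determine the
  sector.\<close>

class rtuple =
  fixes rdim :: "'a itself \<Rightarrow> nat" and enc :: "'a \<Rightarrow> nat \<Rightarrow> real"
  assumes bij_enc: "bij_betw enc UNIV (Rn (rdim TYPE('a)))"
begin

lemma enc_mem: "enc a \<in> Rn (rdim TYPE('a))"
  using bij_enc by (auto simp: bij_betw_def)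

lemma enc_eq_iff: "enc a = enc b \<longleftrightarrow> a = b"
  using bij_enc by (auto simp: bij_betw_def inj_on_def)

lemma enc_surj: "x \<in> Rn (rdim TYPE('a)) \<Longrightarrow> \<exists>a. x = enc a"
  using bij_enc by (auto simp: bij_betw_def)

lemma enc_eqI: "(\<And>i. i < rdim TYPE('a) \<Longrightarrow> enc a i = enc b i) \<Longrightarrow> a = b"
  using enc_mem[of a] enc_mem[of b] by (metis PiE_ext enc_eq_iff lessThan_iff)

end

instantiation real :: rtuple
begin
definition rdim_real :: "real itself \<Rightarrow> nat" where "rdim_real _ = 1"
definition enc_real :: "real \<Rightarrow> nat \<Rightarrow> real" where "enc_real r = (\<lambda>i\<in>{..<1}. r)"
instance
proof
  show "bij_betw (enc :: real \<Rightarrow> _) UNIV (Rn (rdim TYPE(real)))"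
    by (rule bij_betw_byWitness[where f' = "\<lambda>x. x 0"])
      (auto simp: rdim_real_def enc_real_def fun_eq_iff PiE_iff extensional_def split: if_splits)
qed
end

instantiation complex :: rtuple
begin
definition rdim_complex :: "complex itself \<Rightarrow> nat" where "rdim_complex _ = 2"
definition enc_complex :: "complex \<Rightarrow> nat \<Rightarrow> real" where
  "enc_complex z = (\<lambda>i\<in>{..<2}. if i = 0 then Re z else Im z)"
instance
proof
  show "bij_betw (enc :: complex \<Rightarrow> _) UNIV (Rn (rdim TYPE(complex)))"
    by (rule bij_betw_byWitness[where f' = "\<lambda>x. Complex (x 0) (x 1)"])
      (auto simp: rdim_complex_def enc_complex_def fun_eq_iff PiE_iff extensional_def less_2_cases_iff
        split: if_splits)
qed
end

instantiation prod :: (rtuple, rtuple) rtuple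
begin
definition rdim_prod :: "('a \<times> 'b) itself \<Rightarrow> nat" where
  "rdim_prod _ = rdim TYPE('a) + rdim TYPE('b)"
definition enc_prod :: "'a \<times> 'b \<Rightarrow> nat \<Rightarrow> real" where
  "enc_prod z = (\<lambda>i\<in>{..<rdim TYPE('a) + rdim TYPE('b)}.
     if i < rdim TYPE('a) then enc (fst z) i else enc (snd z) (i - rdim TYPE('a)))"
instance
proof
  let ?a = "rdim TYPE('a)" and ?b = "rdim TYPE('b)"
  show "bij_betw (enc :: 'a \<times> 'b \<Rightarrow> _) UNIV (Rn (rdim TYPE('a \<times> 'b)))"
    unfolding bij_betw_def
  proof (intro conjI injI equalityI subsetI)
    fix z w :: "'a \<times> 'b" assume eq: "enc z = enc w"
    have "fst z = fst w"
    proof (rule enc_eqI)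
      fix i assume "i < ?a"
      then show "enc (fst z) i = enc (fst w) i"
        using fun_cong[OF eq, of i] by (auto simp: enc_prod_def)
    qed
    moreover have "snd z = snd w"
    proof (rule enc_eqI)
      fix i assume "i < ?b"
      then show "enc (snd z) i = enc (snd w) i"
        using fun_cong[OF eq, of "?a + i"] by (auto simp: enc_prod_def split: if_splits)
    qed
    ultimately show "z = w" by (simp add: prod_eq_iff)
  next
    fix x assume "x \<in> range (enc :: 'a \<times> 'b \<Rightarrow> _)"
    then show "x \<in> Rn (rdim TYPE('a \<times> 'b))"
      by (elim imageE) (simp add: rdim_prod_def enc_prod_def)
  next
    fix x assume x: "x \<in> Rn (rdim TYPE('a \<times> 'b))"
    obtain a :: 'a where a: "restrict x {..<?a} = enc a"
      using enc_surj[of "restrict x {..<?a}", where 'a = 'a] by auto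
    obtain b :: 'b where b: "(\<lambda>i\<in>{..<?b}. x (?a + i)) = enc b"
      using enc_surj[of "\<lambda>i\<in>{..<?b}. x (?a + i)", where 'a = 'b] by auto
    have "x = enc (a, b)"
    proof
      fix i
      consider "i < ?a" | "?a \<le> i" "i < ?a + ?b" | "?a + ?b \<le> i" by linarith
      then show "x i = enc (a, b) i"
      proof cases
        case 1 then show ?thesis using fun_cong[OF a, of i] by (simp add: enc_prod_def)
      next
        case 2
        then have "i - ?a < ?b" by linarith
        then show ?thesis using 2 fun_cong[OF b, of "i - ?a"] by (simp add: enc_prod_def)
      next
        case 3 then show ?thesis using x by (auto simp: enc_prod_def rdim_prod_def PiE_iff extensional_def)
      qed
    qed
    then show "x \<in> range (enc :: 'a \<times> 'b \<Rightarrow> _)" by blast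
  qed
qed
end

lemma restrict_enc_Pair: "restrict (enc (a, b)) {..<rdim TYPE('a)} = enc a"
  for a :: "'a::rtuple" and b :: "'b::rtuple"
  using enc_mem[of a] by (auto simp: enc_prod_def fun_eq_iff PiE_iff extensional_def)

text \<open>These maps are the substitutions of variables for variables. They are treated ahead of
  definable maps, whose composition already needs variables to be permuted and duplicated.\<close>

definition reindexing :: "('a::rtuple \<Rightarrow> 'b::rtuple) \<Rightarrow> bool" where
  "reindexing f \<longleftrightarrow> (\<forall>i<rdim TYPE('b). \<exists>j<rdim TYPE('a). \<forall>x. enc (f x) i = enc x j)"

lemma reindexing_id: "reindexing (\<lambda>x. x)"
  by (auto simp: reindexing_def)

lemma reindexing_fst: "reindexing f \<Longrightarrow> reindexing (\<lambda>x. fst (f x))"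
  for f :: "'a::rtuple \<Rightarrow> 'b::rtuple \<times> 'c::rtuple"
  unfolding reindexing_def
proof (intro allI impI)
  fix i assume *: "\<forall>i<rdim TYPE('b \<times> 'c). \<exists>j<rdim TYPE('a). \<forall>x. enc (f x) i = enc x j"
    and "i < rdim TYPE('b)"
  then show "\<exists>j<rdim TYPE('a). \<forall>x. enc (fst (f x)) i = enc x j"
    using *[rule_format, of i] by (auto simp: rdim_prod_def enc_prod_def)
qed

lemma reindexing_snd: "reindexing f \<Longrightarrow> reindexing (\<lambda>x. snd (f x))"
  for f :: "'a::rtuple \<Rightarrow> 'b::rtuple \<times> 'c::rtuple"
  unfolding reindexing_def
proof (intro allI impI)
  fix i assume *: "\<forall>i<rdim TYPE('b \<times> 'c). \<exists>j<rdim TYPE('a). \<forall>x. enc (f x) i = enc x j"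
    and "i < rdim TYPE('c)"
  then show "\<exists>j<rdim TYPE('a). \<forall>x. enc (snd (f x)) i = enc x j"
    using *[rule_format, of "rdim TYPE('b) + i"] by (auto simp: rdim_prod_def enc_prod_def)
qed

lemma reindexing_Pair: "reindexing f \<Longrightarrow> reindexing g \<Longrightarrow> reindexing (\<lambda>x. (f x, g x))"
  for f :: "'a::rtuple \<Rightarrow> 'b::rtuple" and g :: "'a \<Rightarrow> 'c::rtuple"
  unfolding reindexing_def
proof (intro allI impI)
  fix i assume f: "\<forall>i<rdim TYPE('b). \<exists>j<rdim TYPE('a). \<forall>x. enc (f x) i = enc x j"
    and g: "\<forall>i<rdim TYPE('c). \<exists>j<rdim TYPE('a). \<forall>x. enc (g x) i = enc x j"
    and i: "i < rdim TYPE('b \<times> 'c)"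
  show "\<exists>j<rdim TYPE('a). \<forall>x. enc (f x, g x) i = enc x j"
  proof (cases "i < rdim TYPE('b)")
    case True
    then show ?thesis using f by (auto simp: enc_prod_def)
  next
    case False
    then show ?thesis using g[rule_format, of "i - rdim TYPE('b)"] i
      by (auto simp: enc_prod_def rdim_prod_def)
  qed
qed

lemma reindexing_Re: "reindexing f \<Longrightarrow> reindexing (\<lambda>x. Re (f x))"
  by (force simp: reindexing_def rdim_real_def rdim_complex_def enc_real_def enc_complex_def)

lemma reindexing_Im: "reindexing f \<Longrightarrow> reindexing (\<lambda>x. Im (f x))"
  unfolding reindexing_def rdim_real_def rdim_complex_def enc_real_def enc_complex_def
  by (auto dest!: spec[of _ 1])

lemma reindexing_Complex: "reindexing f \<Longrightarrow> reindexing g \<Longrightarrow> reindexing (\<lambda>x. Complex (f x) (g x))"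
  by (auto simp: reindexing_def rdim_real_def rdim_complex_def enc_real_def enc_complex_def
      less_2_cases_iff)

lemma reindexing_comp: "reindexing f \<Longrightarrow> reindexing g \<Longrightarrow> reindexing (\<lambda>x. f (g x))"
  unfolding reindexing_def by metis

lemmas reindexing_intros = reindexing_id reindexing_fst reindexing_snd reindexing_Pair
  reindexing_Re reindexing_Im reindexing_Complex

context o_minimal_field_expansion
begin

section \<open>Boolean operations and substitution of variables in the structure\<close>

lemma Int_mem: "A \<in> S n \<Longrightarrow> B \<in> S n \<Longrightarrow> A \<inter> B \<in> S n"
proof -
  assume A: "A \<in> S n" and B: "B \<in> S n"
  have "A \<inter> B = Rn n - ((Rn n - A) \<union> (Rn n - B))"
    using subset_Rn[OF A] subset_Rn[OF B] by blast
  then show ?thesis using A B by (auto intro!: Diff_mem Un_mem)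
qed

lemma drop_mem: "A \<in> S n \<Longrightarrow> {x \<in> Rn (n + k). (\<lambda>i\<in>{..<n}. x (i + k)) \<in> A} \<in> S (n + k)"
proof (induction k)
  case 0
  then have "{x \<in> Rn (n + 0). (\<lambda>i\<in>{..<n}. x (i + 0)) \<in> A} = A"
    using subset_Rn[OF 0] by (auto simp: PiE_restrict)
  then show ?case using 0 by (simp only: add_0_right)
next
  case (Suc k)
  have *: "(\<lambda>i\<in>{..<n}. restrict (\<lambda>i. x (Suc i)) {..<n + k} (i + k)) = (\<lambda>i\<in>{..<n}. x (i + Suc k))"
    for x :: "nat \<Rightarrow> real" by (auto simp: fun_eq_iff)
  have "{x \<in> Rn (Suc (n + k)). (\<lambda>i\<in>{..<n + k}. x (Suc i))
      \<in> {x \<in> Rn (n + k). (\<lambda>i\<in>{..<n}. x (i + k)) \<in> A}} =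
    {x \<in> Rn (n + Suc k). (\<lambda>i\<in>{..<n}. x (i + Suc k)) \<in> A}"
    by (simp only: mem_Collect_eq * add_Suc_right) simp
  then show ?case using times_left_mem[OF Suc.IH[OF Suc.prems]] by (simp only: add_Suc_right)
qed

lemma take_mem: "A \<in> S (n + k) \<Longrightarrow> (\<lambda>x. restrict x {..<n}) ` A \<in> S n"
proof (induction k arbitrary: A)
  case 0
  then have "(\<lambda>x. restrict x {..<n}) ` A = A"
    using subset_Rn[OF 0] by (force simp: image_iff PiE_restrict)
  then show ?case using 0 by (simp only: add_0_right)
next
  case (Suc k)
  then have "(\<lambda>x. restrict x {..<n + k}) ` A \<in> S (n + k)" using projection_mem by simp
  then have "(\<lambda>x. restrict x {..<n}) ` (\<lambda>x. restrict x {..<n + k}) ` A \<in> S n" by (rule Suc.IH)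
  moreover have "(\<lambda>x. restrict x {..<n}) ` (\<lambda>x. restrict x {..<n + k}) ` A = (\<lambda>x. restrict x {..<n}) ` A"
    unfolding image_image by (rule image_cong) (auto simp: fun_eq_iff)
  ultimately show ?case by (simp only:)
qed

text \<open>The set is the projection of all concatenations of \<open>x\<close> with a member
  \<open>y\<close> of \<open>A\<close> such that \<open>y i = x (\<sigma> i)\<close>:
  \<open>drop_mem\<close> places \<open>A\<close> on the last \<open>n\<close> coordinates,
  diagonals impose the equations, and \<open>take_mem\<close> removes \<open>y\<close>.\<close>

lemma substitution_mem:
  assumes A: "A \<in> S n" and \<sigma>: "\<And>i. i < n \<Longrightarrow> \<sigma> i < m"
  shows "{x \<in> Rn m. (\<lambda>i\<in>{..<n}. x (\<sigma> i)) \<in> A} \<in> S m"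
proof -
  define E where "E j = {x \<in> Rn (m + n). \<forall>i<j. x (i + m) = x (\<sigma> i)}" for j
  have E: "E j \<in> S (m + n)" if "j \<le> n" for j
    using that
  proof (induction j)
    case 0 show ?case by (simp add: E_def Rn_mem)
  next
    case (Suc j)
    have "E (Suc j) = E j \<inter> {x \<in> Rn (m + n). x (j + m) = x (\<sigma> j)}"
      by (auto simp: E_def less_Suc_eq)
    moreover have "{x \<in> Rn (m + n). x (j + m) = x (\<sigma> j)} \<in> S (m + n)"
      using Suc.prems \<sigma>[of j] by (intro diagonal_mem) auto
    ultimately show ?case using Suc by (auto intro: Int_mem)
  qed
  let ?D = "{x \<in> Rn (n + m). (\<lambda>i\<in>{..<n}. x (i + m)) \<in> A}"
  have "?D \<inter> E n \<in> S (m + n)"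
    using drop_mem[OF A, of m] E[of n] by (intro Int_mem) (auto simp: add.commute)
  then have "(\<lambda>x. restrict x {..<m}) ` (?D \<inter> E n) \<in> S m" by (rule take_mem)
  moreover have "(\<lambda>x. restrict x {..<m}) ` (?D \<inter> E n) = {x \<in> Rn m. (\<lambda>i\<in>{..<n}. x (\<sigma> i)) \<in> A}"
  proof (intro equalityI subsetI)
    fix y assume "y \<in> (\<lambda>x. restrict x {..<m}) ` (?D \<inter> E n)"
    then obtain x where x: "x \<in> ?D" "x \<in> E n" "y = restrict x {..<m}" by blast
    have "(\<lambda>i\<in>{..<n}. y (\<sigma> i)) = (\<lambda>i\<in>{..<n}. x (i + m))"
      using x \<sigma> by (auto simp: E_def fun_eq_iff)
    then show "y \<in> {x \<in> Rn m. (\<lambda>i\<in>{..<n}. x (\<sigma> i)) \<in> A}" using x by simp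
  next
    fix y assume y: "y \<in> {x \<in> Rn m. (\<lambda>i\<in>{..<n}. x (\<sigma> i)) \<in> A}"
    define x where "x = (\<lambda>i\<in>{..<n + m}. if i < m then y i else y (\<sigma> (i - m)))"
    have "(\<lambda>i\<in>{..<n}. x (i + m)) = (\<lambda>i\<in>{..<n}. y (\<sigma> i))"
      by (auto simp: x_def fun_eq_iff)
    then have "x \<in> ?D" using y by (auto simp: x_def split: if_splits)
    moreover have "x \<in> Rn (m + n)" by (simp add: x_def add.commute)
    then have "x \<in> E n" using \<sigma> by (auto simp: E_def x_def trans_less_add2)
    moreover have "restrict x {..<m} = y"
      using y by (auto simp: x_def fun_eq_iff PiE_iff extensional_def)
    ultimately show "y \<in> (\<lambda>x. restrict x {..<m}) ` (?D \<inter> E n)" by blast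
  qed
  ultimately show ?thesis by simp
qed

text \<open>Formulas become HOL predicates on types of real tuples: free variables are components of
  a nested pair, and a quantifier acts on the last component. Closure under the connectives then
  becomes a set of introduction rules that follow the syntax of a formula.\<close>

definition dfn :: "('a::rtuple \<Rightarrow> bool) \<Rightarrow> bool" where
  "dfn P \<longleftrightarrow> enc ` Collect P \<in> S (rdim TYPE('a))"

definition dmap :: "('a::rtuple \<Rightarrow> 'b::rtuple) \<Rightarrow> bool" where
  "dmap f \<longleftrightarrow> dfn (\<lambda>z. snd z = f (fst z))"

lemma dfn_not: "dfn P \<Longrightarrow> dfn (\<lambda>x. \<not> P x)" for P :: "'a::rtuple \<Rightarrow> bool"
proof -
  have "Rn (rdim TYPE('a)) = range (enc :: 'a \<Rightarrow> _)"
    using bij_enc by (auto simp: bij_betw_def)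
  then have "enc ` {x. \<not> P x} = Rn (rdim TYPE('a)) - enc ` Collect P"
    by (auto simp: enc_eq_iff)
  then show "dfn P \<Longrightarrow> dfn (\<lambda>x. \<not> P x)" by (simp add: dfn_def Diff_mem)
qed

lemma dfn_disj: "dfn P \<Longrightarrow> dfn Q \<Longrightarrow> dfn (\<lambda>x. P x \<or> Q x)"
  using Un_mem by (auto simp: dfn_def Collect_disj_eq image_Un)

lemma dfn_conj:
  assumes "dfn P" "dfn Q"
  shows "dfn (\<lambda>x. P x \<and> Q x)"
proof -
  have "dfn (\<lambda>x. \<not> (\<not> P x \<or> \<not> Q x))" by (intro dfn_not dfn_disj assms)
  then show ?thesis by simp
qed

lemma dfn_imp:
  assumes "dfn P" "dfn Q"
  shows "dfn (\<lambda>x. P x \<longrightarrow> Q x)"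
  unfolding imp_conv_disj by (intro dfn_not dfn_disj assms)

lemma dfn_ex: "dfn (\<lambda>z. P (fst z) (snd z)) \<Longrightarrow> dfn (\<lambda>x. \<exists>y. P x y)"
  for P :: "'a::rtuple \<Rightarrow> 'b::rtuple \<Rightarrow> bool"
proof -
  have "(\<lambda>x. restrict x {..<rdim TYPE('a)}) ` enc ` {z. P (fst z) (snd z)} = enc ` {x. \<exists>y. P x y}"
  proof (intro equalityI subsetI)
    fix u assume "u \<in> enc ` {x. \<exists>y. P x y}"
    then obtain x y where xy: "u = enc x" "P x y" by auto
    have "restrict (enc (x, y)) {..<rdim TYPE('a)} = u" using xy by (simp only: restrict_enc_Pair)
    moreover have "enc (x, y) \<in> enc ` {z. P (fst z) (snd z)}" using xy by (intro imageI) simp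
    ultimately show "u \<in> (\<lambda>x. restrict x {..<rdim TYPE('a)}) ` enc ` {z. P (fst z) (snd z)}"
      by blast
  next
    fix u assume "u \<in> (\<lambda>x. restrict x {..<rdim TYPE('a)}) ` enc ` {z. P (fst z) (snd z)}"
    then obtain x y where "u = restrict (enc (x, y)) {..<rdim TYPE('a)}" "P x y" by auto
    then show "u \<in> enc ` {x. \<exists>y. P x y}" by (auto simp only: restrict_enc_Pair)
  qed
  then show "dfn (\<lambda>z. P (fst z) (snd z)) \<Longrightarrow> dfn (\<lambda>x. \<exists>y. P x y)"
    using take_mem[of "enc ` {z. P (fst z) (snd z)}" "rdim TYPE('a)" "rdim TYPE('b)"]
    by (simp only: dfn_def rdim_prod_def)
qed

lemma dfn_all:
  fixes P :: "'a::rtuple \<Rightarrow> 'b::rtuple \<Rightarrow> bool"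
  assumes "dfn (\<lambda>z. P (fst z) (snd z))"
  shows "dfn (\<lambda>x. \<forall>y. P x y)"
proof -
  have "dfn (\<lambda>x. \<exists>y. \<not> P x y)" by (rule dfn_ex) (rule dfn_not[OF assms])
  from dfn_not[OF this] show ?thesis by (simp only: not_ex not_not)
qed

lemma dfn_reindexing:
  fixes P :: "'b::rtuple \<Rightarrow> bool" and f :: "'a::rtuple \<Rightarrow> 'b"
  assumes "dfn P" "reindexing f"
  shows "dfn (\<lambda>x. P (f x))"
proof -
  let ?a = "rdim TYPE('a)" and ?b = "rdim TYPE('b)"
  obtain \<sigma> where \<sigma>: "\<And>i. i < ?b \<Longrightarrow> \<sigma> i < ?a" "\<And>i x. i < ?b \<Longrightarrow> enc (f x) i = enc x (\<sigma> i)"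
    using assms(2) unfolding reindexing_def by metis
  have eq: "(\<lambda>i\<in>{..<?b}. enc x (\<sigma> i)) = enc (f x)" for x
    using \<sigma>(2) enc_mem[of "f x"] by (auto simp: fun_eq_iff PiE_iff extensional_def)
  have "{x \<in> Rn ?a. (\<lambda>i\<in>{..<?b}. x (\<sigma> i)) \<in> enc ` Collect P} = enc ` {x. P (f x)}"
  proof (intro equalityI subsetI)
    fix x assume "x \<in> {x \<in> Rn ?a. (\<lambda>i\<in>{..<?b}. x (\<sigma> i)) \<in> enc ` Collect P}"
    moreover then obtain a :: 'a where a: "x = enc a" using enc_surj[where 'a = 'a] by auto
    ultimately have "enc (f a) \<in> enc ` Collect P" using eq by simp
    then show "x \<in> enc ` {x. P (f x)}" using a by (auto simp: enc_eq_iff)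
  next
    fix x assume "x \<in> enc ` {x. P (f x)}"
    then show "x \<in> {x \<in> Rn ?a. (\<lambda>i\<in>{..<?b}. x (\<sigma> i)) \<in> enc ` Collect P}"
      using enc_mem eq by auto
  qed
  then show ?thesis
    using substitution_mem[of "enc ` Collect P" ?b \<sigma> ?a] assms(1) \<sigma>(1) by (simp add: dfn_def)
qed

lemma dfn_True: "dfn (\<lambda>x::'a::rtuple. True)"
proof -
  have "range (enc :: 'a \<Rightarrow> _) = Rn (rdim TYPE('a))" using bij_enc by (auto simp: bij_betw_def)
  then show "dfn (\<lambda>x::'a. True)" by (simp add: dfn_def Rn_mem)
qed

lemma dfn_eq: "dfn (\<lambda>z. fst z = (snd z :: 'a::rtuple))"
proof -
  let ?a = "rdim TYPE('a)"
  have *: "{x \<in> Rn (?a + ?a). \<forall>i<j. x i = x (i + ?a)} \<in> S (?a + ?a)" if "j \<le> ?a" for j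
    using that
  proof (induction j)
    case 0 show ?case by (simp add: Rn_mem)
  next
    case (Suc j)
    have "{x \<in> Rn (?a + ?a). \<forall>i<Suc j. x i = x (i + ?a)} =
      {x \<in> Rn (?a + ?a). \<forall>i<j. x i = x (i + ?a)} \<inter> {x \<in> Rn (?a + ?a). x j = x (j + ?a)}"
      by (auto simp: less_Suc_eq)
    then show ?case using Suc diagonal_mem[of j "?a + ?a" "j + ?a"] by (auto intro: Int_mem)
  qed
  have "enc ` {z. fst z = (snd z :: 'a)} = {x \<in> Rn (?a + ?a). \<forall>i<?a. x i = x (i + ?a)}"
  proof (intro equalityI subsetI)
    fix x assume "x \<in> enc ` {z. fst z = (snd z :: 'a)}"
    then obtain a :: 'a where "x = enc (a, a)" by auto
    then show "x \<in> {x \<in> Rn (?a + ?a). \<forall>i<?a. x i = x (i + ?a)}"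
      using enc_mem[of "(a, a)"] by (auto simp: rdim_prod_def enc_prod_def)
  next
    fix x assume x: "x \<in> {x \<in> Rn (?a + ?a). \<forall>i<?a. x i = x (i + ?a)}"
    then obtain z :: "'a \<times> 'a" where z: "x = enc z"
      using enc_surj[where 'a = "'a \<times> 'a"] by (fastforce simp: rdim_prod_def)
    have "fst z = snd z" by (rule enc_eqI) (use x z in \<open>auto simp: enc_prod_def\<close>)
    then show "x \<in> enc ` {z. fst z = (snd z :: 'a)}" using z by blast
  qed
  then show ?thesis using *[of ?a] by (simp add: dfn_def rdim_prod_def)
qed

lemma dmap_reindexing:
  fixes f :: "'a::rtuple \<Rightarrow> 'b::rtuple"
  assumes "reindexing f"
  shows "dmap f"
proof -
  have "reindexing (\<lambda>z::'a \<times> 'b. f (fst z))"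
    by (rule reindexing_comp[OF assms reindexing_fst[OF reindexing_id]])
  then have "reindexing (\<lambda>z::'a \<times> 'b. (snd z, f (fst z)))"
    by (intro reindexing_Pair reindexing_snd reindexing_id)
  from dfn_reindexing[OF dfn_eq this] show ?thesis by (simp only: dmap_def fst_conv snd_conv)
qed

text \<open>A definable map may be substituted because \<open>P (f x)\<close> says that some
  \<open>y\<close> with \<open>y = f x\<close> satisfies \<open>P\<close>, so conjunction and
  projection suffice.\<close>

lemma dfn_comp:
  fixes P :: "'b::rtuple \<Rightarrow> bool" and f :: "'a::rtuple \<Rightarrow> 'b"
  assumes "dfn P" "dmap f"
  shows "dfn (\<lambda>x. P (f x))"
proof -
  have "dfn (\<lambda>z::'a \<times> 'b. P (snd z))"
    by (rule dfn_reindexing[OF assms(1)]) (intro reindexing_intros)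
  then have "dfn (\<lambda>x. \<exists>y. y = f x \<and> P y)"
    using assms(2) unfolding dmap_def by (intro dfn_ex dfn_conj)
  then show ?thesis by simp
qed

lemma dmap_comp:
  fixes g :: "'b::rtuple \<Rightarrow> 'c::rtuple" and f :: "'a::rtuple \<Rightarrow> 'b"
  assumes g: "dmap g" and f: "dmap f"
  shows "dmap (\<lambda>x. g (f x))"
proof -
  have 1: "dfn (\<lambda>z::('a \<times> 'c) \<times> 'b. snd z = f (fst (fst z)))"
    using dfn_reindexing[OF f[unfolded dmap_def], of "\<lambda>z::('a \<times> 'c) \<times> 'b. (fst (fst z), snd z)"]
    by (simp add: reindexing_intros)
  have 2: "dfn (\<lambda>z::('a \<times> 'c) \<times> 'b. snd (fst z) = g (snd z))"
    using dfn_reindexing[OF g[unfolded dmap_def], of "\<lambda>z::('a \<times> 'c) \<times> 'b. (snd z, snd (fst z))"]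
    by (simp add: reindexing_intros)
  have "dfn (\<lambda>z::'a \<times> 'c. \<exists>y. y = f (fst z) \<and> snd z = g y)"
    by (intro dfn_ex dfn_conj 1 2)
  then show ?thesis unfolding dmap_def by simp
qed

lemma dmap_id: "dmap (\<lambda>x. x)"
  by (rule dmap_reindexing[OF reindexing_id])

lemma dmap_fst: "dmap f \<Longrightarrow> dmap (\<lambda>x. fst (f x))"
  by (rule dmap_comp[OF dmap_reindexing]) (intro reindexing_intros)

lemma dmap_snd: "dmap f \<Longrightarrow> dmap (\<lambda>x. snd (f x))"
  by (rule dmap_comp[OF dmap_reindexing]) (intro reindexing_intros)

lemma dmap_Re: "dmap f \<Longrightarrow> dmap (\<lambda>x. Re (f x))"
  by (rule dmap_comp[OF dmap_reindexing]) (intro reindexing_intros)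

lemma dmap_Im: "dmap f \<Longrightarrow> dmap (\<lambda>x. Im (f x))"
  by (rule dmap_comp[OF dmap_reindexing]) (intro reindexing_intros)

lemma dmap_Pair:
  fixes f :: "'a::rtuple \<Rightarrow> 'b::rtuple" and g :: "'a \<Rightarrow> 'c::rtuple"
  assumes f: "dmap f" and g: "dmap g"
  shows "dmap (\<lambda>x. (f x, g x))"
proof -
  have 1: "dfn (\<lambda>z::'a \<times> 'b \<times> 'c. fst (snd z) = f (fst z))"
    using dfn_reindexing[OF f[unfolded dmap_def], of "\<lambda>z::'a \<times> 'b \<times> 'c. (fst z, fst (snd z))"]
    by (simp add: reindexing_intros)
  have 2: "dfn (\<lambda>z::'a \<times> 'b \<times> 'c. snd (snd z) = g (fst z))"
    using dfn_reindexing[OF g[unfolded dmap_def], of "\<lambda>z::'a \<times> 'b \<times> 'c. (fst z, snd (snd z))"]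
    by (simp add: reindexing_intros)
  show ?thesis unfolding dmap_def prod_eq_iff fst_conv snd_conv by (intro dfn_conj 1 2)
qed

lemma dmap_Complex: "dmap f \<Longrightarrow> dmap g \<Longrightarrow> dmap (\<lambda>x. Complex (f x) (g x))"
  using dmap_comp[OF dmap_reindexing dmap_Pair, of "\<lambda>z. Complex (fst z) (snd z)" f g]
  by (simp add: reindexing_intros)

lemma dmap_comp2:
  assumes "dmap (\<lambda>z. h (fst z) (snd z))" "dmap f" "dmap g"
  shows "dmap (\<lambda>x. h (f x) (g x))"
  using dmap_comp[OF assms(1) dmap_Pair[OF assms(2,3)]] by simp

lemma dfn_comp2:
  assumes "dfn (\<lambda>z. P (fst z) (snd z))" "dmap f" "dmap g"
  shows "dfn (\<lambda>x. P (f x) (g x))"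
  using dfn_comp[OF assms(1) dmap_Pair[OF assms(2,3)]] by simp

lemma dfn_equal: "dmap f \<Longrightarrow> dmap g \<Longrightarrow> dfn (\<lambda>x. f x = g x)"
  by (rule dfn_comp2[of "(=)", OF dfn_eq])

section \<open>Definable arithmetic on the reals and the plane\<close>

lemma dfn_real_const: "dfn (\<lambda>x::real. x = c)"
proof -
  \<comment> \<open>A singleton is an interval, so the axiom on \<open>S 1\<close> makes every real
    number a parameter.\<close>
  have "enc ` {x::real. x = c} \<in> S 1"
    unfolding o_minimality
    using enc_mem[of c] by (auto simp: rdim_real_def enc_real_def is_interval_1 intro!: exI[of _ "{{c}}"])
  then show ?thesis by (simp add: dfn_def rdim_real_def)
qed

lemma dmap_real_const: "dmap (\<lambda>x::'a::rtuple. c::real)"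
  unfolding dmap_def
  by (rule dfn_comp[OF dfn_real_const]) (intro dmap_snd dmap_id)

lemma dmap_complex_const: "dmap (\<lambda>x::'a::rtuple. c::complex)"
  using dmap_Complex[OF dmap_real_const dmap_real_const, of "Re c" "Im c"] by simp

lemma enc_Rn3: "Rn 3 = range (enc :: (real \<times> real) \<times> real \<Rightarrow> _)"
  using bij_enc[where 'a = "(real \<times> real) \<times> real"]
  by (simp add: bij_betw_def rdim_prod_def rdim_real_def numeral_3_eq_3)

lemma dmap_of_graph3:
  assumes "{x \<in> Rn 3. h (x 0) (x 1) = x 2} \<in> S 3"
  shows "dmap (\<lambda>z::real \<times> real. h (fst z) (snd z))"
proof -
  have 3: "rdim TYPE((real \<times> real) \<times> real) = 3" by (simp add: rdim_prod_def rdim_real_def)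
  have "enc ` {z :: (real \<times> real) \<times> real. snd z = h (fst (fst z)) (snd (fst z))} =
      {x \<in> Rn 3. h (x 0) (x 1) = x 2}"
    unfolding enc_Rn3 by (auto simp: enc_prod_def rdim_prod_def rdim_real_def enc_real_def)
  then show ?thesis using assms by (simp add: dmap_def dfn_def 3)
qed

lemma dmap_add: "dmap f \<Longrightarrow> dmap g \<Longrightarrow> dmap (\<lambda>x. f x + g x :: real)"
  by (rule dmap_comp2[OF dmap_of_graph3[of "(+)", OF add_mem]])

lemma dmap_mult: "dmap f \<Longrightarrow> dmap g \<Longrightarrow> dmap (\<lambda>x. f x * g x :: real)"
  by (rule dmap_comp2[OF dmap_of_graph3[of "(*)", OF mult_mem]])

lemma dmap_uminus: "dmap f \<Longrightarrow> dmap (\<lambda>x. - f x :: real)"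
  using dmap_mult[OF dmap_real_const[of "-1"]] by simp

lemma dmap_diff: "dmap f \<Longrightarrow> dmap g \<Longrightarrow> dmap (\<lambda>x. f x - g x :: real)"
  using dmap_add[OF _ dmap_uminus, of f g] by simp

lemma dmap_power: "dmap f \<Longrightarrow> dmap (\<lambda>x. f x ^ n :: real)"
  by (induction n) (auto intro: dmap_mult dmap_real_const)

lemma dfn_less:
  assumes "dmap f" "dmap g"
  shows "dfn (\<lambda>x. f x < (g x :: real))"
proof (rule dfn_comp2[OF _ assms])
  \<comment> \<open>The order relation is not among the axioms; it is recovered from the field,
    where the positive elements are the nonzero squares.\<close>
  have "(x < y) = (\<exists>w::real. w \<noteq> 0 \<and> x + w * w = y)" for x y :: real
  proof
    assume "x < y"
    then show "\<exists>w::real. w \<noteq> 0 \<and> x + w * w = y"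
      by (intro exI[of _ "sqrt (y - x)"]) auto
  next
    assume "\<exists>w::real. w \<noteq> 0 \<and> x + w * w = y"
    then show "x < y" by (smt (verit) zero_less_mult_iff not_real_square_gt_zero)
  qed
  moreover have "dfn (\<lambda>z::real \<times> real. \<exists>w::real. w \<noteq> 0 \<and> fst z + w * w = snd z)"
    by (intro dfn_ex dfn_conj dfn_not dfn_equal dmap_add dmap_mult dmap_snd dmap_fst dmap_id
        dmap_real_const)
  ultimately show "dfn (\<lambda>z::real \<times> real. fst z < snd z)" by simp
qed

lemma dfn_le: "dmap f \<Longrightarrow> dmap g \<Longrightarrow> dfn (\<lambda>x. f x \<le> (g x :: real))"
  using dfn_not[OF dfn_less, of g f] by (simp add: not_less)

lemma dmap_inverse:
  assumes "dmap f"
  shows "dmap (\<lambda>x. inverse (f x) :: real)"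
proof (rule dmap_comp[OF _ assms])
  have "(y = inverse x) = (x * y = 1 \<or> x = 0 \<and> y = 0)" for x y :: real
    by (metis inverse_unique inverse_zero mult_zero_left right_inverse zero_neq_one)
  moreover have "dfn (\<lambda>z::real \<times> real. fst z * snd z = 1 \<or> fst z = 0 \<and> snd z = 0)"
    by (intro dfn_disj dfn_conj dfn_equal dmap_mult dmap_snd dmap_fst dmap_id dmap_real_const)
  ultimately show "dmap (\<lambda>x. inverse x :: real)" by (simp add: dmap_def)
qed

lemma dmap_max:
  assumes "dmap f" "dmap g"
  shows "dmap (\<lambda>x. max (f x) (g x) :: real)"
proof (rule dmap_comp2[OF _ assms])
  have "(w = max x y) = (x \<le> y \<and> w = y \<or> y \<le> x \<and> w = x)" for x y w :: real by auto
  moreover have "dfn (\<lambda>z::(real \<times> real) \<times> real. fst (fst z) \<le> snd (fst z) \<and> snd z = snd (fst z) \<or>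
      snd (fst z) \<le> fst (fst z) \<and> snd z = fst (fst z))"
    by (intro dfn_disj dfn_conj dfn_equal dfn_le dmap_snd dmap_fst dmap_id)
  ultimately show "dmap (\<lambda>z::real \<times> real. max (fst z) (snd z))" by (simp add: dmap_def)
qed

lemma dmap_norm:
  assumes "dmap f"
  shows "dmap (\<lambda>x. norm (f x :: complex))"
proof (rule dmap_comp[OF _ assms])
  have "(w = norm z) = (0 \<le> w \<and> w * w = Re z * Re z + Im z * Im z)" for w and z :: complex
    by (metis cmod_power2 norm_ge_zero power2_eq_iff_nonneg power2_eq_square)
  moreover have "dfn (\<lambda>z::complex \<times> real. 0 \<le> snd z \<and>
      snd z * snd z = Re (fst z) * Re (fst z) + Im (fst z) * Im (fst z))"
    by (intro dfn_conj dfn_equal dfn_le dmap_add dmap_mult dmap_Re dmap_Im dmap_snd dmap_fst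
        dmap_id dmap_real_const)
  ultimately show "dmap (\<lambda>x::complex. norm x)" by (simp add: dmap_def)
qed

lemma dmap_complex_add: "dmap f \<Longrightarrow> dmap g \<Longrightarrow> dmap (\<lambda>x. f x + g x :: complex)"
  using dmap_Complex[OF dmap_add[OF dmap_Re dmap_Re] dmap_add[OF dmap_Im dmap_Im], of f g f g]
  by (simp add: complex_eq_iff[symmetric] plus_complex.code)

lemma dmap_scaleR: "dmap f \<Longrightarrow> dmap g \<Longrightarrow> dmap (\<lambda>x. f x *\<^sub>R (g x :: complex))"
  using dmap_Complex[OF dmap_mult[OF _ dmap_Re] dmap_mult[OF _ dmap_Im], of f g f g]
  by (simp add: scaleR_complex.code)

lemma dmap_complex_diff: "dmap f \<Longrightarrow> dmap g \<Longrightarrow> dmap (\<lambda>x. f x - g x :: complex)"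
  using dmap_complex_add[OF _ dmap_scaleR[OF dmap_real_const], of f g "-1"] by simp

lemma dmap_dist: "dmap f \<Longrightarrow> dmap g \<Longrightarrow> dmap (\<lambda>x. dist (f x) (g x :: complex))"
  unfolding dist_norm by (intro dmap_norm dmap_complex_diff)

lemmas dmap_intros = dmap_id dmap_fst dmap_snd dmap_Re dmap_Im dmap_Pair dmap_Complex
  dmap_real_const dmap_complex_const dmap_add dmap_mult dmap_uminus dmap_diff dmap_power
  dmap_inverse dmap_max dmap_norm dmap_complex_add dmap_scaleR dmap_complex_diff dmap_dist

lemmas dfn_intros = dfn_not dfn_disj dfn_conj dfn_imp dfn_ex dfn_all dfn_equal dfn_less dfn_le
  dfn_True

section \<open>The notions of the statement as definable predicates and maps\<close>

lemma definable_set_iff: "definable_set S X \<longleftrightarrow> dfn (\<lambda>z. z \<in> X)"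
proof -
  have "coords X = enc ` X"
  proof (intro equalityI subsetI)
    fix x assume x: "x \<in> coords X"
    then obtain z :: complex where "x = enc z"
      using enc_surj[where 'a = complex] by (auto simp: coords_def rdim_complex_def)
    then show "x \<in> enc ` X" using x by (auto simp: coords_def enc_complex_def)
  next
    fix x assume "x \<in> enc ` X"
    then obtain z where z: "x = enc z" "z \<in> X" by blast
    have "Complex (enc z 0) (enc z 1) = z" by (simp add: enc_complex_def complex_eq_iff)
    then show "x \<in> coords X" using enc_mem[of z] z by (simp add: coords_def rdim_complex_def)
  qed
  then show ?thesis by (simp add: definable_set_def dfn_def rdim_complex_def)
qed

lemma definable_map_iff: "definable_map S X f \<longleftrightarrow> dfn (\<lambda>z. fst z \<in> X \<and> snd z = f (fst z))"
proof -
  have 4: "rdim TYPE(complex \<times> complex) = 4" by (simp add: rdim_prod_def rdim_complex_def)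
  let ?A = "{x \<in> Rn 4. Complex (x 0) (x 1) \<in> X \<and> f (Complex (x 0) (x 1)) = Complex (x 2) (x 3)}"
  have *: "Complex (enc z 0) (enc z 1) = fst z" "Complex (enc z 2) (enc z 3) = snd z"
    for z :: "complex \<times> complex"
    by (auto simp: enc_prod_def enc_complex_def rdim_complex_def complex_eq_iff)
  have "?A = enc ` {z. fst z \<in> X \<and> snd z = f (fst z)}"
  proof (intro equalityI subsetI)
    fix x assume x: "x \<in> ?A"
    then obtain z :: "complex \<times> complex" where "x = enc z"
      using enc_surj[where 'a = "complex \<times> complex"] 4 by (metis (lifting) mem_Collect_eq)
    moreover from this x have "fst z \<in> X \<and> snd z = f (fst z)" by (simp only: mem_Collect_eq *)
    ultimately show "x \<in> enc ` {z. fst z \<in> X \<and> snd z = f (fst z)}" by blast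
  next
    fix x assume "x \<in> enc ` {z. fst z \<in> X \<and> snd z = f (fst z)}"
    then obtain z where "x = enc z" "fst z \<in> X" "snd z = f (fst z)" by blast
    then show "x \<in> ?A" using enc_mem[of z] by (simp only: mem_Collect_eq * 4 complex.collapse)
  qed
  then show ?thesis by (simp add: definable_map_def dfn_def 4)
qed

lemma definable_map_UNIV: "definable_map S UNIV F \<longleftrightarrow> dmap F"
  by (simp add: definable_map_iff dmap_def)

section \<open>Definable subsets of the line\<close>

lemma dfn_real_intervals:
  assumes "dfn (P :: real \<Rightarrow> bool)"
  obtains \<I> where "finite \<I>" "\<And>I. I \<in> \<I> \<Longrightarrow> is_interval I" "{r. P r} = \<Union>\<I>"
proof -
  have "enc ` {r. P r} \<in> S 1" using assms by (simp add: dfn_def rdim_real_def)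
  then obtain \<I> where \<I>: "finite \<I>" "\<forall>I\<in>\<I>. is_interval I" "(\<lambda>x. x 0) ` enc ` {r. P r} = \<Union>\<I>"
    unfolding o_minimality by blast
  moreover have "(\<lambda>x. x 0) ` enc ` {r. P r} = {r. P r}"
    by (simp add: image_image enc_real_def)
  ultimately show ?thesis by (intro that[of \<I>]) auto
qed

lemma dfn_infinite_interval:
  assumes "dfn P" "infinite {r::real. P r}"
  obtains a b where "a < b" "\<And>r. a < r \<Longrightarrow> r < b \<Longrightarrow> P r"
proof -
  obtain \<I> where \<I>: "finite \<I>" "\<And>I. I \<in> \<I> \<Longrightarrow> is_interval I" "{r. P r} = \<Union>\<I>"
    using dfn_real_intervals[OF assms(1)] by auto
  then obtain I where I: "I \<in> \<I>" "infinite I" using assms(2) finite_Union[of \<I>] by auto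
  have "I \<noteq> {}" using I(2) by auto
  then obtain a where a: "a \<in> I" by blast
  have "I \<noteq> {a}" using I(2) by auto
  then obtain b where b: "b \<in> I" "b \<noteq> a" using a by blast
  have "\<exists>a b. a \<in> I \<and> b \<in> I \<and> a < b"
    using a b by (metis linorder_neqE)
  then obtain a b where ab: "a \<in> I" "b \<in> I" "a < b" by blast
  have "P r" if "a < r" "r < b" for r
  proof -
    have "r \<in> I" using \<I>(2)[OF I(1)] ab that unfolding is_interval_1 by (meson less_imp_le)
    then show ?thesis using \<I>(3) I(1) by blast
  qed
  then show ?thesis by (rule that[OF ab(3)])
qed

text \<open>Finitely many intervals make up the set; if it is unbounded above, so is one of them,
  and that interval contains a half-line. Hence, to show that a definable property of the radius
  eventually fails, it is enough to refute that it eventually holds.\<close>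

lemma dfn_eventually_at_top:
  assumes "dfn P" "\<exists>\<^sub>F r::real in at_top. P r"
  shows "\<forall>\<^sub>F r in at_top. P r"
proof -
  obtain \<I> where \<I>: "finite \<I>" "\<And>I. I \<in> \<I> \<Longrightarrow> is_interval I" "{r. P r} = \<Union>\<I>"
    using dfn_real_intervals[OF assms(1)] by auto
  have "\<exists>I\<in>\<I>. \<not> bdd_above I"
  proof (rule ccontr)
    assume "\<not> ?thesis"
    then have "bdd_above {r. P r}" using \<I>(1,3) bdd_above_UN[of \<I> "\<lambda>I. I"] by simp
    then obtain M where "\<And>r. P r \<Longrightarrow> r \<le> M" by (auto simp: bdd_above_def)
    then have "\<forall>\<^sub>F r in at_top. \<not> P r"
      by (intro eventually_at_top_linorderI[of "M + 1"]) force
    then show False using assms(2) by (simp add: frequently_def)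
  qed
  then obtain I where I: "I \<in> \<I>" "\<not> bdd_above I" by (elim bexE)
  then have unb: "\<exists>x\<in>I. M < x" for M by (meson bdd_above.I not_le)
  obtain a where a: "a \<in> I" using unb by blast
  have "P r" if "a \<le> r" for r
  proof -
    obtain x where "x \<in> I" "r < x" using unb by blast
    then have "r \<in> I" using \<I>(2)[OF I(1)] a that unfolding is_interval_1 by (meson less_imp_le)
    then show ?thesis using \<I>(3) I(1) by blast
  qed
  then show ?thesis by (rule eventually_at_top_linorderI)
qed

text \<open>An unbounded family covered by countably many definable sets is, by uncountability, infinite
  in one of them, which then contains an interval by o-minimality.\<close>

lemma dfn_countable_cover:
  fixes Q :: "'k::countable \<Rightarrow> real \<Rightarrow> bool"
  assumes "\<And>k. dfn (Q k)" "\<forall>\<^sub>F r in at_top. \<exists>k. Q k r"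
  obtains k a b where "a < b" "\<And>r. a < r \<Longrightarrow> r < b \<Longrightarrow> Q k r"
proof -
  obtain c where c: "\<And>r. c \<le> r \<Longrightarrow> \<exists>k. Q k r"
    using assms(2) by (auto simp: eventually_at_top_linorder)
  have "\<exists>k. infinite {r. Q k r}"
  proof (rule ccontr)
    assume "\<not> ?thesis"
    then have "countable (\<Union>k. {r. Q k r})" by (auto intro: countable_finite)
    moreover have "{c..c + 1} \<subseteq> (\<Union>k. {r. Q k r})" using c by auto
    ultimately have "countable {c..c + 1}" by (rule countable_subset[rotated])
    then show False using uncountable_closed_interval[of c "c + 1"] by simp
  qed
  then obtain k where "infinite {r. Q k r}" ..
  from dfn_infinite_interval[OF assms(1)[of k] this] obtain a b
    where "a < b" "\<And>r. a < r \<Longrightarrow> r < b \<Longrightarrow> Q k r" by blast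
  then show ?thesis by (rule that)
qed

end

section \<open>The dimension bound and empty interior\<close>

lemma cell_bound_const:
  "graph_on n C (\<lambda>_. c) \<in> S (Suc n) \<Longrightarrow> cell_bound S n C (\<lambda>_. ereal c)"
  unfolding cell_bound_def
  by (rule disjI2, rule disjI2, rule exI[of _ "\<lambda>_. c"]) (intro conjI ballI refl continuous_on_const)

text \<open>An open rectangle inside \<open>X\<close> would be a cell of type (1, 1), which
  contributes 2 to the supremum. Empty interior is the form in which the dimension bound
  enters.\<close>

lemma (in o_minimal_field_expansion) interior_empty_of_odim_le_1:
  assumes "odim S 2 (coords X) \<le> 1"
  shows "interior X = {}"
proof (rule ccontr)
  assume "interior X \<noteq> {}"
  then obtain w where "w \<in> interior X" by blast
  then obtain u v where uv: "w \<in> box u v" "box u v \<subseteq> X"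
    by (meson open_contains_box interior_subset open_interior order_trans)
  have box: "box u v = {z. Re u < Re z \<and> Re z < Re v \<and> Im u < Im z \<and> Im z < Im v}"
    by (auto simp: in_box_complex_iff)
  have lt: "Re u < Re v" "Im u < Im v" using uv(1) by (auto simp: box)
  define C where "C = {x \<in> Rn (Suc 0). restrict x {..<0} \<in> Rn 0 \<and>
    ereal (Re u) < ereal (x 0) \<and> ereal (x 0) < ereal (Re v)}"
  define D where "D = {x \<in> Rn (Suc 1). restrict x {..<1} \<in> C \<and>
    ereal (Im u) < ereal (x 1) \<and> ereal (x 1) < ereal (Im v)}"
  have const0: "cell_bound S 0 (Rn 0) (\<lambda>_. ereal c)" for c
  proof -
    have "graph_on 0 (Rn 0) (\<lambda>_. c) = {enc c}"
    proof (intro equalityI subsetI)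
      fix x assume x: "x \<in> graph_on 0 (Rn 0) (\<lambda>_. c)"
      then obtain d :: real where d: "x = enc d"
        using enc_surj[where 'a = real] by (auto simp: graph_on_def rdim_real_def)
      then show "x \<in> {enc c}" using x by (simp add: graph_on_def enc_real_def)
    next
      fix x assume "x \<in> {enc c}"
      then show "x \<in> graph_on 0 (Rn 0) (\<lambda>_. c)"
        using enc_mem[of c] by (simp add: graph_on_def rdim_real_def enc_real_def fun_eq_iff PiE_iff extensional_def)
    qed
    then have "graph_on 0 (Rn 0) (\<lambda>_. c) \<in> S (Suc 0)"
      using dfn_real_const[of c] by (simp add: dfn_def rdim_real_def)
    then show ?thesis by (rule cell_bound_const)
  qed
  have C_iff: "restrict x {..<1} \<in> C \<longleftrightarrow> Re u < x 0 \<and> x 0 < Re v" for x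
    by (simp add: C_def fun_eq_iff)
  have const1: "cell_bound S 1 C (\<lambda>_. ereal c)" for c
  proof -
    have "graph_on 1 C (\<lambda>_. c) = coords {z. Re u < Re z \<and> Re z < Re v \<and> Im z = c}"
      unfolding graph_on_def C_iff coords_def numeral_2_eq_2 by auto
    moreover have "definable_set S {z. Re u < Re z \<and> Re z < Re v \<and> Im z = c}"
      unfolding definable_set_iff mem_Collect_eq by (intro dfn_intros dmap_intros)
    ultimately have "graph_on 1 C (\<lambda>_. c) \<in> S (Suc 1)"
      by (simp add: definable_set_def numeral_2_eq_2)
    then show ?thesis by (rule cell_bound_const)
  qed
  have "cell S ([] @ [1]) C"
    unfolding C_def using lt by (intro cell.band cell.point const0) auto
  then have "cell S (([] @ [1]) @ [1]) D"
    unfolding D_def using lt by (intro cell.band const1) auto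
  moreover have "D \<subseteq> coords X"
    using uv(2) unfolding D_def C_iff coords_def box numeral_2_eq_2 by auto
  ultimately have "[1, 1] \<in> {i. length i = 2 \<and> (\<exists>C. cell S i C \<and> C \<subseteq> coords X)}" by auto
  then have "ereal (real (sum_list [1, 1])) \<le> odim S 2 (coords X)"
    unfolding odim_def by (rule SUP_upper)
  then have "ereal 2 \<le> 1" using assms by (simp add: one_ereal_def del: ereal_less_eq)
  then show False by (simp add: one_ereal_def)
qed

section \<open>Planar definable sets near infinity\<close>

subsection \<open>Finite fibres and good points\<close>

text \<open>Inverse stereographic projection from \<open>-1\<close>, a rational parametrisation of
  the unit circle without that point. It is chosen over \<open>cis\<close> because it is definable
  from the field operations, whereas sine and cosine need not be definable.\<close>

definition unit_param :: "real \<Rightarrow> complex" where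
  "unit_param t = Complex ((1 - t\<^sup>2) * inverse (1 + t\<^sup>2)) (2 * t * inverse (1 + t\<^sup>2))"

lemma one_plus_square_pos: "0 < 1 + (t::real)\<^sup>2"
  by (simp add: add_pos_nonneg)

lemma norm_unit_param [simp]: "norm (unit_param t) = 1"
proof -
  have "(1 - t\<^sup>2)\<^sup>2 + (2 * t)\<^sup>2 = (1 + t\<^sup>2)\<^sup>2" by algebra
  then have "((1 - t\<^sup>2) * inverse (1 + t\<^sup>2))\<^sup>2 + (2 * t * inverse (1 + t\<^sup>2))\<^sup>2 = 1"
    using one_plus_square_pos[of t]
    by (simp add: power_mult_distrib field_simps flip: add_divide_distrib distrib_right)
  then show ?thesis by (simp add: unit_param_def cmod_def)
qed

lemma unit_param_inverse: "Im (unit_param t) / (1 + Re (unit_param t)) = t"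
proof -
  have "1 + (1 - t\<^sup>2) * inverse (1 + t\<^sup>2) = 2 * inverse (1 + t\<^sup>2)"
    using one_plus_square_pos[of t] by (simp add: field_simps)
  then show ?thesis using one_plus_square_pos[of t] by (simp add: unit_param_def)
qed

lemma unit_param_surj:
  assumes "norm z = 1" "z \<noteq> -1"
  shows "unit_param (Im z / (1 + Re z)) = z"
proof -
  define x y where xy: "x = Re z" "y = Im z"
  have 1: "x\<^sup>2 + y\<^sup>2 = 1" using assms(1) by (simp add: xy cmod_def)
  have "x \<noteq> -1"
  proof
    assume "x = -1"
    then have "y = 0" using 1 by simp
    then show False using assms(2) \<open>x = -1\<close> by (simp add: xy complex_eq_iff)
  qed
  then have x: "1 + x \<noteq> 0" by auto
  have sq: "(y / (1 + x))\<^sup>2 = (1 - x) / (1 + x)"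
  proof -
    have "y\<^sup>2 = (1 - x) * (1 + x)" using 1 by (simp add: algebra_simps power2_eq_square)
    then show ?thesis using x by (simp add: power_divide power2_eq_square)
  qed
  have inv: "inverse (1 + (y / (1 + x))\<^sup>2) = (1 + x) / 2"
    and dif: "1 - (y / (1 + x))\<^sup>2 = 2 * x / (1 + x)"
    unfolding sq using x by (simp_all add: field_simps)
  have "unit_param (y / (1 + x)) = Complex (2 * x / (1 + x) * ((1 + x) / 2)) (2 * (y / (1 + x)) * ((1 + x) / 2))"
    unfolding unit_param_def inv dif ..
  also have "\<dots> = Complex x y" using x by simp
  finally show ?thesis by (simp add: xy)
qed

lemma continuous_on_unit_param [continuous_intros]:
  assumes "continuous_on A f"
  shows "continuous_on A (\<lambda>x. unit_param (f x))"
proof -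
  have "1 + t\<^sup>2 \<noteq> 0" for t :: real using one_plus_square_pos[of t] by simp
  then show ?thesis
    unfolding unit_param_def Complex_eq by (intro continuous_intros assms) auto
qed

text \<open>The polar map is continuous and injective on the rectangle of parameters, since the norm
  returns \<open>r\<close> and stereographic projection returns \<open>t\<close>; invariance of
  domain makes the image open.\<close>

lemma interior_polar_box:
  assumes "a < b" "c < d" "0 \<le> c"
    and sub: "\<And>r t. c < r \<Longrightarrow> r < d \<Longrightarrow> a < t \<Longrightarrow> t < b \<Longrightarrow> r *\<^sub>R unit_param t \<in> X"
  shows "interior X \<noteq> {}"
proof -
  let ?f = "\<lambda>p::real \<times> real. fst p *\<^sub>R unit_param (snd p)"
  let ?B = "{c<..<d} \<times> {a<..<b}"
  have "inj_on ?f ?B"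
  proof (rule inj_onI)
    fix p q assume p: "p \<in> ?B" and q: "q \<in> ?B" and eq: "?f p = ?f q"
    have "norm (?f p) = norm (?f q)" using eq by simp
    then have 1: "fst p = fst q" using p q \<open>0 \<le> c\<close> by auto
    then have "unit_param (snd p) = unit_param (snd q)" using eq p \<open>0 \<le> c\<close> by auto
    then have "snd p = snd q" by (metis unit_param_inverse)
    then show "p = q" using 1 by (simp add: prod_eq_iff)
  qed
  then have "open (?f ` ?B)"
    by (intro invariance_of_domain_gen continuous_intros open_Times) auto
  moreover have "?f ` ?B \<subseteq> X" using sub by auto
  ultimately have "?f ` ?B \<subseteq> interior X" by (rule interior_maximal[rotated])
  moreover have "((c + d) / 2, (a + b) / 2) \<in> ?B" using assms(1,2) by simp
  ultimately show ?thesis by blast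
qed

text \<open>A first-order condition which, for closed \<open>X\<close>, forces \<open>X\<close> to be the image of a continuous
  section of the norm near \<open>z\<close>. Continuity needs the unique point to stay off the boundary of the
  disk.\<close>

definition single_point :: "complex set \<Rightarrow> complex \<Rightarrow> real \<Rightarrow> real \<Rightarrow> bool" where
  "single_point X w \<delta> r \<longleftrightarrow> (\<exists>y. y \<in> X \<and> norm y = r \<and> dist y w < \<delta> \<and>
     (\<forall>y'. y' \<in> X \<and> norm y' = r \<and> dist y' w \<le> \<delta> \<longrightarrow> y' = y))"

definition good_point :: "complex set \<Rightarrow> complex \<Rightarrow> bool" where
  "good_point X z \<longleftrightarrow> (\<exists>w \<delta> a b. a < norm z \<and> norm z < b \<and> dist z w < \<delta> \<and>
     (\<forall>r. a < r \<and> r < b \<longrightarrow> single_point X w \<delta> r))"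

context o_minimal_field_expansion
begin

lemma eventually_finite_sphere:
  assumes X: "definable_set S X" and int: "interior X = {}"
  shows "\<forall>\<^sub>F r in at_top. finite (X \<inter> sphere 0 r)"
proof (rule ccontr)
  assume not_fin: "\<not> ?thesis"
  \<comment> \<open>The circle of radius \<open>r\<close> meets \<open>X\<close> in a whole arc,
    given by an interval of the stereographic parameter. The conjunct \<open>0 < r\<close> later
    forces the interval of radii into the positive half-line, as \<open>interior_polar_box\<close>
    requires.\<close>
  define Q where "Q a b r \<longleftrightarrow> a < b \<and> 0 < r \<and> (\<forall>t. a < t \<and> t < b \<longrightarrow> r *\<^sub>R unit_param t \<in> X)"
    for a b r
  note dX = X[unfolded definable_set_iff]
  have dQ: "dfn (\<lambda>r. Q a b r)" for a b
    unfolding Q_def unit_param_def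
    by (intro dfn_intros dmap_intros dfn_comp[OF dX])
  have dQ': "dfn (\<lambda>r. \<exists>a b. Q a b r)"
    unfolding Q_def unit_param_def
    by (intro dfn_intros dmap_intros dfn_comp[OF dX])
  have Q: "\<exists>a b. Q a b r" if r: "0 < r" "infinite (X \<inter> sphere 0 r)" for r
  proof -
    let ?T = "{t. r *\<^sub>R unit_param t \<in> X}"
    \<comment> \<open>Stereographic projection misses one point of the circle, namely
      \<open>- of_real r\<close>; adding it does not affect infinitude.\<close>
    have "X \<inter> sphere 0 r \<subseteq> insert (- of_real r) ((\<lambda>t. r *\<^sub>R unit_param t) ` ?T)"
    proof
      fix z assume z: "z \<in> X \<inter> sphere 0 r"
      show "z \<in> insert (- of_real r) ((\<lambda>t. r *\<^sub>R unit_param t) ` ?T)"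
      proof (cases "z = - of_real r")
        case False
        define u where "u = z /\<^sub>R r"
        have zu: "z = r *\<^sub>R u" using r(1) by (simp add: u_def)
        moreover have "norm u = 1" using z r(1) by (simp add: u_def)
        moreover have "u \<noteq> -1" using zu False by (auto simp: scaleR_conv_of_real)
        ultimately have "z = r *\<^sub>R unit_param (Im u / (1 + Re u))" using unit_param_surj by simp
        then show ?thesis using z by auto
      qed simp
    qed
    then have "infinite ?T" using r(2) by (meson finite_imageI finite_insert finite_subset)
    moreover have "dfn (\<lambda>t. r *\<^sub>R unit_param t \<in> X)"
      unfolding unit_param_def by (intro dfn_comp[OF dX] dmap_intros)
    ultimately obtain a b where "a < b" "\<And>t. a < t \<Longrightarrow> t < b \<Longrightarrow> r *\<^sub>R unit_param t \<in> X"
      using dfn_infinite_interval by blast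
    then show ?thesis using r(1) by (auto simp: Q_def)
  qed
  have "\<exists>\<^sub>F r in at_top. infinite (X \<inter> sphere 0 r)" using not_fin by (simp add: frequently_def)
  from frequently_eventually_frequently[OF this eventually_gt_at_top[of 0]]
  have "\<exists>\<^sub>F r in at_top. \<exists>a b. Q a b r" by (rule frequently_elim1) (use Q in blast)
  then have "\<forall>\<^sub>F r in at_top. \<exists>a b. Q a b r" by (rule dfn_eventually_at_top[OF dQ'])
  then have "\<forall>\<^sub>F r in at_top. \<exists>k::rat \<times> rat. Q (of_rat (fst k)) (of_rat (snd k)) r"
  proof (rule eventually_mono)
    fix r assume "\<exists>a b. Q a b r"
    then obtain a b where ab: "Q a b r" by blast
    then have "a < b" by (simp add: Q_def)
    then obtain a' where a': "a < of_rat a'" "of_rat a' < b" using of_rat_dense by blast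
    obtain b' where b': "real_of_rat a' < of_rat b'" "of_rat b' < b" using of_rat_dense[OF a'(2)] by blast
    have "Q (of_rat a') (of_rat b') r" using ab a' b' by (auto simp: Q_def)
    then show "\<exists>k::rat \<times> rat. Q (of_rat (fst k)) (of_rat (snd k)) r"
      by (intro exI[of _ "(a', b')"]) simp
  qed
  from dfn_countable_cover[of "\<lambda>k::rat \<times> rat. Q (of_rat (fst k)) (of_rat (snd k))", OF dQ this]
  obtain k c d where cd: "c < d" "\<And>r. c < r \<Longrightarrow> r < d \<Longrightarrow> Q (of_rat (fst k)) (of_rat (snd k)) r"
    by (metis (lifting))
  have "0 \<le> c"
  proof (rule ccontr)
    assume "\<not> 0 \<le> c"
    then obtain r where "c < r" "r < min d 0" using dense[of c "min d 0"] cd(1) by auto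
    then show False using cd(2)[of r] by (auto simp: Q_def)
  qed
  moreover have "of_rat (fst k) < (of_rat (snd k) :: real)"
    using cd dense[OF cd(1)] by (auto simp: Q_def)
  ultimately have "interior X \<noteq> {}"
    using cd by (intro interior_polar_box[of "of_rat (fst k)" "of_rat (snd k)" c d]) (auto simp: Q_def)
  then show False using int by simp
qed

lemma eventually_good_point:
  assumes X: "definable_set S X" and fin: "\<forall>\<^sub>F r in at_top. finite (X \<inter> sphere 0 r)"
  shows "\<forall>\<^sub>F r in at_top. \<forall>z. z \<in> X \<and> norm z = r \<longrightarrow> good_point X z"
proof (rule ccontr)
  assume "\<not> ?thesis"
  moreover have "\<forall>\<^sub>F r in at_top. \<forall>z. z \<in> X \<and> norm z = r \<longrightarrow> good_point X z"
    if "\<forall>\<^sub>F r in at_top. \<not> (\<exists>z. z \<in> X \<and> norm z = r \<and> \<not> good_point X z)"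
    using that by (rule eventually_mono) blast
  ultimately have freq: "\<exists>\<^sub>F r in at_top. \<exists>z. z \<in> X \<and> norm z = r \<and> \<not> good_point X z"
    unfolding frequently_def by blast
  note dX = X[unfolded definable_set_iff]
  have dS: "dfn (\<lambda>x::'a::rtuple. single_point X (w x) (\<delta> x) (r x))"
    if "dmap w" "dmap \<delta>" "dmap r" for w \<delta> r
    unfolding single_point_def
    by (intro dfn_intros dmap_intros dfn_comp[OF dX]
        dmap_comp[OF that(1)] dmap_comp[OF that(2)] dmap_comp[OF that(3)])
  have dG: "dfn (\<lambda>x::'a::rtuple. good_point X (z x))" if "dmap z" for z
    unfolding good_point_def
    by (intro dfn_intros dmap_intros dS dmap_comp[OF that])
  have "dfn (\<lambda>r. \<exists>z. z \<in> X \<and> norm z = r \<and> \<not> good_point X z)"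
    by (intro dfn_intros dmap_intros dG dfn_comp[OF dX])
  then have bad: "\<forall>\<^sub>F r in at_top. \<exists>z. z \<in> X \<and> norm z = r \<and> \<not> good_point X z"
    using freq by (rule dfn_eventually_at_top)
  \<comment> \<open>On the circle of radius \<open>r\<close> the disk around \<open>w\<close>
    isolates a single point of \<open>X\<close>, and that point is bad. If one disk does this for an
    interval of radii, the interval and the disk witness that these bad points are good.\<close>
  define K where "K w \<delta> r \<longleftrightarrow> single_point X w \<delta> r \<and>
      (\<exists>z. z \<in> X \<and> norm z = r \<and> dist z w < \<delta> \<and> \<not> good_point X z)" for w \<delta> r
  let ?c = "\<lambda>k::(rat \<times> rat) \<times> rat. Complex (of_rat (fst (fst k))) (of_rat (snd (fst k)))"
  have dK: "dfn (K w \<delta>)" for w \<delta>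
    unfolding K_def by (intro dfn_intros dmap_intros dG dS dfn_comp[OF dX])
  have "\<forall>\<^sub>F r in at_top. \<exists>k. K (?c k) (of_rat (snd k)) r"
    using bad fin
  proof eventually_elim
    case (elim r)
    then obtain z where z: "z \<in> X" "norm z = r" "\<not> good_point X z" by blast
    \<comment> \<open>Finiteness of the circle section gives a gap \<open>e\<close> between
      \<open>z\<close> and the other points of the section. The centre is chosen within
      \<open>e / 4\<close> of \<open>z\<close> and the radius between \<open>e / 4\<close> and
      \<open>e / 2\<close>, so the open disk contains \<open>z\<close> and, as
      \<open>e / 4 + e / 2 < e\<close>, the closed disk contains no other point of the
      section.\<close>
    obtain e where e: "e > 0" "\<And>y. y \<in> X \<Longrightarrow> norm y = r \<Longrightarrow> y \<noteq> z \<Longrightarrow> e \<le> dist z y"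
      using finite_set_avoid[OF elim(2), of z] by auto
    obtain a where a: "Re z - e / 8 < of_rat a" "of_rat a < Re z"
      using of_rat_dense[of "Re z - e / 8" "Re z"] e(1) by auto
    obtain b where b: "Im z - e / 8 < of_rat b" "of_rat b < Im z"
      using of_rat_dense[of "Im z - e / 8" "Im z"] e(1) by auto
    obtain \<delta> where \<delta>: "e / 4 < of_rat \<delta>" "of_rat \<delta> < e / 2"
      using of_rat_dense[of "e / 4" "e / 2"] e(1) by auto
    let ?w = "Complex (of_rat a) (of_rat b)"
    have "dist z ?w \<le> \<bar>Re (z - ?w)\<bar> + \<bar>Im (z - ?w)\<bar>" unfolding dist_norm by (rule cmod_le)
    also have "\<dots> < e / 4" using a b by simp
    finally have zw: "dist z ?w < e / 4" .
    have "y = z" if "y \<in> X" "norm y = r" "dist y ?w \<le> of_rat \<delta>" for y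
    proof (rule ccontr)
      assume "y \<noteq> z"
      then have "e \<le> dist z y" using e(2) that by blast
      also have "\<dots> \<le> dist z ?w + dist y ?w" by (rule dist_triangle2)
      also have "\<dots> < e" using zw that(3) \<delta> by linarith
      finally show False by simp
    qed
    moreover have zd: "dist z ?w < of_rat \<delta>" using zw \<delta>(1) by linarith
    ultimately have "single_point X ?w (of_rat \<delta>) r"
      unfolding single_point_def using z(1,2) by blast
    then have "K ?w (of_rat \<delta>) r" unfolding K_def using z zd by blast
    then show ?case by (intro exI[of _ "((a, b), \<delta>)"]) simp
  qed
  from dfn_countable_cover[of "\<lambda>k. K (?c k) (of_rat (snd k))", OF dK this]
  obtain k c d where cd: "c < d" "\<And>r. c < r \<Longrightarrow> r < d \<Longrightarrow> K (?c k) (of_rat (snd k)) r"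
    by (metis (lifting))
  obtain r where r: "c < r" "r < d" using dense[OF cd(1)] by blast
  then obtain z where "z \<in> X" "norm z = r" "dist z (?c k) < of_rat (snd k)" "\<not> good_point X z"
    using cd(2) by (auto simp: K_def)
  moreover have "good_point X z"
    unfolding good_point_def using calculation(2,3) r cd(2)
    by (intro exI[of _ "?c k"] exI[of _ "of_rat (snd k)"] exI[of _ c] exI[of _ d]) (simp add: K_def)
  ultimately show False by simp
qed

lemma norm_fibres_near_infinity:
  assumes X: "definable_set S X" and int: "interior X = {}" and unb: "\<not> bounded X"
  obtains r0 where "0 < r0" "\<And>r. r0 < r \<Longrightarrow> finite (X \<inter> sphere 0 r)"
    "\<And>r. r0 < r \<Longrightarrow> X \<inter> sphere 0 r \<noteq> {}" "\<And>z. z \<in> X \<Longrightarrow> r0 < norm z \<Longrightarrow> good_point X z"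
proof -
  note dX = X[unfolded definable_set_iff]
  have fin: "\<forall>\<^sub>F r in at_top. finite (X \<inter> sphere 0 r)"
    by (rule eventually_finite_sphere[OF X int])
  have "dfn (\<lambda>r. \<exists>z. z \<in> X \<and> norm z = r)"
    by (intro dfn_intros dmap_intros dfn_comp[OF dX])
  moreover have "\<exists>\<^sub>F r in at_top. \<exists>z. z \<in> X \<and> norm z = r"
    unfolding frequently_def eventually_at_top_linorder
    using unb unfolding bounded_iff by (metis linear)
  ultimately have ne: "\<forall>\<^sub>F r in at_top. \<exists>z. z \<in> X \<and> norm z = r"
    by (rule dfn_eventually_at_top)
  have "\<forall>\<^sub>F r in at_top. finite (X \<inter> sphere 0 r) \<and> (\<exists>z. z \<in> X \<and> norm z = r) \<and>
      (\<forall>z. z \<in> X \<and> norm z = r \<longrightarrow> good_point X z)"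
    by (intro eventually_conj fin ne eventually_good_point[OF X fin])
  then obtain c where c: "\<And>r. c \<le> r \<Longrightarrow> finite (X \<inter> sphere 0 r) \<and> (\<exists>z. z \<in> X \<and> norm z = r) \<and>
      (\<forall>z. z \<in> X \<and> norm z = r \<longrightarrow> good_point X z)"
    by (auto simp: eventually_at_top_linorder)
  show ?thesis
  proof (rule that[of "max c 1"])
    show "X \<inter> sphere 0 r \<noteq> {}" if "max c 1 < r" for r
      using c[of r] that by auto
    show "good_point X z" if "z \<in> X" "max c 1 < norm z" for z
      using c[of "norm z"] that by auto
  qed (use c in auto)
qed

end

subsection \<open>The norm as a covering map near infinity\<close>

text \<open>The isolated points form a function of the radius whose graph is closed: it is cut out
  of the product with the closed disk by membership in \<open>X\<close> and by the norm. As the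
  closed disk is compact, a closed graph gives continuity. The open disk kept in the conclusion
  later makes the image of the section relatively open in \<open>X\<close>.\<close>

lemma good_point_section:
  assumes X: "closed X" and z: "z \<in> X" "good_point X z"
  shows "\<exists>f w \<delta> a b. a < norm z \<and> norm z < b \<and> continuous_on {a<..<b} f \<and> f (norm z) = z \<and>
    (\<forall>r\<in>{a<..<b}. f r \<in> X \<and> norm (f r) = r \<and> dist (f r) w < \<delta>) \<and>
    (\<forall>y. y \<in> X \<longrightarrow> norm y \<in> {a<..<b} \<longrightarrow> dist y w < \<delta> \<longrightarrow> f (norm y) = y)"
proof -
  obtain w \<delta> a b where ab: "a < norm z" "norm z < b" "dist z w < \<delta>"
    and single: "\<forall>r. a < r \<and> r < b \<longrightarrow> single_point X w \<delta> r"
    using z(2) unfolding good_point_def by blast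
  have "\<forall>r. \<exists>y. r \<in> {a<..<b} \<longrightarrow> y \<in> X \<and> norm y = r \<and> dist y w < \<delta> \<and>
      (\<forall>y'. y' \<in> X \<and> norm y' = r \<and> dist y' w \<le> \<delta> \<longrightarrow> y' = y)"
    using single unfolding single_point_def by (metis greaterThanLessThan_iff)
  from choice[OF this] obtain f where f: "\<And>r. r \<in> {a<..<b} \<Longrightarrow> f r \<in> X"
    "\<And>r. r \<in> {a<..<b} \<Longrightarrow> norm (f r) = r" "\<And>r. r \<in> {a<..<b} \<Longrightarrow> dist (f r) w < \<delta>"
    "\<And>r y. r \<in> {a<..<b} \<Longrightarrow> y \<in> X \<Longrightarrow> norm y = r \<Longrightarrow> dist y w \<le> \<delta> \<Longrightarrow> y = f r"
    by metis
  have "(\<lambda>r. (r, f r)) ` {a<..<b} =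
      ({a<..<b} \<times> cball w \<delta>) \<inter> {p. snd p \<in> X \<and> norm (snd p) = fst p}"
  proof (intro equalityI subsetI)
    fix p assume "p \<in> (\<lambda>r. (r, f r)) ` {a<..<b}"
    then obtain r where "p = (r, f r)" "r \<in> {a<..<b}" by blast
    then show "p \<in> ({a<..<b} \<times> cball w \<delta>) \<inter> {p. snd p \<in> X \<and> norm (snd p) = fst p}"
      using f(1-3)[of r] by (simp add: dist_commute less_imp_le)
  next
    fix p assume p: "p \<in> ({a<..<b} \<times> cball w \<delta>) \<inter> {p. snd p \<in> X \<and> norm (snd p) = fst p}"
    then have "snd p = f (fst p)" using f(4)[of "fst p" "snd p"] by (auto simp: dist_commute)
    then have "p = (fst p, f (fst p))" by (metis prod.collapse)
    then show "p \<in> (\<lambda>r. (r, f r)) ` {a<..<b}" using p by (auto simp: image_iff mem_Times_iff)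
  qed
  moreover have "closed {p. snd p \<in> X \<and> norm (snd p) = (fst p :: real)}"
  proof -
    have "closed (snd -` X :: (real \<times> complex) set)"
      by (intro closed_vimage X continuous_intros)
    moreover have "closed {p :: real \<times> complex. norm (snd p) = fst p}"
      by (intro closed_Collect_eq continuous_intros)
    moreover have "{p. snd p \<in> X \<and> norm (snd p) = (fst p :: real)} =
        snd -` X \<inter> {p. norm (snd p) = fst p}" by auto
    ultimately show ?thesis by (simp add: closed_Int)
  qed
  ultimately have "closedin (top_of_set ({a<..<b} \<times> cball w \<delta>)) ((\<lambda>r. (r, f r)) ` {a<..<b})"
    by (simp add: closedin_closed_Int)
  moreover have "f \<in> {a<..<b} \<rightarrow> cball w \<delta>"
    using f(3) by (simp add: dist_commute less_imp_le)
  ultimately have "continuous_on {a<..<b} f"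
    using continuous_closed_graph_eq[OF compact_cball] by metis
  moreover have "f (norm z) = z" using f(4)[of "norm z" z] ab z(1) by simp
  moreover have "f (norm y) = y" if "y \<in> X" "norm y \<in> {a<..<b}" "dist y w < \<delta>" for y
    using f(4)[of "norm y" y] that by simp
  ultimately show ?thesis
    using ab(1,2) f(1-3) by (intro exI[of _ f] exI[of _ w] exI[of _ \<delta>] exI[of _ a] exI[of _ b]) simp
qed

text \<open>Through each of the finitely many points of \<open>X\<close> on the circle of radius
  \<open>r\<close> passes a local section. Over a small enough interval around \<open>r\<close>
  these sections are all defined, pairwise disjoint and exhaust \<open>X\<close>, so they are the
  sheets of the covering.\<close>

lemma covering_space_norm:
  fixes X :: "complex set"
  assumes X: "closed X" and r0: "0 \<le> r0"
    and fin: "\<And>r. r0 < r \<Longrightarrow> finite (X \<inter> sphere 0 r)"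
    and ne: "\<And>r. r0 < r \<Longrightarrow> X \<inter> sphere 0 r \<noteq> {}"
    and good: "\<And>z. z \<in> X \<Longrightarrow> r0 < norm z \<Longrightarrow> good_point X z"
  shows "covering_space (X - cball 0 r0) norm {r0<..}"
proof
  let ?C = "X - cball 0 r0"
  show "continuous_on ?C norm" by (intro continuous_intros)
  show "norm ` ?C = {r0<..}"
  proof
    show "{r0<..} \<subseteq> norm ` ?C"
    proof
      fix r assume "r \<in> {r0<..}"
      then obtain z where z: "z \<in> X \<inter> sphere 0 r" using ne[of r] by blast
      then have "z \<in> ?C" "r = norm z" using \<open>r \<in> {r0<..}\<close> by auto
      then show "r \<in> norm ` ?C" by blast
    qed
  qed auto
  fix r assume "r \<in> {r0<..}"
  then have r: "r0 < r" by simp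
  let ?F = "X \<inter> sphere 0 r"
  define P where "P z f w \<delta> a b \<longleftrightarrow> a < r \<and> r < b \<and> continuous_on {a<..<b} f \<and> f r = z \<and>
      (\<forall>r\<in>{a<..<b}. f r \<in> X \<and> norm (f r) = r \<and> dist (f r) w < \<delta>) \<and>
      (\<forall>y. y \<in> X \<longrightarrow> norm y \<in> {a<..<b} \<longrightarrow> dist y w < \<delta> \<longrightarrow> f (norm y) = y)" for z f w \<delta> a b
  have "\<exists>f w \<delta> a b. P z f w \<delta> a b" if "z \<in> ?F" for z
  proof -
    have z: "z \<in> X" "norm z = r" using that by auto
    show ?thesis using good_point_section[OF X z(1) good[OF z(1)]] r unfolding z(2) P_def by blast
  qed
  then obtain f w \<delta> a b where P: "\<And>z. z \<in> ?F \<Longrightarrow> P z (f z) (w z) (\<delta> z) (a z) (b z)" by metis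
  have ab: "a z < r \<and> r < b z" and contf: "continuous_on {a z<..<b z} (f z)"
    and fr: "f z r = z"
    and f: "s \<in> {a z<..<b z} \<Longrightarrow> f z s \<in> X \<and> norm (f z s) = s \<and> dist (f z s) (w z) < \<delta> z"
    and uniq: "y \<in> X \<Longrightarrow> norm y \<in> {a z<..<b z} \<Longrightarrow> dist y (w z) < \<delta> z \<Longrightarrow> f z (norm y) = y"
    if "z \<in> ?F" for z s y
    using P[OF that] unfolding P_def by auto
  have ev1: "\<forall>\<^sub>F s in nhds r. s \<in> {a z<..<b z}" if "z \<in> ?F" for z
    using ab[OF that] by (intro eventually_nhds_in_open) auto
  have ev2: "\<forall>\<^sub>F s in nhds r. f z s \<noteq> f z' s" if z: "z \<in> ?F" "z' \<in> ?F" "z \<noteq> z'" for z z'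
  proof -
    have "continuous_on ({a z<..<b z} \<inter> {a z'<..<b z'}) (\<lambda>s. f z s - f z' s)"
      using contf[OF z(1)] contf[OF z(2)]
      by (intro continuous_intros) (auto elim: continuous_on_subset)
    then have "open (({a z<..<b z} \<inter> {a z'<..<b z'}) \<inter> (\<lambda>s. f z s - f z' s) -` (- {0}))"
      by (rule continuous_open_preimage) auto
    moreover have "r \<in> ({a z<..<b z} \<inter> {a z'<..<b z'}) \<inter> (\<lambda>s. f z s - f z' s) -` (- {0})"
      using ab[OF z(1)] ab[OF z(2)] fr[OF z(1)] fr[OF z(2)] z(3) by simp
    ultimately have "\<forall>\<^sub>F s in nhds r. s \<in> ({a z<..<b z} \<inter> {a z'<..<b z'}) \<inter> (\<lambda>s. f z s - f z' s) -` (- {0})"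
      by (rule eventually_nhds_in_open)
    then show ?thesis by (rule eventually_mono) auto
  qed
  have ev3: "\<forall>\<^sub>F s in nhds r. \<forall>y. y \<in> X \<longrightarrow> norm y = s \<longrightarrow> (\<exists>z\<in>?F. dist y (w z) < \<delta> z)"
  proof -
    \<comment> \<open>The part of \<open>X\<close> with norm at most \<open>r + 1\<close> outside
      all isolating disks is compact and misses the circle of radius \<open>r\<close>, hence also
      the nearby circles: no further point of \<open>X\<close> can approach this circle.\<close>
    define K where "K = X \<inter> cball 0 (r + 1) - (\<Union>z\<in>?F. ball (w z) (\<delta> z))"
    have "compact K"
      unfolding K_def using X by (intro compact_diff open_UN ballI open_ball closed_Int_compact) auto
    then have "closed (norm ` K)"
      by (intro compact_imp_closed compact_continuous_image continuous_intros)
    moreover have "r \<notin> norm ` K"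
    proof
      assume "r \<in> norm ` K"
      then obtain y where y: "y \<in> K" "norm y = r" by blast
      then have "y \<in> ?F" by (auto simp: K_def)
      moreover have "dist y (w y) < \<delta> y" using f[OF \<open>y \<in> ?F\<close>, of r] ab[OF \<open>y \<in> ?F\<close>] fr[OF \<open>y \<in> ?F\<close>] by auto
      ultimately have "y \<in> (\<Union>z\<in>?F. ball (w z) (\<delta> z))" by (intro UN_I[of y]) (simp_all add: dist_commute)
      then show False using y(1) by (simp add: K_def)
    qed
    ultimately have "\<forall>\<^sub>F s in nhds r. s \<in> - (norm ` K) \<inter> {..<r + 1}"
      by (intro eventually_nhds_in_open) auto
    then show ?thesis
    proof (rule eventually_mono)
      fix s assume s: "s \<in> - (norm ` K) \<inter> {..<r + 1}"
      show "\<forall>y. y \<in> X \<longrightarrow> norm y = s \<longrightarrow> (\<exists>z\<in>?F. dist y (w z) < \<delta> z)"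
      proof (intro allI impI)
        fix y assume y: "y \<in> X" "norm y = s"
        then have "y \<notin> K" using s by auto
        then show "\<exists>z\<in>?F. dist y (w z) < \<delta> z" using y s by (auto simp: K_def dist_commute)
      qed
    qed
  qed
  have "\<forall>\<^sub>F s in nhds r. s \<in> {r0<..} \<and> (\<forall>z\<in>?F. s \<in> {a z<..<b z}) \<and>
      (\<forall>z\<in>?F. \<forall>z'\<in>?F. z \<noteq> z' \<longrightarrow> f z s \<noteq> f z' s) \<and>
      (\<forall>y. y \<in> X \<longrightarrow> norm y = s \<longrightarrow> (\<exists>z\<in>?F. dist y (w z) < \<delta> z))"
  proof (intro eventually_conj)
    show "\<forall>\<^sub>F s in nhds r. s \<in> {r0<..}" using r by (intro eventually_nhds_in_open) auto
    show "\<forall>\<^sub>F s in nhds r. \<forall>z\<in>?F. s \<in> {a z<..<b z}"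
      using ev1 fin[OF r] by (intro eventually_ball_finite) auto
    have "\<forall>\<^sub>F s in nhds r. z \<noteq> z' \<longrightarrow> f z s \<noteq> f z' s" if "z \<in> ?F" "z' \<in> ?F" for z z'
      using ev2[OF that] by (cases "z = z'") auto
    then show "\<forall>\<^sub>F s in nhds r. \<forall>z\<in>?F. \<forall>z'\<in>?F. z \<noteq> z' \<longrightarrow> f z s \<noteq> f z' s"
      using fin[OF r] by (intro eventually_ball_finite ballI) auto
  qed (rule ev3)
  then obtain e where e: "e > 0" and T: "\<And>s. dist s r < e \<Longrightarrow> s \<in> {r0<..} \<and> (\<forall>z\<in>?F. s \<in> {a z<..<b z}) \<and>
      (\<forall>z\<in>?F. \<forall>z'\<in>?F. z \<noteq> z' \<longrightarrow> f z s \<noteq> f z' s) \<and>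
      (\<forall>y. y \<in> X \<longrightarrow> norm y = s \<longrightarrow> (\<exists>z\<in>?F. dist y (w z) < \<delta> z))"
    unfolding eventually_nhds_metric by blast
  define T where "T = ball r e"
  have T0: "s \<in> {r0<..}" and T1: "z \<in> ?F \<Longrightarrow> s \<in> {a z<..<b z}"
    and T2: "z \<in> ?F \<Longrightarrow> z' \<in> ?F \<Longrightarrow> z \<noteq> z' \<Longrightarrow> f z s \<noteq> f z' s"
    and T3: "y \<in> X \<Longrightarrow> norm y = s \<Longrightarrow> \<exists>z\<in>?F. dist y (w z) < \<delta> z" if "s \<in> T" for s z z' y
    using T[of s] that by (auto simp: T_def dist_commute)
  have fT: "f z ` T = {y \<in> X. norm y \<in> T \<and> dist y (w z) < \<delta> z}" if z: "z \<in> ?F" for z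
  proof (intro equalityI subsetI)
    fix y assume "y \<in> f z ` T"
    then obtain s where s: "s \<in> T" "y = f z s" by blast
    then show "y \<in> {y \<in> X. norm y \<in> T \<and> dist y (w z) < \<delta> z}" using f[OF z T1[OF s(1) z]] by simp
  next
    fix y assume y: "y \<in> {y \<in> X. norm y \<in> T \<and> dist y (w z) < \<delta> z}"
    then have "norm y \<in> {a z<..<b z}" using T1 z by blast
    then have "f z (norm y) = y" using uniq[OF z, of y] y by simp
    then show "y \<in> f z ` T" using y by (metis (mono_tags, lifting) imageI mem_Collect_eq)
  qed
  show "\<exists>T. r \<in> T \<and> openin (top_of_set {r0<..}) T \<and> (\<exists>v. \<Union>v = ?C \<inter> norm -` T \<and>
      (\<forall>u\<in>v. openin (top_of_set ?C) u) \<and> pairwise disjnt v \<and>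
      (\<forall>u\<in>v. \<exists>q. homeomorphism u T norm q))"
  proof (intro exI[of _ T] conjI exI[of _ "(\<lambda>z. f z ` T) ` ?F"] ballI)
    show "r \<in> T" using e by (simp add: T_def)
    have "T \<subseteq> {r0<..}" using T0 by blast
    then show "openin (top_of_set {r0<..}) T" by (intro open_subset) (auto simp: T_def)
    show "\<Union> ((\<lambda>z. f z ` T) ` ?F) = ?C \<inter> norm -` T"
    proof (intro equalityI subsetI)
      fix y assume "y \<in> \<Union> ((\<lambda>z. f z ` T) ` ?F)"
      then obtain z where z: "z \<in> ?F" "y \<in> f z ` T" by blast
      then have y: "y \<in> X" "norm y \<in> T" unfolding fT[OF z(1)] by auto
      then show "y \<in> ?C \<inter> norm -` T" using T0[OF y(2)] by simp
    next
      fix y assume "y \<in> ?C \<inter> norm -` T"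
      then have y: "y \<in> X" "norm y \<in> T" by auto
      then obtain z where z: "z \<in> ?F" "dist y (w z) < \<delta> z" using T3[OF y(2) y(1)] by blast
      then have "y \<in> f z ` T" unfolding fT[OF z(1)] using y by blast
      then show "y \<in> \<Union> ((\<lambda>z. f z ` T) ` ?F)" using z(1) by blast
    qed
    show "openin (top_of_set ?C) u" if u: "u \<in> (\<lambda>z. f z ` T) ` ?F" for u
    proof -
      obtain z where z: "z \<in> ?F" "u = f z ` T" using u by blast
      have "u = ?C \<inter> (norm -` T \<inter> ball (w z) (\<delta> z))"
        unfolding z(2) fT[OF z(1)] using T0 by (force simp: dist_commute)
      moreover have "open (norm -` T \<inter> ball (w z) (\<delta> z) :: complex set)"
        unfolding T_def by (intro open_Int open_vimage continuous_intros) auto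
      ultimately show ?thesis by (metis openin_open)
    qed
    show "pairwise disjnt ((\<lambda>z. f z ` T) ` ?F)"
    proof (rule pairwiseI)
      fix u u' assume "u \<in> (\<lambda>z. f z ` T) ` ?F" "u' \<in> (\<lambda>z. f z ` T) ` ?F" and ne: "u \<noteq> u'"
      then obtain z z' where z: "z \<in> ?F" "u = f z ` T" "z' \<in> ?F" "u' = f z' ` T" by blast
      have "f z s \<noteq> f z' s'" if "s \<in> T" "s' \<in> T" for s s'
      proof
        assume eq: "f z s = f z' s'"
        have "norm (f z s) = s" "norm (f z' s') = s'"
          using f[OF z(1) T1[OF that(1) z(1)]] f[OF z(3) T1[OF that(2) z(3)]] by auto
        then have "s = s'" using eq by simp
        then show False using T2[OF that(1) z(1) z(3)] eq ne z by auto
      qed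
      then show "disjnt u u'" unfolding z disjnt_iff by blast
    qed
    show "\<exists>q. homeomorphism u T norm q" if u: "u \<in> (\<lambda>z. f z ` T) ` ?F" for u
    proof -
      obtain z where z: "z \<in> ?F" "u = f z ` T" using u by blast
      have nf: "norm (f z s) = s" if "s \<in> T" for s using f[OF z(1) T1[OF that z(1)]] by simp
      have "T \<subseteq> {a z<..<b z}" using T1 z(1) by blast
      then have "homeomorphism u T norm (f z)"
        unfolding z(2)
        using nf by (intro homeomorphismI continuous_intros continuous_on_subset[OF contf[OF z(1)]]) auto
      then show ?thesis by (rule exI[where x = "f z"])
    qed
  qed
qed

subsection \<open>Systems of rays\<close>

text \<open>Outside the disk of radius \<open>r0\<close> the set \<open>X\<close> consists of \<open>N\<close> disjoint rays parametrised by the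
  norm. Their arguments are indexed by the integers in increasing order, so that indices that are
  congruent modulo \<open>N\<close> give the same ray.\<close>

locale ray_system =
  fixes X :: "complex set" and r0 :: real and N :: nat and \<theta> :: "int \<Rightarrow> real \<Rightarrow> real"
  assumes r0_pos: "0 < r0"
    and N_pos: "0 < N"
    and continuous_angle: "continuous_on {r0..} (\<theta> k)"
    and angle_less_succ: "r0 \<le> r \<Longrightarrow> \<theta> k r < \<theta> (k + 1) r"
    and angle_period: "r0 \<le> r \<Longrightarrow> \<theta> (k + int N) r = \<theta> k r + 2 * pi"
    and rays_eq: "X - ball 0 r0 = {rcis r (\<theta> k r) | k r. r0 \<le> r}"

lemma rcis_eq_iff:
  assumes "0 < r"
  shows "rcis r a = rcis r b \<longleftrightarrow> (\<exists>n::int. a = b + 2 * pi * n)"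
proof -
  have "rcis r a = rcis r b \<longleftrightarrow> sin a = sin b \<and> cos a = cos b"
    using assms by (auto simp: rcis_def complex_eq_iff)
  also have "\<dots> \<longleftrightarrow> (\<exists>n::int. a = b + 2 * pi * n)"
    by (metis sin_cos_eq_iff mult.commute mult.left_commute)
  finally show ?thesis .
qed

lemma rcis_Arg2pi: "rcis (norm z) (Arg2pi z) = z"
  using Arg2pi_eq[of z] by (simp add: rcis_def cis_conv_exp)

lemma rcis_eq_imp_eq_in_period:
  assumes "0 < r" "rcis r a = rcis r b" "0 \<le> a" "a < 2 * pi" "0 \<le> b" "b < 2 * pi"
  shows "a = b"
proof -
  obtain n :: int where n: "a = b + 2 * pi * n" using assms(1,2) rcis_eq_iff by blast
  have "2 * pi * n < 2 * pi * 1" "2 * pi * (-1) < 2 * pi * n" using n assms(3-) by linarith+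
  moreover have "0 < 2 * pi" by simp
  ultimately have "real_of_int n < 1" "-1 < real_of_int n"
    by (simp_all only: mult_less_cancel_left_pos)
  then show ?thesis using n by simp
qed

text \<open>The half-line is simply connected, so the covering splits into global sections, and each
  section, being nonzero, has a continuous argument. The sections are labelled by their arguments at
  the radius \<open>r0 + 1\<close>, and the cyclic order of these labels persists at every
  radius.\<close>

lemma ray_system_of_covering:
  fixes X :: "complex set"
  assumes r0: "0 < r0" and cov: "covering_space (X - cball 0 r0) norm {r0<..}"
    and fin: "finite (X \<inter> sphere 0 (r0 + 1))"
  shows "\<exists>N \<theta>. ray_system X (r0 + 1) N \<theta>"
proof -
  let ?C = "X - cball 0 r0" and ?D = "{r0<..}"
  define r1 where "r1 = r0 + 1"
  have r1: "r1 \<in> ?D" "0 < r1" using r0 by (simp_all add: r1_def)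
  have lift: "\<exists>s. continuous_on ?D s \<and> (\<forall>r\<in>?D. s r \<in> ?C \<and> norm (s r) = r) \<and> s (norm z) = z"
    if z: "z \<in> ?C" for z
  proof (rule covering_space_lift_strong[OF cov z, of "norm z" ?D "\<lambda>r. r"])
    show "norm z \<in> ?D" using z by simp
    show "simply_connected ?D" by (intro convex_imp_simply_connected convex_real_interval)
    show "locally path_connected ?D" by (intro convex_imp_locally_path_connected convex_real_interval)
  qed auto
  have unique: "s r = s' r"
    if "continuous_on ?D s" "\<And>r. r \<in> ?D \<Longrightarrow> s r \<in> ?C \<and> norm (s r) = r"
      "continuous_on ?D s'" "\<And>r. r \<in> ?D \<Longrightarrow> s' r \<in> ?C \<and> norm (s' r) = r"
      "s c = s' c" "c \<in> ?D" "r \<in> ?D" for s s' c r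
    by (rule covering_space_lift_unique[OF cov, of s c s' ?D "\<lambda>r. r"]) (use that in auto)
  have angle: "\<exists>\<Theta>. continuous_on ?D \<Theta> \<and> (\<forall>r\<in>?D. rcis r (\<Theta> r) \<in> X) \<and> \<Theta> r1 = t"
    if t: "rcis r1 t \<in> X" for t
  proof -
    have nt: "norm (rcis r1 t) = r1" using r1 by simp
    then have "rcis r1 t \<in> ?C" using t r1 by simp
    from lift[OF this] obtain s where s: "continuous_on ?D s"
      "\<And>r. r \<in> ?D \<Longrightarrow> s r \<in> ?C \<and> norm (s r) = r" "s r1 = rcis r1 t" unfolding nt by blast
    have "s r \<noteq> 0" if "r \<in> ?D" for r using s(2)[OF that] r0 that by auto
    then obtain g where g: "continuous_on ?D g" "\<And>r. r \<in> ?D \<Longrightarrow> s r = exp (g r)"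
      using continuous_logarithm_on_contractible[OF s(1) convex_imp_contractible]
      by (metis convex_real_interval(3))
    have sg: "s r = rcis r (Im (g r))" if "r \<in> ?D" for r
    proof -
      have "exp (g r) = rcis (exp (Re (g r))) (Im (g r))"
        by (simp add: rcis_def exp_eq_polar)
      moreover have "exp (Re (g r)) = r" using s(2)[OF that] g(2)[OF that] by (metis norm_exp_eq_Re)
      ultimately show ?thesis using g(2)[OF that] by simp
    qed
    have "rcis r1 t = rcis r1 (Im (g r1))" using sg[OF r1(1)] s(3) by simp
    then obtain n :: int where n: "t = Im (g r1) + 2 * pi * n" using rcis_eq_iff[OF r1(2)] by blast
    show ?thesis
    proof (intro exI[of _ "\<lambda>r. Im (g r) + 2 * pi * n"] conjI ballI)
      show "continuous_on ?D (\<lambda>r. Im (g r) + 2 * pi * n)" by (intro continuous_intros g(1))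
      fix r assume r: "r \<in> ?D"
      then have "rcis r (Im (g r) + 2 * pi * n) = rcis r (Im (g r))"
        using rcis_eq_iff[of r] r0 by auto
      then show "rcis r (Im (g r) + 2 * pi * n) \<in> X" using sg[OF r] s(2)[OF r] by simp
    qed (simp add: n)
  qed
  define L where "L = {t. 0 \<le> t \<and> t < 2 * pi \<and> rcis r1 t \<in> X}"
  obtain \<Theta> where \<Theta>: "\<And>t. t \<in> L \<Longrightarrow> continuous_on ?D (\<Theta> t)"
    "\<And>t r. t \<in> L \<Longrightarrow> r \<in> ?D \<Longrightarrow> rcis r (\<Theta> t r) \<in> X" "\<And>t. t \<in> L \<Longrightarrow> \<Theta> t r1 = t"
  proof -
    have "\<forall>t\<in>L. \<exists>\<Theta>. continuous_on ?D \<Theta> \<and> (\<forall>r\<in>?D. rcis r (\<Theta> r) \<in> X) \<and> \<Theta> r1 = t"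
      using angle by (simp add: L_def)
    from bchoice[OF this] show ?thesis using that by blast
  qed
  have lift\<Theta>: "continuous_on ?D (\<lambda>r. rcis r (\<Theta> t r))"
    "r \<in> ?D \<Longrightarrow> rcis r (\<Theta> t r) \<in> ?C \<and> norm (rcis r (\<Theta> t r)) = r" if "t \<in> L" for t r
    using \<Theta>(1,2)[OF that] r0 by (auto intro!: continuous_intros)
  \<comment> \<open>The difference of the two lifted arguments has no zero, for a zero would make
    the two sections agree at one radius and hence, by uniqueness of lifts, at \<open>r1\<close>. So
    its sign is the sign at \<open>r1\<close>.\<close>
  have order: "\<Theta> t r < \<Theta> t' r + 2 * pi * n"
    if t: "t \<in> L" "t' \<in> L" "t < t' + 2 * pi * n" "r \<in> ?D" for t t' r and n :: int
  proof (cases "t = t'")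
    case True
    then show ?thesis using t(3) by simp
  next
    case False
    define d where "d r = \<Theta> t' r + 2 * pi * n - \<Theta> t r" for r
    have nz: "d r \<noteq> 0" if r: "r \<in> ?D" for r
    proof
      assume "d r = 0"
      then have "\<Theta> t r = \<Theta> t' r + 2 * pi * n" by (simp add: d_def)
      then have eq: "rcis r (\<Theta> t r) = rcis r (\<Theta> t' r)" using rcis_eq_iff[of r] r r0 by auto
      have "rcis r1 (\<Theta> t r1) = rcis r1 (\<Theta> t' r1)"
        by (rule unique[where s = "\<lambda>r. rcis r (\<Theta> t r)" and s' = "\<lambda>r. rcis r (\<Theta> t' r)",
              OF lift\<Theta>[OF t(1)] lift\<Theta>[OF t(2)] eq r r1(1)])
      then have "rcis r1 t = rcis r1 t'" using \<Theta>(3) t by simp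
      then have "t = t'" by (rule rcis_eq_imp_eq_in_period[OF r1(2)]) (use t in \<open>auto simp: L_def\<close>)
      then show False using False by simp
    qed
    have "continuous_on ?D d" unfolding d_def by (intro continuous_intros \<Theta>(1) t)
    then have "connected (d ` ?D)" by (intro connected_continuous_image convex_connected convex_real_interval)
    moreover have "0 < d r1" using t \<Theta>(3) by (simp add: d_def)
    ultimately have "0 \<in> d ` ?D" if "d r \<le> 0"
      using that connected_contains_Icc[of "d ` ?D" "d r" "d r1"] t(4) r1(1) by auto
    then have "0 < d r" using nz by force
    then show ?thesis by (simp add: d_def)
  qed
  have "finite L"
  proof (rule inj_on_finite)
    show "inj_on (rcis r1) L"
      by (rule inj_onI, rule rcis_eq_imp_eq_in_period[OF r1(2)]) (auto simp: L_def)
    show "rcis r1 ` L \<subseteq> X \<inter> sphere 0 (r0 + 1)" using r1 by (auto simp: L_def r1_def)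
  qed (rule fin)
  have in_L: "Arg2pi z \<in> L" "rcis r1 (Arg2pi z) = z" if "z \<in> X" "norm z = r1" for z
    using that rcis_Arg2pi[of z] by (auto simp: L_def Arg2pi_ge_0 Arg2pi_lt_2pi)
  have "L \<noteq> {}"
  proof -
    have "r1 \<in> norm ` ?C" using cov r1(1) by (metis covering_space_imp_surjective)
    then show ?thesis using in_L by blast
  qed
  define xs where "xs = sorted_list_of_set L"
  define N where "N = length xs"
  have set_xs: "set xs = L" using \<open>finite L\<close> by (simp add: xs_def)
  have N: "0 < N" using \<open>L \<noteq> {}\<close> set_xs by (auto simp: N_def)
  have sorted: "xs ! i < xs ! j" if "i < j" "j < N" for i j
    using that strict_sorted_list_of_set[of L] unfolding xs_def N_def by (simp add: sorted_wrt_nth_less)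
  define ix where "ix k = nat (k mod int N)" for k
  have ix: "ix k < N" "int (ix k) = k mod int N" for k using N by (simp_all add: ix_def nat_less_iff)
  have ixL: "xs ! ix k \<in> L" for k using ix(1)[of k] set_xs by (metis N_def nth_mem)
  \<comment> \<open>Division with remainder by \<open>N\<close> unrolls the finite list: the
    remainder of \<open>k\<close> selects a section in the order of the labels, and the quotient
    counts full turns.\<close>
  define \<theta> where "\<theta> k r = \<Theta> (xs ! ix k) r + 2 * pi * of_int (k div int N)" for k r
  have D: "r \<in> ?D" if "r1 \<le> r" for r using that by (simp add: r1_def)
  have "ray_system X r1 N \<theta>"
  proof
    show "0 < r1" "0 < N" by (fact r1(2) N)+
    show "continuous_on {r1..} (\<theta> k)" for k
      unfolding \<theta>_def using D
      by (intro continuous_intros continuous_on_subset[OF \<Theta>(1)[OF ixL]]) auto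
    show "\<theta> (k + int N) r = \<theta> k r + 2 * pi" for k r
      using N by (simp add: \<theta>_def ix_def algebra_simps)
    show "\<theta> k r < \<theta> (k + 1) r" if "r1 \<le> r" for k r
    proof -
      have k: "k = int N * (k div int N) + k mod int N" by simp
      have lt: "k mod int N < int N" "0 \<le> k mod int N" using N by simp_all
      have "xs ! ix k < xs ! ix (k + 1) + 2 * pi * of_int ((k + 1) div int N - k div int N)"
      proof (cases "k mod int N + 1 < int N")
        case True
        have *: "k + 1 = int N * (k div int N) + (k mod int N + 1)" using k by linarith
        have "(k + 1) div int N = k div int N"
          by (rule int_div_pos_eq[OF *]) (use True lt in auto)
        moreover have "(k + 1) mod int N = k mod int N + 1"
          by (rule int_mod_pos_eq[OF *]) (use True lt in auto)
        ultimately show ?thesis using sorted[of "ix k" "ix (k + 1)"] ix[of k] ix[of "k + 1"] by simp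
      next
        \<comment> \<open>At the end of the list the index wraps to the start while the quotient
          grows by one; the inequality holds because all labels are at least \<open>0\<close> and
          less than \<open>2 * pi\<close>.\<close>
        case False
        then have "k mod int N = int N - 1" using lt by simp
        then have *: "k + 1 = int N * (k div int N + 1)"
          using k unfolding distrib_left mult_1_right by linarith
        have "(k + 1) div int N = k div int N + 1" unfolding * using N by simp
        moreover have "xs ! ix k < 2 * pi" "0 \<le> xs ! ix (k + 1)"
          using ixL[of k] ixL[of "k + 1"] by (auto simp: L_def)
        ultimately show ?thesis by simp
      qed
      from order[OF ixL ixL this D[OF that]] show ?thesis
        by (simp add: \<theta>_def algebra_simps)
    qed
    show "X - ball 0 r1 = {rcis r (\<theta> k r) |k r. r1 \<le> r}"
    proof (intro equalityI subsetI)
      \<comment> \<open>A point of \<open>X\<close> is followed along its section to the radius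
        \<open>r1\<close>, where the label is read off; uniqueness of lifts brings this back to the
        radius \<open>norm z\<close>.\<close>
      fix z assume z: "z \<in> X - ball 0 r1"
      then have nz: "r1 \<le> norm z" "norm z \<in> ?D" using D by auto
      have "z \<in> ?C" using z nz(2) by simp
      from lift[OF this] obtain s where s: "continuous_on ?D s"
        "\<And>r. r \<in> ?D \<Longrightarrow> s r \<in> ?C \<and> norm (s r) = r" "s (norm z) = z" by blast
      let ?t = "Arg2pi (s r1)"
      have t: "?t \<in> L" "rcis r1 ?t = s r1" using in_L[of "s r1"] s(2)[OF r1(1)] by auto
      have "s (norm z) = rcis (norm z) (\<Theta> ?t (norm z))"
        by (rule unique[OF s(1,2) lift\<Theta>[OF t(1)] _ r1(1) nz(2)]) (simp_all add: \<Theta>(3)[OF t(1)] t(2))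
      moreover obtain i where i: "i < N" "xs ! i = ?t" using t(1) set_xs by (metis N_def in_set_conv_nth)
      ultimately have "z = rcis (norm z) (\<theta> (int i) (norm z))" using s(3) by (simp add: \<theta>_def ix_def)
      then show "z \<in> {rcis r (\<theta> k r) |k r. r1 \<le> r}" using nz(1) by blast
    next
      fix z assume "z \<in> {rcis r (\<theta> k r) |k r. r1 \<le> r}"
      then obtain k r where r: "r1 \<le> r" "z = rcis r (\<theta> k r)" by blast
      have "rcis r (\<theta> k r) = rcis r (\<Theta> (xs ! ix k) r)"
        using rcis_eq_iff[of r] r1(2) r(1) by (auto simp: \<theta>_def)
      then show "z \<in> X - ball 0 r1" using \<Theta>(2)[OF ixL D[OF r(1)]] r r1(2) by simp
    qed
  qed
  then show ?thesis unfolding r1_def by blast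
qed

theorem (in o_minimal_field_expansion) ray_system_exists:
  assumes "definable_set S X" "closed X" "interior X = {}" "\<not> bounded X"
  shows "\<exists>r0 N \<theta>. ray_system X r0 N \<theta>"
proof -
  obtain r0 where r0: "0 < r0" "\<And>r. r0 < r \<Longrightarrow> finite (X \<inter> sphere 0 r)"
    "\<And>r. r0 < r \<Longrightarrow> X \<inter> sphere 0 r \<noteq> {}" "\<And>z. z \<in> X \<Longrightarrow> r0 < norm z \<Longrightarrow> good_point X z"
    using norm_fibres_near_infinity[OF assms(1,3,4)] by metis
  have "covering_space (X - cball 0 r0) norm {r0<..}"
    using r0 by (intro covering_space_norm assms(2)) auto
  from ray_system_of_covering[OF r0(1) this r0(2)] show ?thesis by auto
qed

text \<open>Each member is relatively clopen in the union, since the other finitely many closed sets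
  have a closed union, so a connected subset that meets it cannot leave it.\<close>

lemma components_closed_unique:
  fixes A :: "'a::topological_space set set"
  assumes fin: "finite A" and disj: "pairwise disjnt A"
    and A: "\<And>X. X \<in> A \<Longrightarrow> closed X \<and> connected X \<and> X \<noteq> {}"
  shows "components (\<Union>A) = A"
proof -
  have comp: "C \<in> components (\<Union>A)" if C: "C \<in> A" for C
    unfolding in_components_maximal
  proof (intro conjI allI impI)
    fix D assume D: "D \<noteq> {} \<and> C \<subseteq> D \<and> D \<subseteq> \<Union>A \<and> connected D"
    have "closed (\<Union>(A - {C}))" using fin A by (intro closed_Union) auto
    moreover have "C \<inter> \<Union>(A - {C}) \<inter> D = {}"
      using disj C by (auto simp: pairwise_def disjnt_def)
    moreover have "D \<subseteq> C \<union> \<Union>(A - {C})" using D by auto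
    ultimately have "C \<inter> D = {} \<or> \<Union>(A - {C}) \<inter> D = {}"
      using connected_closedD[of D C "\<Union>(A - {C})"] D A[OF C] by blast
    moreover have "C \<inter> D \<noteq> {}" using D A[OF C] by blast
    ultimately show "D = C" using D by blast
  qed (use C A in auto)
  moreover have "D \<in> A" if D: "D \<in> components (\<Union>A)" for D
  proof -
    obtain z where z: "z \<in> D" using D in_components_nonempty by blast
    then obtain C where C: "C \<in> A" "z \<in> C" using D in_components_subset by blast
    then have "C = D" using components_nonoverlap[OF comp[OF C(1)] D] z by blast
    then show ?thesis using C(1) by simp
  qed
  ultimately show ?thesis by blast
qed

section \<open>Germs at infinity\<close>

lemma same_germ_refl: "same_germ A A"
  by (simp add: same_germ_def)

lemma same_germ_sym: "same_germ A B \<Longrightarrow> same_germ B A"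
  by (simp add: same_germ_def eq_commute)

lemma same_germ_trans:
  assumes "same_germ A B" "same_germ B C"
  shows "same_germ A C"
  using assms unfolding same_germ_def by eventually_elim simp

lemma same_germ_Un:
  assumes "same_germ A B" "same_germ C D"
  shows "same_germ (A \<union> C) (B \<union> D)"
  using assms unfolding same_germ_def by eventually_elim (simp add: Un_Diff)

lemma same_germI:
  assumes "\<And>z::complex. r \<le> norm z \<Longrightarrow> z \<in> A \<longleftrightarrow> z \<in> B"
  shows "same_germ A B"
  unfolding same_germ_def
  by (rule eventually_at_top_linorderI[of r]) (use assms in auto)

lemma same_germD:
  assumes "same_germ A B"
  obtains r where "\<And>z::complex. r \<le> norm z \<Longrightarrow> z \<in> A \<longleftrightarrow> z \<in> B"
proof -
  obtain r where r: "\<And>s. r \<le> s \<Longrightarrow> A - ball 0 s = B - ball 0 s"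
    using assms unfolding same_germ_def eventually_at_top_linorder by blast
  show ?thesis
  proof (rule that)
    fix z :: complex assume z: "r \<le> norm z"
    have "z \<in> A \<longleftrightarrow> z \<in> A - ball 0 (norm z)" by simp
    also have "\<dots> \<longleftrightarrow> z \<in> B" unfolding r[OF z] by simp
    finally show "z \<in> A \<longleftrightarrow> z \<in> B" .
  qed
qed

context ray_system
begin

lemma angle_mono_le:
  assumes "r0 \<le> r" "j \<le> k"
  shows "\<theta> j r \<le> \<theta> k r"
  using assms(2)
proof (induction k rule: int_ge_induct)
  case (step i)
  then show ?case using angle_less_succ[OF assms(1), of i] by simp
qed simp

lemma angle_mono:
  assumes "r0 \<le> r" "j < k"
  shows "\<theta> j r < \<theta> k r"
  using angle_less_succ[OF assms(1), of j] angle_mono_le[OF assms(1), of "j + 1" k] assms(2) by simp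

lemma angle_less_iff: "r0 \<le> r \<Longrightarrow> \<theta> j r < \<theta> k r \<longleftrightarrow> j < k"
  using angle_mono angle_mono_le by (meson not_le)

lemma angle_shift:
  assumes "r0 \<le> r"
  shows "\<theta> (k + n * int N) r = \<theta> k r + 2 * pi * n"
proof -
  have nat: "\<theta> (k + int m * int N) r = \<theta> k r + 2 * pi * int m" for m k
  proof (induction m)
    case (Suc m)
    have "k + int (Suc m) * int N = (k + int m * int N) + int N" by (simp add: algebra_simps)
    then show ?case using angle_period[OF assms, of "k + int m * int N"] Suc
      by (simp add: algebra_simps)
  qed simp
  show ?thesis
  proof (cases "0 \<le> n")
    case True
    then show ?thesis using nat[of k "nat n"] by simp
  next
    case False
    then have "\<theta> (k + n * int N + int (nat (- n)) * int N) r =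
        \<theta> (k + n * int N) r + 2 * pi * int (nat (- n))" by (intro nat)
    then show ?thesis using False by simp
  qed
qed

lemma angle_shift_succ: "r0 \<le> r \<Longrightarrow> \<theta> (k + n * int N + 1) r = \<theta> (k + 1) r + 2 * pi * n"
  using angle_shift[of r "k + 1" n] by (simp add: algebra_simps)

lemma index_cong_iff: "k mod int N = l mod int N \<longleftrightarrow> (\<exists>n. k = l + n * int N)"
proof
  assume "k mod int N = l mod int N"
  then obtain n where "k - l = int N * n" by (metis mod_eq_dvd_iff dvdE)
  then show "\<exists>n. k = l + n * int N" by (intro exI[of _ n]) (simp add: algebra_simps)
qed auto

lemma rcis_angle_eq_iff:
  assumes "r0 \<le> r"
  shows "rcis r (\<theta> k r) = rcis r (\<theta> l r) \<longleftrightarrow> k mod int N = l mod int N"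
proof -
  have "rcis r (\<theta> k r) = rcis r (\<theta> l r) \<longleftrightarrow> (\<exists>n. \<theta> k r = \<theta> (l + n * int N) r)"
    using assms r0_pos by (simp add: rcis_eq_iff angle_shift)
  also have "\<dots> \<longleftrightarrow> (\<exists>n. k = l + n * int N)"
    using angle_less_iff[OF assms] by (metis less_irrefl linorder_neqE)
  finally show ?thesis by (simp add: index_cong_iff)
qed

lemma angle_locate:
  assumes r: "r0 \<le> r"
  obtains k where "\<theta> k r \<le> t" "t < \<theta> (k + 1) r"
proof -
  \<comment> \<open>The floor selects the period that contains \<open>t\<close>; among the indices
    of this period, the largest one with angle at most \<open>t\<close> is the required one.\<close>
  define n where "n = \<lfloor>(t - \<theta> 0 r) / (2 * pi)\<rfloor>"
  have "of_int n \<le> (t - \<theta> 0 r) / (2 * pi)" "(t - \<theta> 0 r) / (2 * pi) < of_int n + 1"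
    unfolding n_def by linarith+
  then have "\<theta> 0 r + 2 * pi * n \<le> t" "t < \<theta> 0 r + 2 * pi * (n + 1)"
    by (simp_all add: field_simps)
  then have n: "\<theta> (n * int N) r \<le> t" "t < \<theta> ((n + 1) * int N) r"
    using angle_shift[OF r, of 0 n] angle_shift[OF r, of 0 "n + 1"] by simp_all
  define K where "K = {k \<in> {n * int N..(n + 1) * int N}. \<theta> k r \<le> t}"
  have fin: "finite K"
    by (rule finite_subset[of _ "{n * int N..(n + 1) * int N}"]) (auto simp: K_def)
  have "n * int N \<in> K" using n(1) by (auto simp: K_def algebra_simps)
  then have K: "Max K \<in> K" using Max_in[OF fin] by blast
  have "t < \<theta> (Max K + 1) r"
  proof (rule ccontr)
    assume "\<not> ?thesis"
    moreover then have "Max K + 1 < (n + 1) * int N" using n(2) angle_less_iff[OF r] by (meson not_le order_le_less_trans)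
    ultimately have "Max K + 1 \<in> K" using K by (auto simp: K_def)
    then show False using Max_ge[OF fin] by fastforce
  qed
  then show ?thesis using that K by (auto simp: K_def)
qed

text \<open>By periodicity the functions \<open>\<theta> k\<close> run through all arguments of
  every point of \<open>X\<close> far out, so membership becomes an exact equation between real
  numbers, without a multiple of \<open>2 * pi\<close>.\<close>

lemma rcis_mem_iff:
  assumes "r0 \<le> r"
  shows "rcis r t \<in> X \<longleftrightarrow> (\<exists>k. t = \<theta> k r)"
proof
  assume "rcis r t \<in> X"
  then have "rcis r t \<in> X - ball 0 r0" using assms r0_pos by simp
  then obtain s k where s: "r0 \<le> s" "rcis r t = rcis s (\<theta> k s)" unfolding rays_eq by blast
  then have "norm (rcis r t) = norm (rcis s (\<theta> k s))" by simp
  then have "s = r" using s(1) assms r0_pos by simp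
  then obtain n :: int where "t = \<theta> k r + 2 * pi * n" using s(2) rcis_eq_iff[of r] assms r0_pos by auto
  then show "\<exists>k. t = \<theta> k r" using angle_shift[OF assms, of k n] by metis
next
  assume "\<exists>k. t = \<theta> k r"
  then have "rcis r t \<in> X - ball 0 r0" unfolding rays_eq using assms by blast
  then show "rcis r t \<in> X" by simp
qed

text \<open>The equation avoids choosing an argument of \<open>z\<close> and exhibits the ray as the
  zero set of a continuous function, from which closedness is read off.\<close>

definition ray :: "int \<Rightarrow> real \<Rightarrow> complex set" where
  "ray k R = {z. R \<le> norm z \<and> rcis (norm z) (\<theta> k (norm z)) = z}"

lemma rcis_mem_ray: "r0 \<le> R \<Longrightarrow> R \<le> r \<Longrightarrow> rcis r (\<theta> k r) \<in> ray k R"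
  using r0_pos by (simp add: ray_def)

lemma ray_eq_image:
  assumes "r0 \<le> R"
  shows "ray k R = (\<lambda>r. rcis r (\<theta> k r)) ` {R..}"
proof (intro equalityI subsetI)
  fix z assume "z \<in> ray k R"
  then show "z \<in> (\<lambda>r. rcis r (\<theta> k r)) ` {R..}"
    by (intro image_eqI[of _ _ "norm z"]) (simp_all add: ray_def)
qed (use rcis_mem_ray[OF assms] in auto)

lemma ray_cong: "r0 \<le> R \<Longrightarrow> k mod int N = l mod int N \<Longrightarrow> ray k R = ray l R"
  unfolding ray_eq_image by (rule image_cong) (auto simp: rcis_angle_eq_iff)

lemma ray_inter:
  assumes "r0 \<le> R" "r0 \<le> R'" "z \<in> ray k R" "z \<in> ray l R'"
  shows "k mod int N = l mod int N"
proof -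
  have "rcis (norm z) (\<theta> k (norm z)) = rcis (norm z) (\<theta> l (norm z))"
    using assms(3,4) unfolding ray_def by auto
  moreover have "r0 \<le> norm z" using assms by (simp add: ray_def)
  ultimately show ?thesis using rcis_angle_eq_iff by blast
qed

lemma ray_subset: "r0 \<le> R \<Longrightarrow> ray k R \<subseteq> X"
proof
  fix z assume R: "r0 \<le> R" and z: "z \<in> ray k R"
  then have "rcis (norm z) (\<theta> k (norm z)) \<in> X" by (subst rcis_mem_iff) (auto simp: ray_def)
  then show "z \<in> X" using z by (simp add: ray_def)
qed

lemma mem_some_ray:
  assumes "r0 \<le> R" "z \<in> X" "R \<le> norm z"
  obtains k where "z \<in> ray k R"
proof -
  have "rcis (norm z) (Arg2pi z) \<in> X" using assms(2) by (simp only: rcis_Arg2pi)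
  then obtain k where k: "Arg2pi z = \<theta> k (norm z)"
    using assms(1,3) rcis_mem_iff[of "norm z" "Arg2pi z"] by auto
  have "rcis (norm z) (\<theta> k (norm z)) = z" unfolding k[symmetric] by (simp only: rcis_Arg2pi)
  then have "z \<in> ray k R" using assms(3) by (simp add: ray_def)
  then show ?thesis by (rule that)
qed

lemma Diff_ball_eq:
  assumes R: "r0 \<le> R"
  shows "X - ball 0 R = (\<Union>k. ray k R)"
proof (intro equalityI subsetI)
  fix z assume "z \<in> X - ball 0 R"
  then have "z \<in> X" "R \<le> norm z" by auto
  from mem_some_ray[OF R this] show "z \<in> (\<Union>k. ray k R)" by blast
next
  fix z assume "z \<in> (\<Union>k. ray k R)"
  then obtain k where "z \<in> ray k R" by blast
  then show "z \<in> X - ball 0 R" using ray_subset[OF R, of k] by (auto simp: ray_def)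
qed

lemma closed_ray: "r0 \<le> R \<Longrightarrow> closed (ray k R)"
proof -
  assume R: "r0 \<le> R"
  have cl: "closed {z :: complex. R \<le> norm z}" by (intro closed_Collect_le continuous_intros)
  have "continuous_on {z. R \<le> norm z} (\<lambda>z. z - rcis (norm z) (\<theta> k (norm z)))"
    using R by (intro continuous_intros continuous_on_compose2[OF continuous_angle[of k]]) auto
  from continuous_closed_preimage[OF this cl closed_singleton[of 0]] show ?thesis
    by (rule back_subst[of closed]) (auto simp: ray_def)
qed

lemma connected_ray: "r0 \<le> R \<Longrightarrow> connected (ray k R)"
  unfolding ray_eq_image
  by (intro connected_continuous_image continuous_intros
      continuous_on_subset[OF continuous_angle[of k]] convex_connected convex_real_interval) auto

lemma ray_nonempty: "r0 \<le> R \<Longrightarrow> ray k R \<noteq> {}"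
  unfolding ray_eq_image by simp

lemma range_ray_eq:
  assumes R: "r0 \<le> R"
  shows "range (\<lambda>k. ray k R) = (\<lambda>k. ray k R) ` {0..<int N}"
proof (intro equalityI subsetI)
  fix A assume "A \<in> range (\<lambda>k. ray k R)"
  then obtain k where "A = ray k R" by blast
  moreover have "ray k R = ray (k mod int N) R" by (rule ray_cong[OF R]) simp
  ultimately show "A \<in> (\<lambda>k. ray k R) ` {0..<int N}"
    using N_pos by (intro image_eqI[of _ _ "k mod int N"]) simp_all
qed blast

lemma ray_eq_iff:
  assumes R: "r0 \<le> R"
  shows "ray k R = ray l R \<longleftrightarrow> k mod int N = l mod int N"
proof
  assume eq: "ray k R = ray l R"
  obtain z where "z \<in> ray k R" using ray_nonempty[OF R] by blast
  then show "k mod int N = l mod int N" using ray_inter[OF R R, of z k l] eq by simp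
qed (rule ray_cong[OF R])

lemma components_Diff_ball:
  assumes R: "r0 \<le> R"
  shows "components (X - ball 0 R) = range (\<lambda>k. ray k R)"
  unfolding Diff_ball_eq[OF R]
proof (rule components_closed_unique)
  show "finite (range (\<lambda>k. ray k R))" unfolding range_ray_eq[OF R] by simp
  show "pairwise disjnt (range (\<lambda>k. ray k R))"
  proof (rule pairwiseI)
    fix A B assume "A \<in> range (\<lambda>k. ray k R)" "B \<in> range (\<lambda>k. ray k R)" and ne: "A \<noteq> B"
    then obtain k l where kl: "A = ray k R" "B = ray l R" by blast
    then have "k mod int N \<noteq> l mod int N" using ne by (simp add: ray_eq_iff[OF R])
    then show "disjnt A B" unfolding kl disjnt_iff using ray_inter[OF R R] by blast
  qed
qed (use closed_ray[OF R] connected_ray[OF R] ray_nonempty[OF R] in auto)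

lemma card_components_Diff_ball:
  assumes R: "r0 \<le> R"
  shows "finite (components (X - ball 0 R))" "card (components (X - ball 0 R)) = N"
proof -
  have "inj_on (\<lambda>k. ray k R) {0..<int N}"
    by (rule inj_onI) (simp add: ray_eq_iff[OF R])
  then show "card (components (X - ball 0 R)) = N"
    unfolding components_Diff_ball[OF R] range_ray_eq[OF R] by (simp add: card_image)
  show "finite (components (X - ball 0 R))"
    unfolding components_Diff_ball[OF R] range_ray_eq[OF R] by simp
qed

lemma deg_infinity_eq: "deg_infinity X = N"
  unfolding deg_infinity_def
proof (rule the_equality)
  show ev: "\<forall>\<^sub>F R in at_top. finite (components (X - ball 0 R)) \<and> card (components (X - ball 0 R)) = N"
    by (rule eventually_at_top_linorderI[of r0]) (simp add: card_components_Diff_ball)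
  fix m assume "\<forall>\<^sub>F R in at_top. finite (components (X - ball 0 R)) \<and> card (components (X - ball 0 R)) = m"
  then have "\<forall>\<^sub>F R::real in at_top. m = N" using ev by eventually_elim simp
  then show "m = N" by simp
qed

subsection \<open>Sectors\<close>

text \<open>General indices are allowed because the neighbourhood of a ray that serves to determine
  frontiers is the wedge from \<open>l - 1\<close> to \<open>l + 1\<close>. For small
  \<open>N\<close> such a wedge may wrap around the origin.\<close>

definition wedge :: "int \<Rightarrow> int \<Rightarrow> real \<Rightarrow> complex set" where
  "wedge j k R = {rcis r t | r t. R < r \<and> \<theta> j r < t \<and> t < \<theta> k r}"

definition sector :: "int \<Rightarrow> real \<Rightarrow> complex set" where
  "sector k R = wedge k (k + 1) R"

lemma mem_wedgeI: "R < r \<Longrightarrow> \<theta> j r < t \<Longrightarrow> t < \<theta> k r \<Longrightarrow> rcis r t \<in> wedge j k R"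
  unfolding wedge_def by blast

text \<open>In logarithmic coordinates the wedge is the open region between two graphs. It is
  carried back by \<open>exp\<close>, a covering of the punctured plane and therefore an open map,
  whether or not the wedge wraps around.\<close>

lemma open_wedge:
  assumes R: "r0 \<le> R"
  shows "open (wedge j k R)"
proof -
  define W where "W = {w. R < exp (Re w)} \<inter>
    ((\<lambda>w. Im w - \<theta> j (exp (Re w))) -` {0<..} \<inter> (\<lambda>w. \<theta> k (exp (Re w)) - Im w) -` {0<..})"
  have O: "open {w. R < exp (Re w)}" by (intro open_Collect_less continuous_intros)
  have c: "continuous_on {w. R < exp (Re w)} (\<lambda>w. \<theta> i (exp (Re w)))" for i
    using R by (intro continuous_on_compose2[OF continuous_angle[of i]] continuous_intros) auto
  have "open ({w. R < exp (Re w)} \<inter> (\<lambda>w. Im w - \<theta> j (exp (Re w))) -` {0<..})"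
    "open ({w. R < exp (Re w)} \<inter> (\<lambda>w. \<theta> k (exp (Re w)) - Im w) -` {0<..})"
    by (intro continuous_open_preimage O continuous_intros c; simp)+
  then have "open W" unfolding W_def by (metis Int_assoc Int_left_absorb Int_left_commute open_Int)
  then have "openin (top_of_set (- {0})) (exp ` W)"
    using covering_space_open_map[OF covering_space_exp_punctured_plane, of W] by simp
  moreover have "open (- {0 :: complex})" by (intro open_Compl closed_singleton)
  ultimately have "open (exp ` W)" using openin_open_eq by blast
  moreover have "wedge j k R = exp ` W"
  proof (intro equalityI subsetI)
    fix z assume "z \<in> wedge j k R"
    then obtain r t where z: "z = rcis r t" "R < r" "\<theta> j r < t" "t < \<theta> k r" unfolding wedge_def by blast
    have "exp (Complex (ln r) t) = z" using z(1,2) R r0_pos by (simp add: rcis_def exp_eq_polar exp_of_real)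
    moreover have "Complex (ln r) t \<in> W" using z R r0_pos by (simp add: W_def)
    ultimately show "z \<in> exp ` W" by blast
  next
    fix z assume "z \<in> exp ` W"
    then obtain w where w: "w \<in> W" "z = exp w" by blast
    then have "z = rcis (exp (Re w)) (Im w)" by (simp add: rcis_def exp_eq_polar[of w])
    then show "z \<in> wedge j k R" using w(1) unfolding wedge_def W_def by fastforce
  qed
  ultimately show ?thesis by simp
qed

lemma connected_sector:
  assumes R: "r0 \<le> R"
  shows "connected (sector k R)"
proof -
  let ?f = "\<lambda>p::real \<times> real. rcis (fst p) ((1 - snd p) * \<theta> k (fst p) + snd p * \<theta> (k + 1) (fst p))"
  have "continuous_on ({R<..} \<times> {0<..<1}) ?f"
    using R by (intro continuous_intros continuous_on_compose2[OF continuous_angle[of k]]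
        continuous_on_compose2[OF continuous_angle[of "k + 1"]]) auto
  then have "connected (?f ` ({R<..} \<times> {0<..<1}))"
    by (rule connected_continuous_image) (intro convex_connected convex_Times convex_real_interval)
  moreover have "?f ` ({R<..} \<times> {0<..<1}) = sector k R"
  proof (intro equalityI subsetI)
    fix z assume "z \<in> ?f ` ({R<..} \<times> {0<..<1})"
    then obtain r u where u: "R < r" "0 < u" "u < 1"
      and z: "z = rcis r ((1 - u) * \<theta> k r + u * \<theta> (k + 1) r)" by auto
    define d where "d = \<theta> (k + 1) r - \<theta> k r"
    have d: "0 < d" using angle_less_succ[of r k] u(1) R by (simp add: d_def)
    have eq: "(1 - u) * \<theta> k r + u * \<theta> (k + 1) r = \<theta> k r + u * d" by (simp add: d_def algebra_simps)
    have "0 < u * d" "u * d < d" using d u by simp_all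
    then show "z \<in> sector k R" unfolding sector_def wedge_def z eq using u(1) by (fastforce simp: d_def)
  next
    fix z assume "z \<in> sector k R"
    then obtain r t where t: "R < r" "\<theta> k r < t" "t < \<theta> (k + 1) r" and z: "z = rcis r t"
      unfolding sector_def wedge_def by blast
    define d where "d = \<theta> (k + 1) r - \<theta> k r"
    define u where "u = (t - \<theta> k r) / d"
    have d: "0 < d" using t by (simp add: d_def)
    have u: "0 < u" "u < 1" using t d by (simp_all add: u_def d_def)
    have "(1 - u) * \<theta> k r + u * \<theta> (k + 1) r = \<theta> k r + u * d" by (simp add: d_def algebra_simps)
    also have "\<dots> = t" using d by (simp add: u_def)
    finally have "z = ?f (r, u)" using z by simp
    moreover have "(r, u) \<in> {R<..} \<times> {0<..<1}" using t(1) u by simp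
    ultimately show "z \<in> ?f ` ({R<..} \<times> {0<..<1})" by blast
  qed
  ultimately show ?thesis by simp
qed

lemma sector_nonempty:
  assumes "r0 \<le> R" "R < r"
  shows "rcis r ((\<theta> k r + \<theta> (k + 1) r) / 2) \<in> sector k R"
  using angle_less_succ[of r k] assms unfolding sector_def wedge_def by fastforce

lemma sector_subset_Compl:
  assumes R: "r0 \<le> R"
  shows "sector k R \<subseteq> - (X \<union> cball 0 R)"
proof
  fix z assume "z \<in> sector k R"
  then obtain r t where t: "R < r" "\<theta> k r < t" "t < \<theta> (k + 1) r" and z: "z = rcis r t"
    unfolding sector_def wedge_def by blast
  have r: "r0 \<le> r" using t(1) R by simp
  have "t \<noteq> \<theta> l r" for l
  proof
    assume "t = \<theta> l r"
    then have "k < l" "l < k + 1" using t(2,3) angle_less_iff[OF r] by simp_all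
    then show False by simp
  qed
  then show "z \<in> - (X \<union> cball 0 R)" using rcis_mem_iff[OF r] t(1) r r0_pos z by auto
qed

lemma mem_some_sector:
  assumes R: "r0 \<le> R" and z: "z \<notin> X" "R < norm z"
  obtains k where "z \<in> sector k R"
proof -
  have r: "r0 \<le> norm z" using R z(2) by simp
  obtain k where k: "\<theta> k (norm z) \<le> Arg2pi z" "Arg2pi z < \<theta> (k + 1) (norm z)"
    using angle_locate[OF r] by blast
  have "Arg2pi z \<noteq> \<theta> k (norm z)" using rcis_mem_iff[OF r, of "Arg2pi z"] z(1) rcis_Arg2pi[of z] by auto
  then have "rcis (norm z) (Arg2pi z) \<in> sector k R"
    using k z(2) unfolding sector_def wedge_def by fastforce
  then show ?thesis using that rcis_Arg2pi by simp
qed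

text \<open>A common point has two arguments that differ by full turns. Shifting \<open>k\<close> by
  the corresponding multiple of \<open>N\<close> puts the argument from the wedge between two
  consecutive angle functions, and comparing these with the sides of the wedge bounds the shifted
  index.\<close>

lemma wedge_inter_sector:
  assumes R: "r0 \<le> R" "r0 \<le> R'" and z: "z \<in> wedge i j R" "z \<in> sector k R'"
  obtains m where "m mod int N = k mod int N" "i \<le> m" "m < j"
proof -
  obtain r t where t: "R < r" "\<theta> i r < t" "t < \<theta> j r" "z = rcis r t"
    using z(1) unfolding wedge_def by blast
  obtain r' t' where t': "R' < r'" "\<theta> k r' < t'" "t' < \<theta> (k + 1) r'" "z = rcis r' t'"
    using z(2) unfolding sector_def wedge_def by blast
  have r: "r0 \<le> r" using t(1) R by simp
  have "norm (rcis r t) = norm (rcis r' t')" using t(4) t'(4) by simp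
  then have "r' = r" using t(1) t'(1) R r0_pos by simp
  then have "rcis r t = rcis r t'" using t(4) t'(4) by simp
  moreover have "0 < r" using r r0_pos by simp
  ultimately obtain n :: int where n: "t = t' + 2 * pi * n" using rcis_eq_iff by blast
  have "\<theta> (k + n * int N) r < t" "t < \<theta> (k + n * int N + 1) r"
    using t'(2,3) n unfolding \<open>r' = r\<close> angle_shift[OF r] angle_shift_succ[OF r] by linarith+
  then have "i < k + n * int N + 1" "k + n * int N < j"
    using t(2,3) angle_less_iff[OF r] by (meson less_trans)+
  then show ?thesis using that[of "k + n * int N"] by simp
qed

lemma sector_inter:
  assumes "r0 \<le> R" "r0 \<le> R'" "z \<in> sector k R" "z \<in> sector l R'"
  shows "k mod int N = l mod int N"
proof -
  obtain m where "m mod int N = l mod int N" "k \<le> m" "m < k + 1"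
    using wedge_inter_sector[OF assms(1,2)] assms(3,4) unfolding sector_def[of k] by metis
  then show ?thesis by simp
qed

lemma sector_cong:
  assumes R: "r0 \<le> R" and kl: "k mod int N = l mod int N"
  shows "sector k R = sector l R"
proof -
  have "sector (l + n * int N) R \<subseteq> sector l R" for l n
  proof
    fix z assume "z \<in> sector (l + n * int N) R"
    then obtain r t where t: "R < r" "\<theta> (l + n * int N) r < t" "t < \<theta> (l + n * int N + 1) r" "z = rcis r t"
      unfolding sector_def wedge_def by blast
    have r: "r0 \<le> r" using t(1) R by simp
    have "\<theta> l r < t - 2 * pi * n" "t - 2 * pi * n < \<theta> (l + 1) r"
      using t(2,3) unfolding angle_shift[OF r] angle_shift_succ[OF r] by linarith+
    moreover have "z = rcis r (t - 2 * pi * n)"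
      using t(4) rcis_eq_iff[of r t "t - 2 * pi * n"] r r0_pos by auto
    ultimately show "z \<in> sector l R" unfolding sector_def wedge_def using t(1) by blast
  qed
  then show ?thesis using kl kl[symmetric] unfolding index_cong_iff by (metis subset_antisym)
qed

lemma complement_components_eq:
  assumes R: "r0 \<le> R"
  shows "complement_components X R = range (\<lambda>k. sector k R)"
  unfolding complement_components_def
proof (rule components_open_unique)
  show "pairwise disjnt (range (\<lambda>k. sector k R))"
  proof (rule pairwiseI)
    fix A B assume "A \<in> range (\<lambda>k. sector k R)" "B \<in> range (\<lambda>k. sector k R)" and ne: "A \<noteq> B"
    then obtain k l where kl: "A = sector k R" "B = sector l R" by blast
    then have "k mod int N \<noteq> l mod int N" using ne sector_cong[OF R, of k l] by blast
    then show "disjnt A B" unfolding kl disjnt_iff using sector_inter[OF R R] by blast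
  qed
  show "\<Union> (range (\<lambda>k. sector k R)) = - (X \<union> cball 0 R)"
  proof (intro equalityI subsetI)
    fix z assume "z \<in> - (X \<union> cball 0 R)"
    then have "z \<notin> X" "R < norm z" by auto
    from mem_some_sector[OF R this] obtain k where "z \<in> sector k R" .
    then show "z \<in> \<Union> (range (\<lambda>k. sector k R))" by blast
  qed (use sector_subset_Compl[OF R] in blast)
  fix V assume "V \<in> range (\<lambda>k. sector k R)"
  then obtain k where "V = sector k R" by blast
  then show "open V \<and> connected V \<and> V \<noteq> {}"
    using open_wedge[OF R] connected_sector[OF R] sector_nonempty[OF R, of "R + 1" k]
    by (auto simp: sector_def)
qed

text \<open>A frontier point cannot lie in any sector, as these are open and disjoint or equal, so
  it lies on some ray \<open>l\<close>. The open wedge from \<open>l - 1\<close> to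
  \<open>l + 1\<close> around it meets only sectors with indices congruent to \<open>l - 1\<close>
  or \<open>l\<close>, which leaves two possibilities for \<open>k\<close>. Conversely, both rays
  are reached along the arc at the same radius. Passing to \<open>R' > R\<close> cuts away the part
  of the frontier on the circle of radius \<open>R\<close>.\<close>

lemma frontier_sector:
  assumes R: "r0 \<le> R" "R < R'"
  shows "frontier (sector k R) - ball 0 R' = ray k R' \<union> ray (k + 1) R'"
proof (intro equalityI subsetI)
  have R': "r0 \<le> R'" using R by simp
  fix z assume z: "z \<in> frontier (sector k R) - ball 0 R'"
  have op: "open (sector k R)" unfolding sector_def by (rule open_wedge[OF R(1)])
  then have fr: "z \<in> closure (sector k R)" "z \<notin> sector k R"
    using z by (auto simp: frontier_def interior_open)
  have nz: "R' \<le> norm z" "R < norm z" using z R(2) by auto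
  have "z \<in> X"
  proof (rule ccontr)
    assume "z \<notin> X"
    then obtain l where l: "z \<in> sector l R" using mem_some_sector[OF R(1) _ nz(2)] by metis
    have "open (sector l R)" unfolding sector_def by (rule open_wedge[OF R(1)])
    then have "sector l R \<inter> sector k R \<noteq> {}"
      using l fr(1) open_Int_closure_eq_empty[of "sector l R" "sector k R"] by blast
    then obtain y where "y \<in> sector l R" "y \<in> sector k R" by blast
    then have "sector l R = sector k R" using sector_inter[OF R(1) R(1)] sector_cong[OF R(1)] by metis
    then show False using l fr(2) by blast
  qed
  then obtain l where l: "z \<in> ray l R'" using mem_some_ray[OF R' _ nz(1)] by metis
  then have "z = rcis (norm z) (\<theta> l (norm z))" by (simp add: ray_def eq_commute)
  moreover have "\<theta> (l - 1) (norm z) < \<theta> l (norm z)" "\<theta> l (norm z) < \<theta> (l + 1) (norm z)"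
    using nz(2) R(1) by (intro angle_mono; simp)+
  ultimately have "z \<in> wedge (l - 1) (l + 1) R" unfolding wedge_def using nz(2) by blast
  then have "wedge (l - 1) (l + 1) R \<inter> sector k R \<noteq> {}"
    using open_Int_closure_eq_empty[OF open_wedge[OF R(1)], of "l - 1" "l + 1" "sector k R"] fr(1)
    by blast
  then obtain y where "y \<in> wedge (l - 1) (l + 1) R" "y \<in> sector k R" by blast
  then obtain m where m: "m mod int N = k mod int N" "l - 1 \<le> m" "m < l + 1"
    using wedge_inter_sector[OF R(1) R(1)] by metis
  then consider "m = l" | "l = m + 1" by linarith
  then show "z \<in> ray k R' \<union> ray (k + 1) R'"
  proof cases
    case 1
    then show ?thesis using l m(1) ray_cong[OF R'] by blast
  next
    case 2
    then have "l mod int N = (k + 1) mod int N" using m(1) by (metis mod_add_cong)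
    then show ?thesis using l ray_cong[OF R'] by blast
  qed
next
  have R': "r0 \<le> R'" using R by simp
  fix z assume z: "z \<in> ray k R' \<union> ray (k + 1) R'"
  define r where "r = norm z"
  have r: "R' \<le> r" "r0 \<le> r" "R < r" using z R by (auto simp: ray_def r_def)
  have "z \<in> X" using z ray_subset[OF R'] by blast
  then have "z \<notin> sector k R" using sector_subset_Compl[OF R(1)] by blast
  have lt: "\<theta> k r < \<theta> (k + 1) r" by (rule angle_less_succ[OF r(2)])
  have "z = rcis r (\<theta> k r) \<or> z = rcis r (\<theta> (k + 1) r)" using z by (auto simp: ray_def r_def)
  then have "z \<in> rcis r ` closure {\<theta> k r<..<\<theta> (k + 1) r}" using lt by auto
  also have "\<dots> \<subseteq> closure (rcis r ` {\<theta> k r<..<\<theta> (k + 1) r})"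
    by (intro continuous_image_closure_subset[of UNIV] continuous_intros) auto
  also have "\<dots> \<subseteq> closure (sector k R)"
    using r(3) by (intro closure_mono) (auto intro: mem_wedgeI simp: sector_def)
  finally show "z \<in> frontier (sector k R) - ball 0 R'"
    using \<open>z \<notin> sector k R\<close> open_wedge[OF R(1)] r(1)
    by (simp add: frontier_def sector_def interior_open r_def)
qed

lemma same_germ_ray: "r0 \<le> R \<Longrightarrow> r0 \<le> R' \<Longrightarrow> same_germ (ray k R) (ray k R')"
  by (rule same_germI[of "max R R'"]) (simp add: ray_def)

lemma mem_sector_iff:
  assumes "r0 \<le> R"
  shows "z \<in> sector k R \<longleftrightarrow> R < norm z \<and> z \<in> sector k r0"
proof
  assume "z \<in> sector k R"
  then obtain r t where rt: "z = rcis r t" "R < r" "\<theta> k r < t" "t < \<theta> (k + 1) r"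
    unfolding sector_def wedge_def by blast
  then have "z \<in> sector k r0" using assms by (auto intro: mem_wedgeI simp: sector_def)
  then show "R < norm z \<and> z \<in> sector k r0" using rt(1,2) assms r0_pos by simp
next
  assume z: "R < norm z \<and> z \<in> sector k r0"
  then obtain r t where rt: "z = rcis r t" "r0 < r" "\<theta> k r < t" "t < \<theta> (k + 1) r"
    unfolding sector_def wedge_def by blast
  then have "R < r" using z r0_pos by simp
  then show "z \<in> sector k R" using rt by (auto intro: mem_wedgeI simp: sector_def)
qed

lemma same_germ_sector:
  assumes "r0 \<le> R" "r0 \<le> R'"
  shows "same_germ (sector k R) (sector k R')"
proof (rule same_germI[of "max R R' + 1"])
  fix z :: complex assume "max R R' + 1 \<le> norm z"
  then have "R < norm z" "R' < norm z" by simp_all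
  then show "z \<in> sector k R \<longleftrightarrow> z \<in> sector k R'"
    using mem_sector_iff[OF assms(1)] mem_sector_iff[OF assms(2)] by simp
qed

lemma same_germ_frontier_sector:
  assumes "r0 \<le> R" "r0 \<le> R'"
  shows "same_germ (frontier (sector k R)) (ray k R' \<union> ray (k + 1) R')"
proof (rule same_germI[of "max (R + 1) R'"])
  fix z :: complex assume z: "max (R + 1) R' \<le> norm z"
  have "z \<in> frontier (sector k R) \<longleftrightarrow> z \<in> frontier (sector k R) - ball 0 (R + 1)" using z by simp
  also have "\<dots> \<longleftrightarrow> z \<in> ray k (R + 1) \<union> ray (k + 1) (R + 1)"
    using frontier_sector[of R "R + 1" k] assms by simp
  also have "\<dots> \<longleftrightarrow> z \<in> ray k R' \<union> ray (k + 1) R'" using z by (simp add: ray_def)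
  finally show "z \<in> frontier (sector k R) \<longleftrightarrow> z \<in> ray k R' \<union> ray (k + 1) R'" .
qed

lemma ray_germ_subset:
  assumes R: "r0 \<le> R" and g: "same_germ P (ray l R \<union> ray m R)" and sub: "ray k R \<subseteq> P"
  shows "k mod int N = l mod int N \<or> k mod int N = m mod int N"
proof -
  obtain r where r: "\<And>z. r \<le> norm z \<Longrightarrow> z \<in> P \<longleftrightarrow> z \<in> ray l R \<union> ray m R"
    using same_germD[OF g] by metis
  define s where "s = max r R"
  have z: "rcis s (\<theta> k s) \<in> ray k R" using R by (intro rcis_mem_ray) (simp_all add: s_def)
  have "norm (rcis s (\<theta> k s)) = s" using R r0_pos by (simp add: s_def)
  then have "rcis s (\<theta> k s) \<in> ray l R \<union> ray m R" using r[of "rcis s (\<theta> k s)"] z sub by (auto simp: s_def)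
  then show ?thesis using ray_inter[OF R R z] by blast
qed

lemma ray_germ_eq: "r0 \<le> R \<Longrightarrow> same_germ (ray k R) (ray l R) \<Longrightarrow> k mod int N = l mod int N"
  using ray_germ_subset[of R "ray k R" l l k] by simp

text \<open>If the indices differed, each sector would begin with the ray that ends the other, so
  \<open>k\<close> and \<open>k + 2\<close> would agree modulo \<open>N\<close>. Two rays have to be
  excluded because both sectors then have the same frontier near infinity.\<close>

lemma sector_germ_eq:
  assumes R: "r0 \<le> R" and N: "3 \<le> N"
    and g: "same_germ (ray k R \<union> ray (k + 1) R) (ray l R \<union> ray (l + 1) R)"
  shows "k mod int N = l mod int N"
proof (rule ccontr)
  assume ne: "k mod int N \<noteq> l mod int N"
  have "k mod int N = (l + 1) mod int N" using ray_germ_subset[OF R g] ne by blast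
  moreover have "l mod int N = (k + 1) mod int N"
    using ray_germ_subset[OF R same_germ_sym[OF g]] ne by (metis Un_upper1)
  ultimately have "k mod int N = (k + 1 + 1) mod int N" by (metis mod_add_left_eq)
  then have "int N dvd (k + 1 + 1) - k" by (metis mod_eq_dvd_iff)
  then have "int N dvd 2" by simp
  then show False using N zdvd_imp_le by fastforce
qed

end

subsection \<open>The cyclic order of the rays\<close>

lemma shiftpath_circlepath:
  assumes a: "0 \<le> a" "a \<le> 1"
  shows "shiftpath a (circlepath 0 R) = (\<lambda>s. rcis R (2 * pi * a + 2 * pi * s))"
proof
  fix s
  have c: "circlepath 0 R x = rcis R (2 * pi * x)" for x
    by (simp add: circlepath rcis_def cis_conv_exp mult_ac)
  show "shiftpath a (circlepath 0 R) s = rcis R (2 * pi * a + 2 * pi * s)"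
  proof (cases "a + s \<le> 1")
    case True
    then show ?thesis by (simp add: shiftpath_def c algebra_simps)
  next
    case False
    have "2 * pi * (a + s - 1) = 2 * pi * a + 2 * pi * s - 2 * pi" by (simp add: algebra_simps)
    then show ?thesis using False
      by (simp add: shiftpath_def c rcis_def complex_eq_iff cos_diff sin_diff)
  qed
qed

lemma IVT_sign_change:
  fixes f :: "real \<Rightarrow> real"
  assumes "continuous_on {0..1} f" "0 \<le> a" "a < b" "b \<le> 1" "f a * f b < 0"
  shows "\<exists>s. a < s \<and> s < b \<and> f s = 0"
proof -
  have c: "continuous_on {a..b} f" using assms by (auto elim: continuous_on_subset)
  have "\<exists>s. a \<le> s \<and> s \<le> b \<and> f s = 0"
  proof (cases "f a < 0")
    case True
    then have "0 < f b" using assms(5) by (simp add: mult_less_0_iff)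
    then show ?thesis using IVT'[of f a 0 b] True c assms(3) by auto
  next
    case False
    then have "0 < f a" "f b < 0" using assms(5) by (auto simp: mult_less_0_iff)
    then show ?thesis using IVT2'[of f b 0 a] c assms(3) by auto
  qed
  then obtain s where s: "a \<le> s" "s \<le> b" "f s = 0" by blast
  moreover have "s \<noteq> a" "s \<noteq> b" using s(3) assms(5) by auto
  ultimately show ?thesis by (intro exI[of _ s]) simp
qed

context ray_system
begin

text \<open>The witness is the circle itself, traversed from its point on ray \<open>k\<close>: no
  angle function lies strictly between the two given ones, so the next point of \<open>X\<close> is
  on ray \<open>k + 1\<close>. With at least two rays it comes before a full turn.\<close>

lemma precedes_succ:
  assumes "o_minimal_field_expansion S" and N: "2 \<le> N" and R: "r0 \<le> R"
  shows "precedes S X (ray k R) (ray (k + 1) R)"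
  unfolding precedes_def
proof (rule eventually_at_top_linorderI[of r0])
  interpret o_minimal_field_expansion S by fact
  fix r assume r: "r0 \<le> r"
  then have r_pos: "0 < r" using r0_pos by simp
  let ?C = "ray k r" and ?D = "ray (k + 1) r"
  \<comment> \<open>\<open>circlepath\<close> starts at argument \<open>0\<close>; shifting it by
    the fractional part of \<open>\<theta> k r / (2 * pi)\<close> makes it start on ray
    \<open>k\<close> while the shift stays in the unit interval.\<close>
  define a where "a = frac (\<theta> k r / (2 * pi))"
  have a: "0 \<le> a" "a \<le> 1" by (simp_all add: a_def less_imp_le frac_lt_1)
  define \<gamma> where "\<gamma> = shiftpath a (circlepath 0 r)"
  have \<gamma>: "\<gamma> s = rcis r (\<theta> k r + 2 * pi * s)" for s
  proof -
    have "2 * pi * a + 2 * pi * s = \<theta> k r + 2 * pi * s + 2 * pi * of_int (- \<lfloor>\<theta> k r / (2 * pi)\<rfloor>)"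
      by (simp add: a_def frac_def field_simps)
    then show ?thesis unfolding \<gamma>_def shiftpath_circlepath[OF a] using rcis_eq_iff[OF r_pos] by blast
  qed
  have img: "path_image \<gamma> = sphere 0 r"
    unfolding \<gamma>_def using a r_pos by (subst path_image_shiftpath) simp_all
  have loop: "pathfinish \<gamma> = pathstart \<gamma>" unfolding \<gamma>_def using a by (intro closed_shiftpath) simp_all
  have jordan: "jordan_curve_around_infinity S X r \<gamma>"
    unfolding jordan_curve_around_infinity_def
  proof (intro conjI ballI)
    show "simple_path \<gamma>"
      unfolding \<gamma>_def using a r_pos by (intro simple_path_shiftpath) (simp_all add: simple_path_circlepath)
    show "definable_set S (path_image \<gamma>)"
      unfolding definable_set_iff img mem_sphere_0 by (intro dfn_intros dmap_intros)
    show "path_image \<gamma> \<subseteq> - ball 0 r" unfolding img by auto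
    fix C assume "C \<in> components (X - ball 0 r)"
    then obtain l where l: "C = ray l r" unfolding components_Diff_ball[OF r] by blast
    show "\<exists>!z. z \<in> C \<inter> path_image \<gamma>"
      unfolding l img
    proof (rule ex1I[of _ "rcis r (\<theta> l r)"])
      show "rcis r (\<theta> l r) \<in> ray l r \<inter> sphere 0 r" using rcis_mem_ray[OF r] r_pos by simp
      show "z = rcis r (\<theta> l r)" if "z \<in> ray l r \<inter> sphere 0 r" for z
        using that unfolding ray_def by auto
    qed
  qed (rule loop)
  have ccw: "counterclockwise \<gamma>"
    unfolding counterclockwise_def
  proof
    fix z assume z: "z \<in> inside (path_image \<gamma>)"
    have "- cball 0 r \<subseteq> outside (sphere (0::complex) r)" by (rule outside_subset_convex) auto
    then have "z \<in> cball 0 r" using z inside_Int_outside[of "path_image \<gamma>"] unfolding img by blast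
    moreover have "z \<notin> sphere 0 r" using z inside_no_overlap[of "path_image \<gamma>"] unfolding img by blast
    ultimately have nz: "norm z < r" by simp
    have "winding_number \<gamma> z = winding_number (circlepath 0 r) z"
      unfolding \<gamma>_def using a nz r_pos by (intro winding_number_shiftpath) auto
    also have "\<dots> = 1" using nz by (intro winding_number_circlepath) simp
    finally show "winding_number \<gamma> z = 1" .
  qed
  define t where "t = (\<theta> (k + 1) r - \<theta> k r) / (2 * pi)"
  have "\<theta> k r < \<theta> (k + 1) r" "\<theta> (k + 1) r < \<theta> k r + 2 * pi"
    using angle_mono[OF r, of k "k + 1"] angle_mono[OF r, of "k + 1" "k + int N"] angle_period[OF r, of k] N
    by simp_all
  then have t: "0 < t" "t < 1" by (simp_all add: t_def field_simps)
  have "\<gamma> t = rcis r (\<theta> (k + 1) r)" by (simp add: \<gamma> t_def)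
  then have "\<gamma> t \<in> ?D" using rcis_mem_ray[OF r] by simp
  moreover have "\<gamma> s \<notin> X" if s: "0 < s" "s < t" for s
  proof -
    have "\<theta> k r < \<theta> k r + 2 * pi * s" "\<theta> k r + 2 * pi * s < \<theta> (k + 1) r"
      using s by (simp_all add: t_def field_simps)
    then have "\<theta> k r + 2 * pi * s \<noteq> \<theta> l r" for l
      using angle_less_iff[OF r, of k l] angle_less_iff[OF r, of l "k + 1"] by auto
    then show ?thesis unfolding \<gamma> rcis_mem_iff[OF r] by blast
  qed
  ultimately have ex: "\<exists>t. 0 < t \<and> t < 1 \<and> \<gamma> t \<in> ?D \<and> (\<forall>s. 0 < s \<and> s < t \<longrightarrow> \<gamma> s \<notin> X)"
    using t by blast
  have start: "pathstart \<gamma> \<in> ?C" using rcis_mem_ray[OF r] by (simp add: pathstart_def \<gamma>)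
  have "?C \<noteq> ?D"
  proof
    assume "?C = ?D"
    then have "(k + 1) mod int N = k mod int N" using ray_eq_iff[OF r] by simp
    then have "int N dvd 1" by (metis add_diff_cancel_left' mod_eq_dvd_iff)
    then show False using N by simp
  qed
  then show "\<exists>C\<in>components (X - ball 0 r). \<exists>D\<in>components (X - ball 0 r). C \<noteq> D \<and>
      same_germ (ray k R) C \<and> same_germ (ray (k + 1) R) D \<and>
      (\<exists>\<gamma>. jordan_curve_around_infinity S X r \<gamma> \<and> counterclockwise \<gamma> \<and> pathstart \<gamma> \<in> C \<and>
        (\<exists>t. 0 < t \<and> t < 1 \<and> \<gamma> t \<in> D \<and> (\<forall>s. 0 < s \<and> s < t \<longrightarrow> \<gamma> s \<notin> X)))"
    unfolding components_Diff_ball[OF r]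
    using same_germ_ray[OF R r] jordan ccw start ex by blast
qed

text \<open>Along a simple closed curve through every ray exactly once, lift the argument and compare it
  with the lifted rays. If the first ray met after the \<open>k\<close>-th were the \<open>(k - 1)\<close>-st, the curve
  would have to cross the \<open>k\<close>-th ray a second time (winding number 1) or one of the
  rays \<open>k\<close>, \<open>k - 1\<close> a second time in order to visit the \<open>(k + 1)\<close>-st (winding number 0).\<close>

lemma first_ray_is_succ:
  assumes R: "r0 \<le> R" and N: "3 \<le> N"
    and simple: "simple_path \<gamma>" and loop: "pathfinish \<gamma> = pathstart \<gamma>"
    and avoid: "path_image \<gamma> \<subseteq> - ball 0 R"
    and once: "\<And>k. \<exists>!z. z \<in> ray k R \<inter> path_image \<gamma>"
    and ccw: "counterclockwise \<gamma>"
    and start: "\<gamma> 0 \<in> ray k0 R" and t: "0 < t" "t < 1" "\<gamma> t \<in> ray l R"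
    and first: "\<And>s. 0 < s \<Longrightarrow> s < t \<Longrightarrow> \<gamma> s \<notin> X" and ne: "l mod int N \<noteq> k0 mod int N"
  shows "l mod int N = (k0 + 1) mod int N"
proof -
  have R_pos: "0 < R" using R r0_pos by simp
  have path: "path \<gamma>" using simple by (rule simple_path_imp_path)
  have nz: "0 \<notin> path_image \<gamma>" using avoid R_pos by auto
  have wn: "winding_number \<gamma> 0 = 1 \<or> winding_number \<gamma> 0 = 0"
  proof (cases "0 \<in> inside (path_image \<gamma>)")
    case True
    then show ?thesis using ccw by (simp add: counterclockwise_def)
  next
    case False
    then have "0 \<in> outside (path_image \<gamma>)" using nz inside_Un_outside[of "path_image \<gamma>"] by blast
    then show ?thesis using winding_number_zero_in_outside[OF path loop] by simp
  qed
  obtain q where q: "path q" "pathfinish q - pathstart q = 2 * of_real pi * \<i> * winding_number \<gamma> 0"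
    "\<And>s. s \<in> {0..1} \<Longrightarrow> \<gamma> s = 0 + exp (q s)"
    using winding_number_as_continuous_log[OF path nz] by metis
  define \<rho> where "\<rho> s = exp (Re (q s))" for s
  have \<gamma>_eq: "\<gamma> s = rcis (\<rho> s) (Im (q s))" if "s \<in> {0..1}" for s
    using q(3)[OF that] by (simp add: \<rho>_def rcis_def exp_eq_polar[of "q s"])
  have \<rho>R: "R \<le> \<rho> s" if "s \<in> {0..1}" for s
  proof -
    have "\<gamma> s \<in> path_image \<gamma>" using that by (simp add: path_image_def)
    then have "R \<le> norm (\<gamma> s)" using avoid by auto
    then show ?thesis unfolding \<gamma>_eq[OF that] by (simp add: \<rho>_def)
  qed
  have \<rho>0: "r0 \<le> \<rho> s" "0 < \<rho> s" if "s \<in> {0..1}" for s using \<rho>R[OF that] R R_pos by simp_all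
  have cq: "continuous_on {0..1} q" using q(1) by (simp add: path_def)
  \<comment> \<open>Angular distance from the \<open>j\<close>-th lifted ray to the lifted curve.
    The curve is on a ray exactly when some index congruent to that of the ray has distance zero;
    the distances decrease in \<open>j\<close>, and every change of sign is a crossing.\<close>
  define e where "e j s = Im (q s) - \<theta> j (\<rho> s)" for j s
  have cont_e: "continuous_on {0..1} (e j)" for j
  proof -
    have "continuous_on {0..1} (\<lambda>s. Im (q s) - \<theta> j (\<rho> s))"
      unfolding \<rho>_def
      by (intro continuous_intros cq continuous_on_compose2[OF continuous_angle[of j]])
        (use \<rho>0(1) in \<open>auto simp: \<rho>_def\<close>)
    then show ?thesis unfolding e_def .
  qed
  have e_less: "e i s < e j s" if "j < i" "s \<in> {0..1}" for i j s
    using angle_mono[OF \<rho>0(1)[OF that(2)] that(1)] by (simp add: e_def)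
  have zero_mem: "\<gamma> s \<in> ray j R" if "e j s = 0" "s \<in> {0..1}" for j s
  proof -
    have "\<gamma> s = rcis (\<rho> s) (\<theta> j (\<rho> s))" using that \<gamma>_eq by (simp add: e_def)
    then show ?thesis using rcis_mem_ray[OF R \<rho>R[OF that(2)]] by simp
  qed
  have mem_zero: "\<exists>i. i mod int N = j mod int N \<and> e i s = 0" if s: "\<gamma> s \<in> ray j R" "s \<in> {0..1}" for j s
  proof -
    have "norm (\<gamma> s) = \<rho> s" using \<gamma>_eq[OF s(2)] by (simp add: \<rho>_def)
    then have "rcis (\<rho> s) (Im (q s)) = rcis (\<rho> s) (\<theta> j (\<rho> s))"
      using s(1) \<gamma>_eq[OF s(2)] by (simp add: ray_def)
    then obtain n :: int where "Im (q s) = \<theta> j (\<rho> s) + 2 * pi * n"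
      using rcis_eq_iff[OF \<rho>0(2)[OF s(2)]] by blast
    then have "e (j + n * int N) s = 0" using angle_shift[OF \<rho>0(1)[OF s(2)]] by (simp add: e_def)
    then show ?thesis by (intro exI[of _ "j + n * int N"]) simp
  qed
  have meet_once: "s = s' \<or> s \<in> {0, 1} \<and> s' \<in> {0, 1}"
    if "s \<in> {0..1}" "s' \<in> {0..1}" "\<gamma> s \<in> ray j R" "\<gamma> s' \<in> ray j R" for s s' j
  proof -
    have "\<gamma> s \<in> path_image \<gamma>" "\<gamma> s' \<in> path_image \<gamma>" using that(1,2) by (simp_all add: path_image_def)
    then have "\<gamma> s = \<gamma> s'" using once[of j] that(3,4) by blast
    then have "s = s' \<or> s = 0 \<and> s' = 1 \<or> s = 1 \<and> s' = 0"
      using simple that(1,2) unfolding simple_path_def loop_free_def by blast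
    then show ?thesis by blast
  qed
  obtain k where k: "k mod int N = k0 mod int N" "e k 0 = 0" using mem_zero[OF start] by auto
  obtain l' where l': "l' mod int N = l mod int N" "e l' t = 0" using mem_zero[OF t(3)] t(1,2) by auto
  have "l' \<noteq> k" using ne k(1) l'(1) by auto
  have t01: "t \<in> {0..1}" using t by simp
  have no_cross: False if "0 < s" "s < t" "e j s = 0" for s j
  proof -
    have "\<gamma> s \<in> ray j R" using zero_mem that t by simp
    then show False using first[OF that(1,2)] ray_subset[OF R] by blast
  qed
  \<comment> \<open>A higher lift at time \<open>t\<close> could only be reached by crossing the
    lift \<open>k + 1\<close> earlier, although no ray is met before \<open>t\<close>; the lift
    \<open>k - 1\<close> bounds \<open>l'\<close> from below in the same way.\<close>
  have "l' \<le> k + 1"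
  proof (rule ccontr)
    assume "\<not> ?thesis"
    then have "e (k + 1) 0 < 0" "0 < e (k + 1) t"
      using e_less[of k "k + 1" 0] e_less[of "k + 1" l' t] k(2) l'(2) t01 by auto
    then have "e (k + 1) 0 * e (k + 1) t < 0" by (rule mult_neg_pos)
    from IVT_sign_change[OF cont_e _ t(1) _ this] show False using no_cross t by auto
  qed
  moreover have "k - 1 \<le> l'"
  proof (rule ccontr)
    assume "\<not> ?thesis"
    then have "0 < e (k - 1) 0" "e (k - 1) t < 0"
      using e_less[of "k - 1" k 0] e_less[of l' "k - 1" t] k(2) l'(2) t01 by auto
    then have "e (k - 1) 0 * e (k - 1) t < 0" by (rule mult_pos_neg)
    from IVT_sign_change[OF cont_e _ t(1) _ this] show False using no_cross t by auto
  qed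
  moreover have "l' \<noteq> k - 1"
  proof
    assume l'k: "l' = k - 1"
    have et: "e k t < 0" using e_less[of l' k t] l'(2) l'k t01 by simp
    have no_k: False if "0 < s" "s < 1" "e k s = 0" for s
      using meet_once[of 0 s k] zero_mem[of k s] zero_mem[of k 0] k(2) that by auto
    have q1: "Im (q 1) - Im (q 0) = 2 * pi * Re (winding_number \<gamma> 0)"
      using arg_cong[OF q(2), of Im] wn by (auto simp: pathfinish_def pathstart_def)
    have "\<gamma> 1 = \<gamma> 0" using loop by (simp add: pathfinish_def pathstart_def)
    then have \<rho>1: "\<rho> 1 = \<rho> 0" using \<gamma>_eq[of 0] \<gamma>_eq[of 1]
      by (metis \<rho>_def abs_exp_cancel atLeastAtMost_iff complex_mod_rcis order_refl zero_le_one)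
    have e1: "e k 1 = 2 * pi * Re (winding_number \<gamma> 0)" using q1 \<rho>1 k(2) by (simp add: e_def)
    from wn show False
    proof
      assume "winding_number \<gamma> 0 = 1"
      then have "0 < e k 1" using e1 by simp
      then have "e k t * e k 1 < 0" using et by (intro mult_neg_pos)
      from IVT_sign_change[OF cont_e _ t(2) _ this] obtain s where "t < s" "s < 1" "e k s = 0"
        using t by auto
      then show False using no_k[of s] t by simp
    next
      assume "winding_number \<gamma> 0 = 0"
      then have ek1: "e k 1 = 0" using e1 by simp
      obtain z where "z \<in> ray (k + 1) R \<inter> path_image \<gamma>" using once[of "k + 1"] by blast
      then obtain u where u: "u \<in> {0..1}" "\<gamma> u \<in> ray (k + 1) R" by (auto simp: path_image_def)
      obtain m where m: "m mod int N = (k + 1) mod int N" "e m u = 0" using mem_zero[OF u(2,1)] by blast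
      have mk: "m \<noteq> k" "m \<noteq> k - 1"
      proof -
        have "\<not> int N dvd 1" "\<not> int N dvd 2" using N zdvd_imp_le by fastforce+
        moreover have "int N dvd (k + 1) - m" using m(1) by (metis mod_eq_dvd_iff)
        ultimately show "m \<noteq> k" "m \<noteq> k - 1" by auto
      qed
      have disj: False if "\<gamma> u \<in> ray j R" "j = k \<or> j = k - 1" for j
      proof -
        have "j mod int N = m mod int N" using ray_inter[OF R R that(1) u(2)] m(1) by simp
        then have "int N dvd (k + 1) - j" using m(1) by (metis mod_eq_dvd_iff)
        moreover have "\<not> int N dvd 1" "\<not> int N dvd 2" using N zdvd_imp_le by fastforce+
        ultimately show False using that(2) by auto
      qed
      have u_ne: "u \<noteq> 0" "u \<noteq> 1" "u \<noteq> t"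
        using disj zero_mem[of k 0] zero_mem[of k 1] zero_mem[of l' t] k(2) ek1 l'(2) l'k t01 by auto
      then have tu: "t < u" "u < 1" using no_cross[of u m] m(2) u(1) by force+
      show False
      \<comment> \<open>The ray \<open>k + 1\<close> may be hit in any lift \<open>m\<close>
        congruent to \<open>k + 1\<close>. As the curve is below the lift \<open>k\<close> at time
        \<open>t\<close> and ends on it at time 1, a hit above \<open>k\<close> forces a crossing of
        \<open>k\<close> before it, and a hit below \<open>k - 1\<close> forces a crossing of
        \<open>k - 1\<close> after it.\<close>
      proof (cases "k < m")
        case True
        then have "0 < e k u" using e_less[of k m u] m(2) u(1) by simp
        then have "e k t * e k u < 0" using et by (intro mult_neg_pos)
        from IVT_sign_change[OF cont_e _ tu(1) _ this] obtain s where "t < s" "s < u" "e k s = 0"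
          using t tu by auto
        then show False using no_k[of s] t tu by simp
      next
        case False
        then have "m < k - 1" using mk by simp
        then have "e (k - 1) u < 0" "0 < e (k - 1) 1"
          using e_less[of m "k - 1" u] m(2) u(1) e_less[of "k - 1" k 1] ek1 by auto
        then have "e (k - 1) u * e (k - 1) 1 < 0" by (rule mult_neg_pos)
        from IVT_sign_change[OF cont_e _ tu(2) _ this] obtain s where s: "u < s" "s < 1" "e (k - 1) s = 0"
          using u(1) by auto
        then have "\<gamma> s \<in> ray (k - 1) R" "\<gamma> t \<in> ray (k - 1) R"
          using zero_mem[of "k - 1" s] zero_mem[of l' t] l'(2) l'k t01 tu t by auto
        then show False using meet_once[of s t "k - 1"] s t tu by auto
      qed
    qed
  qed
  ultimately have "l' = k + 1" using \<open>l' \<noteq> k\<close> by simp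
  then show ?thesis using k(1) l'(1) by (metis mod_add_left_eq)
qed

text \<open>The curve provided by \<open>precedes\<close> is arbitrary, so this settles independence
  of the curve: whatever the witness, \<open>first_ray_is_succ\<close> leaves only the next index.
  Germs transfer this to the given representatives.\<close>

lemma precedes_imp_succ:
  assumes N: "3 \<le> N" and R: "r0 \<le> R"
    and prec: "precedes S X A B" and A: "same_germ A (ray k R)" and B: "same_germ B (ray l R)"
  shows "l mod int N = (k + 1) mod int N"
proof -
  obtain R1 where R1: "\<And>r. R1 \<le> r \<Longrightarrow> \<exists>C\<in>components (X - ball 0 r). \<exists>D\<in>components (X - ball 0 r).
      C \<noteq> D \<and> same_germ A C \<and> same_germ B D \<and>
      (\<exists>\<gamma>. jordan_curve_around_infinity S X r \<gamma> \<and> counterclockwise \<gamma> \<and> pathstart \<gamma> \<in> C \<and>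
        (\<exists>t. 0 < t \<and> t < 1 \<and> \<gamma> t \<in> D \<and> (\<forall>s. 0 < s \<and> s < t \<longrightarrow> \<gamma> s \<notin> X)))"
    using prec unfolding precedes_def eventually_at_top_linorder by blast
  define r where "r = max R1 r0"
  have r: "r0 \<le> r" by (simp add: r_def)
  have "R1 \<le> r" by (simp add: r_def)
  from R1[OF this] obtain k' l' \<gamma> t where ne: "ray k' r \<noteq> ray l' r"
    and germs: "same_germ A (ray k' r)" "same_germ B (ray l' r)"
    and jordan: "jordan_curve_around_infinity S X r \<gamma>" and ccw: "counterclockwise \<gamma>"
    and start: "pathstart \<gamma> \<in> ray k' r"
    and t: "0 < t" "t < 1" "\<gamma> t \<in> ray l' r" "\<forall>s. 0 < s \<and> s < t \<longrightarrow> \<gamma> s \<notin> X"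
    unfolding components_Diff_ball[OF r] by blast
  have "l' mod int N = (k' + 1) mod int N"
  proof (rule first_ray_is_succ[OF r N _ _ _ _ ccw])
    show "\<exists>!z. z \<in> ray j r \<inter> path_image \<gamma>" for j
      using jordan unfolding jordan_curve_around_infinity_def components_Diff_ball[OF r] by blast
    show "l' mod int N \<noteq> k' mod int N" using ne ray_eq_iff[OF r] by metis
  qed (use jordan start t in \<open>auto simp: jordan_curve_around_infinity_def pathstart_def\<close>)
  moreover have "k mod int N = k' mod int N"
    by (rule ray_germ_eq[OF r]) (meson A germs(1) R r same_germ_ray same_germ_sym same_germ_trans)
  moreover have "l mod int N = l' mod int N"
    by (rule ray_germ_eq[OF r]) (meson B germs(2) R r same_germ_ray same_germ_sym same_germ_trans)
  ultimately show ?thesis by (metis mod_add_left_eq)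
qed

end

section \<open>Homeomorphisms of the plane\<close>

subsection \<open>Behaviour at infinity\<close>

text \<open>Homeomorphisms of the plane are proper: the points sent into a disk form its image under
  \<open>G\<close>, which is compact. The transfer of germs at infinity rests on this.\<close>

lemma homeomorphism_norm_bound:
  fixes H :: "complex \<Rightarrow> complex"
  assumes "homeomorphism UNIV UNIV H G"
  obtains b where "\<And>z. b \<le> norm z \<Longrightarrow> B \<le> norm (H z)"
proof -
  have "compact (G ` cball 0 B)"
    by (rule compact_continuous_image[OF continuous_on_subset[OF homeomorphism_cont2[OF assms] subset_UNIV] compact_cball])
  then have "bounded (G ` cball 0 B)" by (rule compact_imp_bounded)
  then obtain b where "\<forall>y\<in>G ` cball 0 B. norm y \<le> b" by (auto simp only: bounded_iff)
  then have b: "norm (G w) \<le> b" if "w \<in> cball 0 B" for w using that by blast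
  have "B \<le> norm (H z)" if "b + 1 \<le> norm z" for z
  proof (rule ccontr)
    assume "\<not> ?thesis"
    then have "norm (G (H z)) \<le> b" by (intro b) simp
    then show False using that homeomorphism_apply1[OF assms, of z] by simp
  qed
  then show ?thesis by (rule that)
qed

lemma same_germ_image:
  assumes hom: "homeomorphism UNIV UNIV H G" and AB: "same_germ A B"
  shows "same_germ (H ` A) (H ` B)"
proof -
  obtain r where r: "\<And>z. r \<le> norm z \<Longrightarrow> z \<in> A \<longleftrightarrow> z \<in> B" using same_germD[OF AB] by metis
  obtain b where b: "\<And>w. b \<le> norm w \<Longrightarrow> r \<le> norm (G w)"
    using homeomorphism_norm_bound[OF homeomorphism_symD[OF hom]] by metis
  have mem: "w \<in> H ` C \<longleftrightarrow> G w \<in> C" for w C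
    using homeomorphism_apply1[OF hom] homeomorphism_apply2[OF hom] by (metis UNIV_I image_iff)
  show ?thesis by (rule same_germI[of b]) (simp add: mem r b)
qed

text \<open>Closures are local, so agreement outside a disk passes to the closures of the sets and
  of their complements, away from the bounding circle.\<close>

lemma same_germ_frontier:
  assumes "same_germ A B"
  shows "same_germ (frontier A) (frontier B)"
proof -
  obtain r where r: "\<And>z. r \<le> norm z \<Longrightarrow> z \<in> A \<longleftrightarrow> z \<in> B" using same_germD[OF assms] by metis
  have *: "z \<in> closure C" if "z \<in> closure D" "r < norm z" "\<And>y. r \<le> norm y \<Longrightarrow> y \<in> D \<Longrightarrow> y \<in> C"
    for z C D
  proof -
    have "z \<in> - cball 0 r \<inter> closure D" using that(1,2) by simp
    also have "\<dots> \<subseteq> closure (- cball 0 r \<inter> D)" by (rule open_Int_closure_subset) auto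
    also have "\<dots> \<subseteq> closure C" using that(3) by (intro closure_mono) auto
    finally show ?thesis .
  qed
  show ?thesis
  proof (rule same_germI[of "r + 1"])
    fix z :: complex assume "r + 1 \<le> norm z"
    then have "r < norm z" by simp
    then show "z \<in> frontier A \<longleftrightarrow> z \<in> frontier B"
      unfolding frontier_closures using *[of z A B] *[of z B A] *[of z "- A" "- B"] *[of z "- B" "- A"] r
      by auto
  qed
qed

lemma homeomorphism_image_eq_vimage:
  assumes "homeomorphism UNIV UNIV H G"
  shows "H ` A = G -` A"
proof (intro equalityI subsetI)
  fix y assume "y \<in> G -` A"
  then show "y \<in> H ` A" using homeomorphism_apply2[OF assms, of y] by (metis UNIV_I image_eqI vimageD)
qed (use homeomorphism_apply1[OF assms] in auto)

lemma homeomorphism_closed_image: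
  assumes "homeomorphism UNIV UNIV H G" "closed A"
  shows "closed (H ` A)"
  unfolding homeomorphism_image_eq_vimage[OF assms(1)]
  using homeomorphism_cont2[OF assms(1)] assms(2) by (rule closed_vimage[rotated])

lemma homeomorphism_closure_image:
  assumes "homeomorphism UNIV UNIV H G"
  shows "closure (H ` A) = H ` closure A"
proof
  have "closed (H ` closure A)" by (rule homeomorphism_closed_image[OF assms closed_closure])
  then show "closure (H ` A) \<subseteq> H ` closure A" by (intro closure_minimal image_mono closure_subset)
  show "H ` closure A \<subseteq> closure (H ` A)"
    using homeomorphism_cont1[OF assms] by (intro continuous_image_closure_subset[of UNIV]) auto
qed

lemma homeomorphism_frontier_image:
  assumes "homeomorphism UNIV UNIV H G"
  shows "frontier (H ` A) = H ` frontier A"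
proof -
  have bij: "bij H" using assms unfolding homeomorphism_def by (metis UNIV_I bij_betw_def inj_on_inverseI)
  then have "- (H ` A) = H ` (- A)" by (simp add: bij_image_Compl_eq)
  then show ?thesis unfolding frontier_closures
    using bij by (simp add: homeomorphism_closure_image[OF assms] image_Int bij_is_inj)
qed

subsection \<open>Conjugation by inversions\<close>

lemma phi_0: "phi 0 z = z /\<^sub>R (norm z)\<^sup>2"
  by (simp add: phi_def)

lemma phi_eq: "phi a z = phi 0 (z - a)"
  by (simp add: phi_def)

lemma norm_phi_0: "norm (phi 0 z) = inverse (norm z)"
  by (cases "z = 0") (simp_all add: phi_0 power2_eq_square field_simps)

lemma phi_0_phi_0 [simp]: "phi 0 (phi 0 z) = z"
proof (cases "z = 0")
  case False
  then have "inverse ((inverse (norm z))\<^sup>2) * inverse ((norm z)\<^sup>2) = 1" by (simp add: field_simps)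
  then show ?thesis unfolding phi_0[of "phi 0 z"] norm_phi_0 by (simp add: phi_0)
qed (simp add: phi_0)

lemma phi_0_0 [simp]: "phi 0 0 = 0"
  by (simp add: phi_0)

lemma phi_0_eq_0_iff [simp]: "phi 0 z = 0 \<longleftrightarrow> z = 0"
  by (auto simp: phi_0)

text \<open>Away from the origin this is a composition of continuous maps, as \<open>K 0 = 0\<close>
  keeps \<open>K\<close> from vanishing elsewhere. Near the origin \<open>phi 0\<close> tends to
  infinity, \<open>K\<close> follows by properness, and the outer inversion returns to
  \<open>0\<close>, which is also the value that division by zero gives to
  \<open>phi 0 0\<close>.\<close>

lemma continuous_inversion_conj:
  assumes hom: "homeomorphism UNIV UNIV K L" and K0: "K 0 = 0"
  shows "continuous_on UNIV (\<lambda>z. phi 0 (K (phi 0 z)))"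
proof -
  have phi_cont: "isCont (phi 0) z" if "z \<noteq> 0" for z
    unfolding phi_0[abs_def] using that by (intro continuous_intros) auto
  have K_cont: "isCont K z" for z
    using homeomorphism_cont1[OF hom] by (simp add: continuous_on_eq_continuous_at)
  have K_ne: "K z \<noteq> 0" if "z \<noteq> 0" for z
    using homeomorphism_apply1[OF hom, of z] homeomorphism_apply1[OF hom, of 0] K0 that by auto
  have "isCont (\<lambda>z. phi 0 (K (phi 0 z))) z" for z
  proof (cases "z = 0")
    case False
    then show ?thesis
      by (intro isCont_o2[OF isCont_o2[OF phi_cont K_cont] phi_cont] K_ne) simp_all
  next
    case True
    have "filterlim (phi 0) at_infinity (at 0)"
    proof (rule filterlim_norm_at_top_imp_at_infinity, unfold norm_phi_0, rule filterlim_inverse_at_top)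
      show "((\<lambda>z::complex. norm z) \<longlongrightarrow> 0) (at 0)" by (intro tendsto_norm_zero tendsto_ident_at)
      show "\<forall>\<^sub>F z::complex in at 0. 0 < norm z" by (simp add: eventually_at_filter)
    qed
    moreover have "filterlim K at_infinity at_infinity"
      unfolding filterlim_at_infinity_conv_norm_at_top filterlim_at_top
    proof
      fix B
      obtain b where "\<And>z. b \<le> norm z \<Longrightarrow> B \<le> norm (K z)"
        using homeomorphism_norm_bound[OF hom] by metis
      then show "\<forall>\<^sub>F z in at_infinity. B \<le> norm (K z)" by (auto simp: eventually_at_infinity)
    qed
    ultimately have "filterlim (\<lambda>z. K (phi 0 z)) at_infinity (at 0)" by (rule filterlim_compose[rotated])
    then have "((\<lambda>z. norm (phi 0 (K (phi 0 z)))) \<longlongrightarrow> 0) (at 0)"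
      unfolding norm_phi_0 by (intro tendsto_inverse_0_at_top filterlim_at_infinity_imp_norm_at_top)
    then have "((\<lambda>z. phi 0 (K (phi 0 z))) \<longlongrightarrow> 0) (at 0)" by (rule tendsto_norm_zero_cancel)
    then show ?thesis using True K0 by (simp add: isCont_def)
  qed
  then show ?thesis by (simp add: continuous_on_eq_continuous_at)
qed

lemma homeomorphism_inversion_conj:
  assumes "homeomorphism UNIV UNIV K L" "K 0 = 0"
  shows "homeomorphism UNIV UNIV (\<lambda>z. phi 0 (K (phi 0 z))) (\<lambda>z. phi 0 (L (phi 0 z)))"
proof -
  have L: "homeomorphism UNIV UNIV L K" using assms(1) by (rule homeomorphism_symD)
  have "L 0 = 0" using homeomorphism_apply1[OF assms(1), of 0] assms(2) by simp
  moreover have "L (K z) = z" "K (L z) = z" for z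
    using homeomorphism_apply1[OF assms(1)] homeomorphism_apply2[OF assms(1)] by simp_all
  ultimately show ?thesis
    by (intro homeomorphismI continuous_inversion_conj[OF assms] continuous_inversion_conj[OF L]) simp_all
qed

lemma homeomorphism_translation_conj:
  fixes K :: "complex \<Rightarrow> complex"
  assumes "homeomorphism UNIV UNIV K L"
  shows "homeomorphism UNIV UNIV (\<lambda>z. b + K (z + a)) (\<lambda>z. L (z - b) - a)"
proof -
  have "L (K z) = z" "K (L z) = z" for z
    using homeomorphism_apply1[OF assms] homeomorphism_apply2[OF assms] by simp_all
  then show ?thesis
    by (intro homeomorphismI continuous_intros continuous_on_compose2[OF homeomorphism_cont1[OF assms]]
        continuous_on_compose2[OF homeomorphism_cont2[OF assms]]) simp_all
qed

context o_minimal_field_expansion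
begin

lemma dmap_phi: "dmap f \<Longrightarrow> dmap (\<lambda>x. phi a (f x))"
  unfolding phi_def by (intro dmap_intros)

lemma g_map_phi:
  assumes "x \<noteq> p"
  shows "g_map h p q (phi p x) = phi q (h x)"
proof -
  have "inj_on (phi p) (- {p})"
    by (rule inj_onI) (metis add_diff_cancel diff_add_cancel phi_0_phi_0 phi_eq)
  then have "inv_into (- {p}) (phi p) (phi p x) = x" using assms by (intro inv_into_f_f) auto
  moreover have "phi p x \<noteq> 0" using assms by (simp add: phi_eq[of p])
  ultimately show ?thesis by (simp add: g_map_def)
qed

lemma extends_of_g_map_extends:
  assumes p: "p \<notin> X"
    and ext: "extends_to_definable_homeomorphism S (insert 0 (phi p ` X)) (g_map h p q)"
  shows "extends_to_definable_homeomorphism S X h"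
proof -
  obtain K L where K: "homeomorphism UNIV UNIV K L" "dmap K"
    "\<And>y. y \<in> insert 0 (phi p ` X) \<Longrightarrow> K y = g_map h p q y"
    using ext by (auto simp: extends_to_definable_homeomorphism_def definable_map_UNIV)
  have K0: "K 0 = 0" using K(3)[of 0] by (simp add: g_map_def)
  \<comment> \<open>The inverse of \<open>phi q\<close> is \<open>phi 0\<close> followed by the
    translation by \<open>q\<close>. The convention \<open>phi 0 0 = 0\<close> together with
    \<open>K 0 = 0\<close> supplies the missing value \<open>F p = q\<close>.\<close>
  define F where "F z = q + phi 0 (K (phi 0 (z + (- p))))" for z
  have "homeomorphism UNIV UNIV F (\<lambda>z. phi 0 (L (phi 0 (z - q))) - (- p))"
    unfolding F_def by (rule homeomorphism_translation_conj[OF homeomorphism_inversion_conj[OF K(1) K0]])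
  moreover have "dmap F"
    unfolding F_def by (intro dmap_intros dmap_phi dmap_comp[OF K(2)])
  moreover have "F x = h x" if "x \<in> X" for x
  proof -
    have "K (phi p x) = phi q (h x)" using K(3)[of "phi p x"] g_map_phi[of x p h q] that p by auto
    then have "K (phi 0 (x - p)) = phi 0 (h x - q)" by (simp only: phi_eq[of p] phi_eq[of q])
    then show ?thesis by (simp add: F_def)
  qed
  ultimately show ?thesis
    unfolding extends_to_definable_homeomorphism_def definable_map_UNIV by blast
qed

lemma g_map_extends_of_extends:
  assumes p: "p \<notin> X"
    and H: "homeomorphism UNIV UNIV H G" "dmap H" "\<And>x. x \<in> X \<Longrightarrow> H x = h x" "H p = q"
  shows "extends_to_definable_homeomorphism S (insert 0 (phi p ` X)) (g_map h p q)"
proof -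
  define T where "T z = - q + H (z + p)" for z
  have T: "homeomorphism UNIV UNIV T (\<lambda>z. G (z - (- q)) - p)"
    unfolding T_def by (rule homeomorphism_translation_conj[OF H(1)])
  have T0: "T 0 = 0" by (simp add: T_def H(4))
  define K where "K z = phi 0 (T (phi 0 z))" for z
  have "homeomorphism UNIV UNIV K (\<lambda>z. phi 0 (G (phi 0 z - (- q)) - p))"
    unfolding K_def by (rule homeomorphism_inversion_conj[OF T T0])
  moreover have "dmap K"
    unfolding K_def T_def by (intro dmap_intros dmap_phi dmap_comp[OF H(2)])
  moreover have "K y = g_map h p q y" if y: "y \<in> insert 0 (phi p ` X)" for y
  proof (cases "y = 0")
    case True
    show ?thesis using True T0 by (simp add: K_def g_map_def)
  next
    case False
    then obtain x where x: "x \<in> X" "y = phi p x" using y by auto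
    then have "g_map h p q y = phi 0 (h x - q)" using g_map_phi[of x p h q] p phi_eq[of q] by auto
    moreover have "K y = phi 0 (h x - q)" by (simp add: K_def T_def x phi_eq[of p] H(3))
    ultimately show ?thesis by simp
  qed
  ultimately show ?thesis
    unfolding extends_to_definable_homeomorphism_def definable_map_UNIV by blast
qed

subsection \<open>Moving a point inside a connected open set\<close>

definition moves :: "complex set \<Rightarrow> complex \<Rightarrow> complex \<Rightarrow> bool" where
  "moves U a b \<longleftrightarrow> (\<exists>F G. homeomorphism UNIV UNIV F G \<and> dmap F \<and> F a = b \<and> (\<forall>x. x \<notin> U \<longrightarrow> F x = x))"

lemma moves_sym:
  assumes "moves U a b"
  shows "moves U b a"
proof -
  obtain F G where F: "homeomorphism UNIV UNIV F G" "dmap F" "F a = b" "\<And>x. x \<notin> U \<Longrightarrow> F x = x"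
    using assms unfolding moves_def by blast
  have FG: "F (G y) = y" "G (F y) = y" for y
    using homeomorphism_apply1[OF F(1)] homeomorphism_apply2[OF F(1)] by simp_all
  \<comment> \<open>The graph of the inverse is the transposed graph of \<open>F\<close>.\<close>
  have "dfn (\<lambda>z. fst z = F (snd z))" by (intro dfn_intros dmap_intros dmap_comp[OF F(2)])
  moreover have "fst z = F (snd z) \<longleftrightarrow> snd z = G (fst z)" for z using FG by metis
  ultimately have "dmap G" by (simp add: dmap_def)
  moreover have "G b = a" using F(3) FG by auto
  moreover have "G x = x" if "x \<notin> U" for x using F(4)[OF that] FG by metis
  ultimately show ?thesis unfolding moves_def using homeomorphism_symD[OF F(1)] by blast
qed

lemma moves_trans:
  assumes "moves U a b" "moves U b c"
  shows "moves U a c"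
proof -
  obtain F G where F: "homeomorphism UNIV UNIV F G" "dmap F" "F a = b" "\<And>x. x \<notin> U \<Longrightarrow> F x = x"
    using assms(1) unfolding moves_def by blast
  obtain F' G' where F': "homeomorphism UNIV UNIV F' G'" "dmap F'" "F' b = c" "\<And>x. x \<notin> U \<Longrightarrow> F' x = x"
    using assms(2) unfolding moves_def by blast
  show ?thesis unfolding moves_def
  proof (intro exI conjI)
    show "homeomorphism UNIV UNIV (F' \<circ> F) (G \<circ> G')" by (rule homeomorphism_compose[OF F(1) F'(1)])
    show "dmap (F' \<circ> F)" unfolding o_def by (rule dmap_comp[OF F'(2) F(2)])
  qed (use F F' in auto)
qed

text \<open>The map pushes by \<open>v = b - a\<close> with a tent-shaped weight that is 1 at
  \<open>a\<close> and vanishes outside the disk. The tent has Lipschitz constant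
  \<open>inverse r\<close> and \<open>norm v < r\<close>, so the displacement is a strict
  contraction, whence injectivity. A tent function of the distance is definable from the field,
  while smooth bump functions need not be definable.\<close>

lemma moves_in_ball:
  assumes sub: "ball a r \<subseteq> U" and b: "b \<in> ball a r"
  shows "moves U a b"
proof -
  have r: "0 < r" using b by (metis dist_not_less_zero less_le_trans mem_ball not_less)
  define v where "v = b - a"
  have v: "norm v < r" using b by (simp add: v_def dist_norm norm_minus_commute)
  define \<mu> where "\<mu> x = max 0 (1 - inverse r * dist x a)" for x
  define F where "F x = x + \<mu> x *\<^sub>R v" for x
  have \<mu>_lip: "\<bar>\<mu> x - \<mu> y\<bar> \<le> inverse r * dist x y" for x y
  proof -
    have "\<bar>\<mu> x - \<mu> y\<bar> \<le> \<bar>inverse r * dist x a - inverse r * dist y a\<bar>" unfolding \<mu>_def by arith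
    also have "\<dots> = inverse r * \<bar>dist x a - dist y a\<bar>"
      using r by (simp add: abs_mult flip: right_diff_distrib)
    also have "\<dots> \<le> inverse r * dist x y"
      using r abs_dist_diff_le[of x a y] by (intro mult_left_mono) (simp_all add: dist_commute)
    finally show ?thesis .
  qed
  have "inj F"
  proof (rule injI, rule ccontr)
    fix x y assume eq: "F x = F y" and ne: "x \<noteq> y"
    have "x - y = (\<mu> y - \<mu> x) *\<^sub>R v" using eq by (simp add: F_def algebra_simps)
    then have "dist x y = \<bar>\<mu> y - \<mu> x\<bar> * norm v" by (simp add: dist_norm)
    also have "\<dots> \<le> inverse r * dist x y * norm v"
      using \<mu>_lip[of y x] by (intro mult_right_mono) (simp_all add: dist_commute)
    also have "\<dots> < dist x y" using v r ne by (simp add: field_simps)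
    finally show False by simp
  qed
  have cont: "continuous_on UNIV F" unfolding F_def \<mu>_def by (intro continuous_intros)
  have out: "F x = x" if "x \<notin> ball a r" for x
  proof -
    have "1 \<le> inverse r * dist x a" using that r by (simp add: field_simps dist_commute)
    then show ?thesis by (simp add: F_def \<mu>_def max_def)
  qed
  \<comment> \<open>Surjectivity: the range is open by invariance of domain, and closed as the union
    of a compact set and the closed complement of the disk, so it is the whole plane.\<close>
  have "range F = F ` cball a r \<union> - ball a r"
  proof (intro equalityI subsetI)
    fix y assume "y \<in> range F"
    then obtain x where "y = F x" by blast
    then show "y \<in> F ` cball a r \<union> - ball a r" using out[of x] by (cases "x \<in> ball a r") auto
  next
    fix y assume "y \<in> F ` cball a r \<union> - ball a r"
    then show "y \<in> range F" using out[of y] by (metis Compl_iff UnE imageE rangeI)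
  qed
  moreover have "closed (F ` cball a r)"
    by (rule compact_imp_closed[OF compact_continuous_image[OF continuous_on_subset[OF cont subset_UNIV] compact_cball]])
  ultimately have "closed (range F)" by (simp add: closed_Compl closed_Un)
  moreover have "open (range F)" by (rule invariance_of_domain[OF cont open_UNIV \<open>inj F\<close>])
  ultimately have "range F = UNIV" using clopen by blast
  then obtain G where "homeomorphism UNIV UNIV F G"
    using invariance_of_domain_homeomorphism[OF open_UNIV cont _ \<open>inj F\<close>] by auto
  moreover have "dmap F" unfolding F_def \<mu>_def by (intro dmap_intros)
  moreover have "F a = b" by (simp add: F_def \<mu>_def v_def)
  moreover have "F x = x" if "x \<notin> U" for x using out sub that by blast
  ultimately show ?thesis unfolding moves_def by blast
qed

text \<open>\<open>moves\<close> is symmetric and transitive, and by \<open>moves_in_ball\<close>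
  every point of \<open>U\<close> can be moved to all points near it; connectedness turns this local
  statement into a global one.\<close>

lemma moves_connected:
  assumes "open U" "connected U" "a \<in> U" "b \<in> U"
  shows "moves U a b"
proof (rule connected_equivalence_relation[OF assms(2-4)])
  fix x assume "x \<in> U"
  then obtain r where r: "0 < r" "ball x r \<subseteq> U" using assms(1) open_contains_ball by blast
  then show "\<exists>T. openin (top_of_set U) T \<and> x \<in> T \<and> (\<forall>y\<in>T. moves U x y)"
    using moves_in_ball[OF r(2)] by (intro exI[of _ "ball x r"]) (auto intro: open_subset)
qed (use moves_sym moves_trans in blast)+

lemma g_map_extends_of_connected:
  assumes "closed Y" and p: "p \<notin> X"
    and H: "homeomorphism UNIV UNIV H G" "dmap H" "\<And>x. x \<in> X \<Longrightarrow> H x = h x" "h ` X = Y"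
    and C: "connected C" "C \<subseteq> - Y" "H p \<in> C" "q \<in> C"
  shows "extends_to_definable_homeomorphism S (insert 0 (phi p ` X)) (g_map h p q)"
proof -
  \<comment> \<open>The full component is used instead of \<open>C\<close>: it is open because
    \<open>Y\<close> is closed, as \<open>moves_connected\<close> requires, while \<open>C\<close>
    is only known to be connected.\<close>
  let ?W = "connected_component_set (- Y) (H p)"
  have "C \<subseteq> ?W" using C by (intro connected_component_maximal)
  then have "moves ?W (H p) q"
    using C \<open>closed Y\<close> by (intro moves_connected open_connected_component connected_connected_component) auto
  then obtain F F' where F: "homeomorphism UNIV UNIV F F'" "dmap F" "F (H p) = q"
    "\<And>y. y \<notin> ?W \<Longrightarrow> F y = y"
    unfolding moves_def by blast
  show ?thesis
  proof (rule g_map_extends_of_extends[OF p])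
    show "homeomorphism UNIV UNIV (F \<circ> H) (G \<circ> F')" by (rule homeomorphism_compose[OF H(1) F(1)])
    show "dmap (F \<circ> H)" unfolding o_def by (rule dmap_comp[OF F(2) H(2)])
    show "(F \<circ> H) p = q" using F(3) by simp
    show "(F \<circ> H) x = h x" if "x \<in> X" for x
    proof -
      have "h x \<notin> ?W" using that H(4) connected_component_subset[of "- Y" "H p"] by blast
      then show ?thesis using F(4) H(3)[OF that] by simp
    qed
  qed
qed

end

section \<open>Homeomorphisms and ray systems\<close>

text \<open>Stated for abstract ends so that it applies both to the rays of \<open>X\<close> and to
  the sectors of its complement. Far out, \<open>H\<close> maps a connected end into a single end of
  the target, and \<open>G\<close> maps that one back into a single end, which is the original one
  since they share a point; the two inclusions give equality of germs. The margins
  \<open>s0 + 1\<close> and \<open>r0 + 1\<close> make the hypotheses fit ends cut off by open as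
  well as by closed disks.\<close>

lemma germ_of_end_image:
  fixes P Q :: "int \<Rightarrow> real \<Rightarrow> complex set"
  assumes hom: "homeomorphism UNIV UNIV H G"
    and compE: "\<And>R. r0 \<le> R \<Longrightarrow> components (E R) = range (\<lambda>k. P k R)"
    and compF: "\<And>R. s0 \<le> R \<Longrightarrow> components (F R) = range (\<lambda>k. Q k R)"
    and germP: "\<And>k R. r0 \<le> R \<Longrightarrow> same_germ (P k R) (P k r0)"
    and germQ: "\<And>k R. s0 \<le> R \<Longrightarrow> same_germ (Q k R) (Q k s0)"
    and unbP: "\<And>k B. \<exists>z\<in>P k r0. B \<le> norm z"
    and E: "\<And>R. r0 \<le> R \<Longrightarrow> E R \<subseteq> {z \<in> E r0. R \<le> norm z}"
    and F: "\<And>R. s0 \<le> R \<Longrightarrow> F R \<subseteq> {z \<in> F s0. R \<le> norm z}"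
    and EF: "\<And>z. z \<in> E r0 \<Longrightarrow> s0 + 1 \<le> norm (H z) \<Longrightarrow> H z \<in> F s0"
    and FE: "\<And>w. w \<in> F s0 \<Longrightarrow> r0 + 1 \<le> norm (G w) \<Longrightarrow> G w \<in> E r0"
  shows "\<exists>l. same_germ (H ` P k r0) (Q l s0)"
proof -
  have GH: "G (H z) = z" "H (G w) = w" for z w
    using homeomorphism_apply1[OF hom] homeomorphism_apply2[OF hom] by simp_all
  have compP: "P j R \<in> components (E R)" if "r0 \<le> R" for j R using compE[OF that] by simp
  have compQ: "Q j R \<in> components (F R)" if "s0 \<le> R" for j R using compF[OF that] by simp
  note P = in_components_subset[OF compP] in_components_connected[OF compP]
  note Q = in_components_subset[OF compQ] in_components_connected[OF compQ]
  obtain b where b: "\<And>z. b \<le> norm z \<Longrightarrow> s0 + 1 \<le> norm (H z)"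
    using homeomorphism_norm_bound[OF hom] by metis
  obtain c where c: "\<And>w. c \<le> norm w \<Longrightarrow> r0 + 1 \<le> norm (G w)"
    using homeomorphism_norm_bound[OF homeomorphism_symD[OF hom]] by metis
  define R where "R = max b r0"
  have R: "r0 \<le> R" "b \<le> R" by (simp_all add: R_def)
  define R' where "R' = max c s0"
  have R': "s0 \<le> R'" "c \<le> R'" by (simp_all add: R'_def)
  have HP: "H ` P k R \<subseteq> F s0"
  proof
    fix w assume "w \<in> H ` P k R"
    then obtain z where z: "z \<in> P k R" "w = H z" by blast
    then have "z \<in> E r0" "R \<le> norm z" using P(1)[OF R(1)] E[OF R(1)] by blast+
    then show "w \<in> F s0" using EF b[of z] R(2) z(2) by simp
  qed
  have GQ: "G ` Q l R' \<subseteq> E r0" for l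
  proof
    fix z assume "z \<in> G ` Q l R'"
    then obtain w where w: "w \<in> Q l R'" "z = G w" by blast
    then have "w \<in> F s0" "R' \<le> norm w" using Q(1)[OF R'(1)] F[OF R'(1)] by blast+
    then show "z \<in> E r0" using FE c[of w] R'(2) w(2) by simp
  qed
  obtain p where p: "\<And>z. p \<le> norm z \<Longrightarrow> z \<in> P k R \<longleftrightarrow> z \<in> P k r0"
    using same_germD[OF germP[OF R(1)]] by metis
  have "P k r0 \<noteq> {}" using unbP[of k 0] by blast
  obtain z1 where z1: "z1 \<in> P k r0" "p \<le> norm z1" using unbP by blast
  then have "H z1 \<in> F s0" using HP p by blast
  moreover have "connected (H ` P k R)"
    using P(2)[OF R(1)] continuous_on_subset[OF homeomorphism_cont1[OF hom] subset_UNIV]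
    by (intro connected_continuous_image)
  ultimately obtain C where C: "C \<in> components (F s0)" "H ` P k R \<subseteq> C"
    using exists_component_superset[OF HP] by blast
  have "C \<in> range (\<lambda>k. Q k s0)" using C(1) compF[OF order_refl] by simp
  then obtain l where l: "H ` P k R \<subseteq> Q l s0" using C(2) by blast
  obtain q where q: "\<And>w. q \<le> norm w \<Longrightarrow> w \<in> Q l R' \<longleftrightarrow> w \<in> Q l s0"
    using same_germD[OF germQ[OF R'(1)]] by metis
  obtain d where d: "\<And>z. d \<le> norm z \<Longrightarrow> q \<le> norm (H z)"
    using homeomorphism_norm_bound[OF hom] by metis
  obtain z2 where z2: "z2 \<in> P k r0" "max p d \<le> norm z2" using unbP by blast
  then have "H z2 \<in> Q l R'" using p[of z2] d[of z2] q[of "H z2"] l by auto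
  then have z2': "z2 \<in> G ` Q l R'" using GH(1)[of z2] by (metis image_eqI)
  moreover have "connected (G ` Q l R')"
    using Q(2)[OF R'(1)] continuous_on_subset[OF homeomorphism_cont2[OF hom] subset_UNIV]
    by (intro connected_continuous_image)
  ultimately obtain C' where C': "C' \<in> components (E r0)" "G ` Q l R' \<subseteq> C'"
    using exists_component_superset[OF GQ] GQ by blast
  have "C' = P k r0"
    using components_nonoverlap[OF C'(1) compP[OF order_refl]] C'(2) z2' z2(1) by blast
  then have GQP: "G ` Q l R' \<subseteq> P k r0" using C'(2) by simp
  obtain e where e: "\<And>w. e \<le> norm w \<Longrightarrow> p \<le> norm (G w)"
    using homeomorphism_norm_bound[OF homeomorphism_symD[OF hom]] by metis
  have "same_germ (H ` P k r0) (Q l s0)"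
  proof (rule same_germI[of "max e q"])
    fix w :: complex assume w: "max e q \<le> norm w"
    show "w \<in> H ` P k r0 \<longleftrightarrow> w \<in> Q l s0"
    proof
      assume "w \<in> H ` P k r0"
      then have "G w \<in> P k r0" using GH(1) by auto
      then have "G w \<in> P k R" using p[of "G w"] e[of w] w by simp
      then show "w \<in> Q l s0" using l GH(2)[of w] by (metis imageI subsetD)
    next
      assume "w \<in> Q l s0"
      then have "w \<in> Q l R'" using q[of w] w by simp
      then show "w \<in> H ` P k r0" using GQP GH(2)[of w] by (metis imageI subsetD)
    qed
  qed
  then show ?thesis by blast
qed

lemma precedes_cong:
  assumes "same_germ A A'" "same_germ B B'" "precedes S X A B"
  shows "precedes S X A' B'"
proof -
  have eq: "same_germ A C = same_germ A' C" "same_germ B C = same_germ B' C" for C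
    using assms(1,2) same_germ_sym same_germ_trans by blast+
  show ?thesis using assms(3) unfolding precedes_def eq .
qed

locale ray_system_homeomorphism =
  X: ray_system X r0 N \<theta> + Y: ray_system Y s0 M \<eta>
  for X r0 N \<theta> Y s0 M \<eta> +
  fixes H G :: "complex \<Rightarrow> complex"
  assumes hom: "homeomorphism UNIV UNIV H G" and image_eq: "H ` X = Y"
begin

lemma mem_Y_iff: "H z \<in> Y \<longleftrightarrow> z \<in> X"
  using homeomorphism_image_eq_vimage[OF hom, of X] homeomorphism_apply1[OF hom, of z] image_eq by auto

lemma mem_X_iff: "G w \<in> X \<longleftrightarrow> w \<in> Y"
  using mem_Y_iff[of "G w"] homeomorphism_apply2[OF hom, of w] by simp

lemma ray_image: "\<exists>l. same_germ (H ` X.ray k r0) (Y.ray l s0)"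
proof (rule germ_of_end_image[OF hom X.components_Diff_ball Y.components_Diff_ball])
  show "\<exists>z\<in>X.ray k r0. B \<le> norm z" for k B
    using X.rcis_mem_ray[of r0 "max r0 B" k] X.r0_pos by (intro bexI[of _ "rcis (max r0 B) (\<theta> k (max r0 B))"]) auto
  show "same_germ (X.ray k R) (X.ray k r0)" if "r0 \<le> R" for k R using that by (intro X.same_germ_ray) auto
  show "same_germ (Y.ray k R) (Y.ray k s0)" if "s0 \<le> R" for k R using that by (intro Y.same_germ_ray) auto
qed (auto simp: mem_Y_iff mem_X_iff)

lemma sector_image: "\<exists>l. same_germ (H ` X.sector k r0) (Y.sector l s0)"
  using X.complement_components_eq Y.complement_components_eq unfolding complement_components_def
proof (rule germ_of_end_image[OF hom])
  show "\<exists>z\<in>X.sector k r0. B \<le> norm z" for k B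
    using X.sector_nonempty[of r0 "max r0 B + 1" k] X.r0_pos
    by (intro bexI[of _ "rcis (max r0 B + 1) ((\<theta> k (max r0 B + 1) + \<theta> (k + 1) (max r0 B + 1)) / 2)"]) auto
  show "same_germ (X.sector k R) (X.sector k r0)" if "r0 \<le> R" for k R using that by (intro X.same_germ_sector) auto
  show "same_germ (Y.sector k R) (Y.sector k s0)" if "s0 \<le> R" for k R using that by (intro Y.same_germ_sector) auto
qed (auto simp: mem_Y_iff mem_X_iff)

text \<open>Frontiers commute with homeomorphisms and respect germs, so the pair of rays bounding a
  sector goes to the pair bounding its image.\<close>

lemma sector_frontier_image:
  assumes "same_germ (H ` X.sector k r0) (Y.sector l s0)"
  shows "same_germ (H ` (X.ray k r0 \<union> X.ray (k + 1) r0)) (Y.ray l s0 \<union> Y.ray (l + 1) s0)"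
proof -
  have "same_germ (frontier (H ` X.sector k r0)) (frontier (Y.sector l s0))"
    by (rule same_germ_frontier[OF assms])
  moreover have "same_germ (H ` frontier (X.sector k r0)) (H ` (X.ray k r0 \<union> X.ray (k + 1) r0))"
    by (intro same_germ_image[OF hom] X.same_germ_frontier_sector order_refl)
  moreover have "same_germ (frontier (Y.sector l s0)) (Y.ray l s0 \<union> Y.ray (l + 1) s0)"
    by (intro Y.same_germ_frontier_sector order_refl)
  ultimately show ?thesis
    unfolding homeomorphism_frontier_image[OF hom] using same_germ_sym same_germ_trans by blast
qed

lemma same_germ_image_iff: "same_germ (H ` A) (H ` B) \<longleftrightarrow> same_germ A B"
proof
  assume "same_germ (H ` A) (H ` B)"
  then have "same_germ (G ` H ` A) (G ` H ` B)" by (rule same_germ_image[OF homeomorphism_symD[OF hom]])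
  then show "same_germ A B" using homeomorphism_apply1[OF hom] by (simp add: image_image)
qed (rule same_germ_image[OF hom])

lemma ray_image_cong:
  assumes "same_germ (H ` X.ray k r0) (Y.ray i s0)" "same_germ (H ` X.ray l r0) (Y.ray j s0)"
    and "i mod int M = j mod int M"
  shows "k mod int N = l mod int N"
proof -
  have "Y.ray i s0 = Y.ray j s0" by (rule Y.ray_cong[OF order_refl assms(3)])
  then have "same_germ (H ` X.ray k r0) (H ` X.ray l r0)"
    using assms(1,2) same_germ_sym same_germ_trans by metis
  then show ?thesis using X.ray_germ_eq[OF order_refl] same_germ_image_iff by blast
qed

lemma N_le_M: "N \<le> M"
proof -
  obtain \<sigma> where \<sigma>: "\<And>k. same_germ (H ` X.ray k r0) (Y.ray (\<sigma> k) s0)" using ray_image by metis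
  have "inj_on (\<lambda>k. \<sigma> k mod int M) {0..<int N}"
  proof (rule inj_onI)
    fix k l assume "k \<in> {0..<int N}" "l \<in> {0..<int N}" "\<sigma> k mod int M = \<sigma> l mod int M"
    then show "k = l" using ray_image_cong[OF \<sigma> \<sigma>, of k l] by simp
  qed
  moreover have "(\<lambda>k. \<sigma> k mod int M) ` {0..<int N} \<subseteq> {0..<int M}" using Y.N_pos by auto
  ultimately have "card {0..<int N} \<le> card {0..<int M}" by (intro card_inj_on_le) auto
  then show ?thesis by simp
qed

lemma N_eq_M: "N = M"
proof -
  have "G ` Y = X"
    unfolding homeomorphism_image_eq_vimage[OF homeomorphism_symD[OF hom]] vimage_def mem_Y_iff by simp
  then interpret inverse: ray_system_homeomorphism Y s0 M \<eta> X r0 N \<theta> G H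
    by unfold_locales (rule homeomorphism_symD[OF hom])
  show ?thesis using N_le_M inverse.N_le_M by simp
qed

text \<open>The images of adjacent rays bound the image of a sector, so they are adjacent.\<close>

lemma ray_image_adjacent:
  assumes N: "3 \<le> N"
    and \<sigma>: "same_germ (H ` X.ray k r0) (Y.ray i s0)" "same_germ (H ` X.ray (k + 1) r0) (Y.ray j s0)"
  shows "j mod int N = (i + 1) mod int N \<or> i mod int N = (j + 1) mod int N"
proof -
  obtain l where l: "same_germ (H ` X.sector k r0) (Y.sector l s0)" using sector_image by blast
  have "same_germ (Y.ray i s0 \<union> Y.ray j s0) (H ` (X.ray k r0 \<union> X.ray (k + 1) r0))"
    unfolding image_Un by (intro same_germ_Un same_germ_sym[OF \<sigma>(1)] same_germ_sym[OF \<sigma>(2)])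
  then have *: "same_germ (Y.ray i s0 \<union> Y.ray j s0) (Y.ray l s0 \<union> Y.ray (l + 1) s0)"
    by (rule same_germ_trans[OF _ sector_frontier_image[OF l]])
  have "i mod int N = l mod int N \<or> i mod int N = (l + 1) mod int N"
    "j mod int N = l mod int N \<or> j mod int N = (l + 1) mod int N"
    using Y.ray_germ_subset[OF order_refl *] unfolding N_eq_M by blast+
  moreover have "i mod int N \<noteq> j mod int N"
  proof
    assume "i mod int N = j mod int N"
    then have "k mod int N = (k + 1) mod int N" using ray_image_cong[OF \<sigma>] N_eq_M by simp
    then have "int N dvd (k + 1) - k" by (metis mod_eq_dvd_iff)
    then show False using N by simp
  qed
  ultimately show ?thesis by (metis mod_add_left_eq)
qed

text \<open>By adjacency each step of the index goes up or down by one. A change of direction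
  between successive steps would give the rays \<open>k\<close> and \<open>k + 2\<close> the same
  image, which \<open>3 \<le> N\<close> forbids; so the direction is the same at all
  integers.\<close>

lemma ray_image_cyclic:
  assumes N: "3 \<le> N" and \<sigma>: "\<And>k. same_germ (H ` X.ray k r0) (Y.ray (\<sigma> k) s0)"
  shows "(\<forall>k. \<sigma> (k + 1) mod int N = (\<sigma> k + 1) mod int N) \<or>
    (\<forall>k. \<sigma> k mod int N = (\<sigma> (k + 1) + 1) mod int N)"
proof -
  define up down where "up k \<longleftrightarrow> \<sigma> (k + 1) mod int N = (\<sigma> k + 1) mod int N"
    and "down k \<longleftrightarrow> \<sigma> k mod int N = (\<sigma> (k + 1) + 1) mod int N" for k
  have either: "up k \<or> down k" for k
    unfolding up_def down_def by (rule ray_image_adjacent[OF N \<sigma>[of k] \<sigma>[of "k + 1"]])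
  have ne: "\<sigma> k mod int N \<noteq> \<sigma> (k + 1 + 1) mod int N" for k
  proof
    assume "\<sigma> k mod int N = \<sigma> (k + 1 + 1) mod int N"
    then have "k mod int N = (k + 1 + 1) mod int N"
      using ray_image_cong[OF \<sigma>[of k] \<sigma>[of "k + 1 + 1"]] N_eq_M by simp
    then have "int N dvd (k + 1 + 1) - k" by (metis mod_eq_dvd_iff)
    then have "int N dvd 2" by simp
    then show False using N zdvd_imp_le by fastforce
  qed
  have cancel: "a mod int N = b mod int N" if "(a + 1) mod int N = (b + 1) mod int N" for a b
    using that by (metis add_diff_cancel_right mod_eq_dvd_iff)
  have no_switch: "\<not> (up k \<and> down (k + 1))" "\<not> (down k \<and> up (k + 1))" for k
  proof -
    show "\<not> (up k \<and> down (k + 1))"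
      unfolding up_def down_def using ne[of k] cancel[of "\<sigma> k" "\<sigma> (k + 1 + 1)"] by auto
    show "\<not> (down k \<and> up (k + 1))"
      unfolding up_def down_def using ne[of k] by auto
  qed
  have step: "up (k + 1) \<longleftrightarrow> up k" "down (k + 1) \<longleftrightarrow> down k" if "\<not> (up k \<and> down k)" "\<not> (up (k + 1) \<and> down (k + 1))" for k
    using either[of k] either[of "k + 1"] no_switch[of k] that by blast+
  \<comment> \<open>Going up and down at once would make the next step, in whichever direction, a
    change of direction.\<close>
  have excl: "\<not> (up k \<and> down k)" for k
  proof
    assume "up k \<and> down k"
    then show False using either[of "k + 1"] no_switch[of k] by blast
  qed
  have "up k \<longleftrightarrow> up 0" for k
    using step(1)[OF excl excl] by (induction k rule: int_induct[where k = 0]) (simp_all, metis diff_add_cancel)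
  then show ?thesis using either unfolding up_def[symmetric] down_def[symmetric] by blast
qed

lemma ord_infinity_homeomorphism:
  assumes S: "o_minimal_field_expansion S" and N: "3 \<le> N" and h: "\<And>x. x \<in> X \<Longrightarrow> h x = H x"
  shows "ord_infinity S X h \<in> {1, - 1}"
proof -
  obtain \<sigma> where \<sigma>: "\<And>k. same_germ (H ` X.ray k r0) (Y.ray (\<sigma> k) s0)" using ray_image by metis
  have hX: "h ` X = Y" using h image_eq by auto
  have ray_h: "same_germ (Y.ray (\<sigma> k) s0) (h ` X.ray k R)" if R: "r0 \<le> R" for k R
  proof -
    have "h ` X.ray k R = H ` X.ray k R" using X.ray_subset[OF R] h by (intro image_cong) auto
    moreover have "same_germ (H ` X.ray k r0) (H ` X.ray k R)"
      using R by (intro same_germ_image[OF hom] X.same_germ_ray) auto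
    ultimately show ?thesis using \<sigma>[of k] same_germ_sym same_germ_trans by metis
  qed
  have succ: "precedes S Y (Y.ray i s0) (Y.ray j s0)" if "j mod int N = (i + 1) mod int N" for i j
  proof -
    have "Y.ray j s0 = Y.ray (i + 1) s0" by (rule Y.ray_cong) (use that N_eq_M in auto)
    then show ?thesis using Y.precedes_succ[OF S, of s0 i] N N_eq_M by simp
  qed
  \<comment> \<open>\<open>T\<close> stands for \<open>precedes\<close> on the image or for its
    converse, so that both signs are treated together; \<open>precedes_imp_succ\<close> reduces the
    premise to consecutive rays.\<close>
  have main: "\<forall>\<^sub>F R in at_top. \<forall>A\<in>components (X - ball 0 R). \<forall>B\<in>components (X - ball 0 R).
      A \<noteq> B \<longrightarrow> precedes S X A B \<longrightarrow> T (h ` A) (h ` B)"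
    if T: "\<And>k R. r0 \<le> R \<Longrightarrow> T (h ` X.ray k R) (h ` X.ray (k + 1) R)" for T
  proof (rule eventually_at_top_linorderI[of r0], intro ballI impI)
    fix R A B assume R: "r0 \<le> R" and AB: "A \<in> components (X - ball 0 R)" "B \<in> components (X - ball 0 R)"
      and prec: "precedes S X A B"
    then obtain k l where kl: "A = X.ray k R" "B = X.ray l R"
      unfolding X.components_Diff_ball[OF R] by blast
    have "l mod int N = (k + 1) mod int N"
      by (rule X.precedes_imp_succ[OF N R prec]) (simp_all add: kl same_germ_refl)
    then have "B = X.ray (k + 1) R" unfolding kl by (rule X.ray_cong[OF R])
    then show "T (h ` A) (h ` B)" using T[OF R] kl(1) by simp
  qed
  from ray_image_cyclic[OF N \<sigma>] show ?thesis
  proof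
    assume up: "\<forall>k. \<sigma> (k + 1) mod int N = (\<sigma> k + 1) mod int N"
    have "precedes S (h ` X) (h ` X.ray k R) (h ` X.ray (k + 1) R)" if "r0 \<le> R" for k R
      unfolding hX by (rule precedes_cong[OF ray_h[OF that] ray_h[OF that] succ]) (use up in blast)
    from main[of "precedes S (h ` X)", OF this] show ?thesis by (simp add: ord_infinity_def)
  next
    assume down: "\<forall>k. \<sigma> k mod int N = (\<sigma> (k + 1) + 1) mod int N"
    have "precedes S (h ` X) (h ` X.ray (k + 1) R) (h ` X.ray k R)" if "r0 \<le> R" for k R
      unfolding hX by (rule precedes_cong[OF ray_h[OF that] ray_h[OF that] succ]) (use down in blast)
    from main[of "\<lambda>A B. precedes S (h ` X) B A", OF this] show ?thesis by (simp add: ord_infinity_def)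
  qed
qed

section \<open>Matching a component at infinity with its image\<close>

lemma sector_image_inter:
  assumes "r0 \<le> R" "s0 \<le> R'"
  obtains l where "same_germ (H ` X.sector k r0) (Y.sector l s0)" "H ` X.sector k R \<inter> Y.sector l R' \<noteq> {}"
proof -
  obtain l where l: "same_germ (H ` X.sector k r0) (Y.sector l s0)" using sector_image by blast
  have "same_germ (H ` X.sector k R) (H ` X.sector k r0)"
    using assms by (intro same_germ_image[OF hom] X.same_germ_sector) auto
  moreover have "same_germ (Y.sector l s0) (Y.sector l R')" using assms by (intro Y.same_germ_sector) auto
  ultimately have "same_germ (H ` X.sector k R) (Y.sector l R')" using l same_germ_trans by blast
  then obtain r where r: "\<And>z. r \<le> norm z \<Longrightarrow> z \<in> H ` X.sector k R \<longleftrightarrow> z \<in> Y.sector l R'"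
    using same_germD by metis
  define s where "s = max r R' + 1"
  have s: "R' < s" "r \<le> s" "0 < s" using assms(2) Y.r0_pos by (auto simp: s_def)
  let ?w = "rcis s ((\<eta> l s + \<eta> (l + 1) s) / 2)"
  have "?w \<in> Y.sector l R'" by (rule Y.sector_nonempty[OF assms(2) s(1)])
  moreover have "r \<le> norm ?w" using s by simp
  ultimately have "?w \<in> H ` X.sector k R \<inter> Y.sector l R'" using r by blast
  then show ?thesis using that[OF l] by blast
qed

text \<open>This union joins \<open>H p\<close> to \<open>q\<close> inside the complement of
  \<open>Y\<close> when \<open>p\<close> and \<open>q\<close> lie in matching sectors, which lets
  the perturbation move one to the other.\<close>

lemma sector_image_connected:
  assumes "r0 \<le> R" "s0 \<le> R'" "H ` X.sector k R \<inter> Y.sector l R' \<noteq> {}"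
  shows "connected (H ` X.sector k R \<union> Y.sector l R')" "H ` X.sector k R \<union> Y.sector l R' \<subseteq> - Y"
proof -
  have "connected (H ` X.sector k R)"
    using X.connected_sector[OF assms(1)] continuous_on_subset[OF homeomorphism_cont1[OF hom] subset_UNIV]
    by (intro connected_continuous_image)
  then show "connected (H ` X.sector k R \<union> Y.sector l R')"
    using Y.connected_sector[OF assms(2)] assms(3) by (rule connected_Un)
  show "H ` X.sector k R \<union> Y.sector l R' \<subseteq> - Y"
    using X.sector_subset_Compl[OF assms(1), of k] Y.sector_subset_Compl[OF assms(2), of l] mem_Y_iff by blast
qed

end

text \<open>The image falls under the same existence result; emptiness of the interior is
  transported by the homeomorphism, without computing the dimension of the image.\<close>

lemma (in o_minimal_field_expansion) ray_system_image:
  assumes X: "definable_set S X" "closed X" "interior X = {}" "\<not> bounded X"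
    and H: "homeomorphism UNIV UNIV H G" "dmap H"
  shows "\<exists>s0 M \<eta>. ray_system (H ` X) s0 M \<eta>"
proof (rule ray_system_exists)
  have "dfn (\<lambda>w. \<exists>z. z \<in> X \<and> w = H z)"
    by (intro dfn_intros dmap_intros dfn_comp[OF X(1)[unfolded definable_set_iff]] dmap_comp[OF H(2)])
  moreover have "w \<in> H ` X \<longleftrightarrow> (\<exists>z. z \<in> X \<and> w = H z)" for w by blast
  ultimately show "definable_set S (H ` X)" by (simp only: definable_set_iff)
  show "closed (H ` X)" by (rule homeomorphism_closed_image[OF H(1) X(2)])
  have "open (H -` interior (H ` X))"
    using homeomorphism_cont1[OF H(1)] by (intro open_vimage open_interior)
  moreover have "H -` interior (H ` X) \<subseteq> X"
  proof
    fix z assume "z \<in> H -` interior (H ` X)"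
    then have "H z \<in> H ` X" using interior_subset by blast
    then show "z \<in> X"
      unfolding homeomorphism_image_eq_vimage[OF H(1)] using homeomorphism_apply1[OF H(1), of z] by simp
  qed
  ultimately have empty: "H -` interior (H ` X) = {}" using X(3) interior_maximal by blast
  show "interior (H ` X) = {}"
  proof (rule ccontr)
    assume "interior (H ` X) \<noteq> {}"
    then obtain w where "w \<in> interior (H ` X)" by blast
    then have "G w \<in> H -` interior (H ` X)" using homeomorphism_apply2[OF H(1), of w] by simp
    then show False using empty by simp
  qed
  show "\<not> bounded (H ` X)"
  proof
    assume "bounded (H ` X)"
    then obtain B where B: "\<And>x. x \<in> X \<Longrightarrow> norm (H x) \<le> B" by (auto simp: bounded_iff)
    obtain b where b: "\<And>z. b \<le> norm z \<Longrightarrow> B + 1 \<le> norm (H z)" using homeomorphism_norm_bound[OF H(1)] by metis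
    have "norm x \<le> b" if "x \<in> X" for x using B[OF that] b[of x] by linarith
    then show False using X(4) by (auto simp: bounded_iff)
  qed
qed

text \<open>\<open>R0\<close> expresses that both radii are large. The guard
  \<open>3 \<le> deg_infinity X\<close> encodes the convention that the order condition holds
  automatically for fewer branches, and the existential over \<open>P\<close> means one of the two
  pairs in degree 2 and otherwise refers to the single pair.\<close>

theorem theorem4p1:
  fixes S :: "nat \<Rightarrow> (nat \<Rightarrow> real) set set"
    and X :: "complex set"
    and h :: "complex \<Rightarrow> complex"
  assumes "o_minimal_field_expansion S"
    and "definable_set S X" and "closed X" and "\<not> bounded X" and "odim S 2 (coords X) \<le> 1"
    and "definable_map S X h" and "continuous_on X h" and "inj_on h X" and "coercive_on X h"
  shows "\<exists>R0. \<forall>R\<ge>R0. \<forall>R'\<ge>R0. \<forall>P. choice_pq S X h R R' P \<longrightarrow>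
    (extends_to_definable_homeomorphism S X h \<longleftrightarrow>
       (3 \<le> deg_infinity X \<longrightarrow> ord_infinity S X h \<in> {1, - 1}) \<and>
       (\<exists>(p, q) \<in> P. extends_to_definable_homeomorphism S (insert 0 (phi p ` X)) (g_map h p q)))"
proof (cases "extends_to_definable_homeomorphism S X h")
  case False
  interpret o_minimal_field_expansion S by fact
  \<comment> \<open>Without an extension of \<open>h\<close> the right-hand side fails at every
    radius, because an extension of \<open>g_map h p q\<close> would produce one of
    \<open>h\<close>; so any \<open>R0\<close> works.\<close>
  have "\<not> extends_to_definable_homeomorphism S (insert 0 (phi p ` X)) (g_map h p q)"
    if "choice_pq S X h R R' P" "(p, q) \<in> P" for R R' P p q
  proof
    assume ext: "extends_to_definable_homeomorphism S (insert 0 (phi p ` X)) (g_map h p q)"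
    have sub: "x \<notin> X" if "U \<in> complement_components X R" "x \<in> U" for U x
      using in_components_subset that unfolding complement_components_def by blast
    have "p \<notin> X" by (rule choice_pq.cases[OF that(1)]) (use that(2) sub in auto)
    then show False using extends_of_g_map_extends[OF _ ext] False by blast
  qed
  then show ?thesis using False by blast
next
  case True
  interpret o_minimal_field_expansion S by fact
  obtain H G where H: "homeomorphism UNIV UNIV H G" "dmap H" "\<And>x. x \<in> X \<Longrightarrow> H x = h x"
    using True by (auto simp: extends_to_definable_homeomorphism_def definable_map_UNIV)
  have int: "interior X = {}" by (rule interior_empty_of_odim_le_1) fact
  have hX: "h ` X = H ` X" using H(3) by auto
  obtain r0 N \<theta> where X: "ray_system X r0 N \<theta>"
    using ray_system_exists[OF assms(2,3) int assms(4)] by blast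
  obtain s0 M \<eta> where Y: "ray_system (H ` X) s0 M \<eta>"
    using ray_system_image[OF assms(2,3) int assms(4) H(1,2)] by blast
  interpret ray_system_homeomorphism X r0 N \<theta> "H ` X" s0 M \<eta> H G
    by (intro ray_system_homeomorphism.intro X Y ray_system_homeomorphism_axioms.intro H(1) refl)
  have closed_Y: "closed (H ` X)" by (rule homeomorphism_closed_image[OF H(1)]) fact
  have ord: "ord_infinity S X h \<in> {1, - 1}" if "3 \<le> N"
    by (rule ord_infinity_homeomorphism[OF assms(1) that]) (simp add: H(3))
  have g: "extends_to_definable_homeomorphism S (insert 0 (phi p ` X)) (g_map h p q)"
    if R: "r0 \<le> R" "s0 \<le> R'" and inter: "H ` X.sector k R \<inter> Y.sector l R' \<noteq> {}"
      and pq: "p \<in> X.sector k R" "q \<in> Y.sector l R'" for R R' k l p q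
  proof (rule g_map_extends_of_connected[OF closed_Y _ H hX sector_image_connected[OF R inter]])
    show "p \<notin> X" using pq(1) X.sector_subset_Compl[OF R(1)] by blast
  qed (use pq in auto)
  have main: "\<exists>(p, q) \<in> P. extends_to_definable_homeomorphism S (insert 0 (phi p ` X)) (g_map h p q)"
    if R: "r0 \<le> R" "s0 \<le> R'" and choice: "choice_pq S X h R R' P" for R R' P
    using choice
  proof cases
    case (one U V p q)
    obtain k where k: "U = X.sector k R" using one(3) X.complement_components_eq[OF R(1)] by auto
    obtain l' where l': "V = Y.sector l' R'"
      using one(4) Y.complement_components_eq[OF R(2)] unfolding hX by auto
    obtain l where l: "H ` X.sector k R \<inter> Y.sector l R' \<noteq> {}"
      using sector_image_inter[OF R] by metis
    \<comment> \<open>With a single ray all indices are congruent, so \<open>V\<close> is the sector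
      that meets the image of \<open>U\<close>.\<close>
    have "M = 1" using one(2) X.deg_infinity_eq N_eq_M by simp
    then have "Y.sector l R' = Y.sector l' R'" by (intro Y.sector_cong[OF R(2)]) simp
    then have "extends_to_definable_homeomorphism S (insert 0 (phi p ` X)) (g_map h p q)"
      using one(5,6) k l l' by (intro g[OF R, of k l']) simp_all
    then show ?thesis using one(1) by simp
  next
    case (two U V1 V2 p1 q1 p2 q2)
    obtain k where k: "U = X.sector k R" using two(3) X.complement_components_eq[OF R(1)] by auto
    obtain l1 where l1: "V1 = Y.sector l1 R'"
      using two(4) Y.complement_components_eq[OF R(2)] unfolding hX by auto
    obtain l2 where l2: "V2 = Y.sector l2 R'"
      using two(5) Y.complement_components_eq[OF R(2)] unfolding hX by auto
    obtain l where l: "H ` X.sector k R \<inter> Y.sector l R' \<noteq> {}"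
      using sector_image_inter[OF R] by metis
    have M: "int M = 2" using two(2) X.deg_infinity_eq N_eq_M by simp
    have "l1 mod int M \<noteq> l2 mod int M" using two(6) l1 l2 Y.sector_cong[OF R(2)] by metis
    \<comment> \<open>Two distinct sectors exhaust the residues modulo 2, so the sector met by the
      image of \<open>U\<close> is \<open>V1\<close> or \<open>V2\<close>; nothing decides which,
      hence the two pairs.\<close>
    then have "l mod int M = l1 mod int M \<or> l mod int M = l2 mod int M" unfolding M by presburger
    then have "Y.sector l R' = V1 \<or> Y.sector l R' = V2" using l1 l2 Y.sector_cong[OF R(2)] by metis
    then show ?thesis
    proof
      assume "Y.sector l R' = V1"
      then have "extends_to_definable_homeomorphism S (insert 0 (phi p1 ` X)) (g_map h p1 q1)"
        using two k l by (intro g[OF R, of k l]) simp_all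
      then show ?thesis using two(1) by simp
    next
      assume "Y.sector l R' = V2"
      then have "extends_to_definable_homeomorphism S (insert 0 (phi p2 ` X)) (g_map h p2 q2)"
        using two k l by (intro g[OF R, of k l]) simp_all
      then show ?thesis using two(1) by simp
    qed
  next
    case (many m B i U p q)
    have N: "m = N" "3 \<le> N" using many(2,3) X.deg_infinity_eq by simp_all
    obtain k where k: "U = X.sector k R" using many(7) X.complement_components_eq[OF R(1)] by auto
    let ?A = "B i \<union> B (Suc i mod m)"
    \<comment> \<open>The order of \<open>h\<close> is already known to be 1 or -1, so the
      conditional clause of the choice supplies \<open>V\<close>.\<close>
    obtain V where V: "V \<in> complement_components (h ` X) R'"
      "bounded_by_branches V (h ` B i) (h ` B (Suc i mod m))" "q \<in> V"
      using many(11) ord[OF N(2)] by blast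
    obtain l' where l': "V = Y.sector l' R'"
      using V(1) Y.complement_components_eq[OF R(2)] unfolding hX by auto
    obtain l where l: "same_germ (H ` X.sector k r0) (Y.sector l s0)"
      "H ` X.sector k R \<inter> Y.sector l R' \<noteq> {}"
      using sector_image_inter[OF R] by metis
    have "B i \<in> components (X - ball 0 R)" "B (Suc i mod m) \<in> components (X - ball 0 R)"
      using many(4,6) by (auto dest!: bij_betwE)
    then have "?A \<subseteq> X" using in_components_subset by blast
    then have hA: "h ` B i \<union> h ` B (Suc i mod m) = H ` ?A"
      unfolding image_Un[symmetric] by (intro image_cong) (auto simp: H(3))
    have "same_germ (frontier U) ?A" using many(8) by (simp add: bounded_by_branches_def)
    moreover have "same_germ (frontier U) (X.ray k r0 \<union> X.ray (k + 1) r0)"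
      unfolding k by (rule X.same_germ_frontier_sector[OF R(1) order_refl])
    ultimately have "same_germ (H ` ?A) (H ` (X.ray k r0 \<union> X.ray (k + 1) r0))"
      using same_germ_image[OF H(1)] same_germ_sym same_germ_trans by metis
    then have A: "same_germ (H ` ?A) (Y.ray l s0 \<union> Y.ray (l + 1) s0)"
      by (rule same_germ_trans[OF _ sector_frontier_image[OF l(1)]])
    have "same_germ (frontier V) (H ` ?A)" using V(2) hA by (simp add: bounded_by_branches_def)
    moreover have "same_germ (frontier V) (Y.ray l' s0 \<union> Y.ray (l' + 1) s0)"
      unfolding l' by (rule Y.same_germ_frontier_sector[OF R(2) order_refl])
    ultimately have "same_germ (Y.ray l' s0 \<union> Y.ray (l' + 1) s0) (Y.ray l s0 \<union> Y.ray (l + 1) s0)"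
      using A same_germ_sym same_germ_trans by metis
    \<comment> \<open>Near infinity \<open>V\<close> and the image of \<open>U\<close> are bounded
      by the same pair of rays; with at least three rays this identifies the sectors.\<close>
    then have "l' mod int M = l mod int M" using N N_eq_M by (intro Y.sector_germ_eq[OF order_refl]) simp_all
    then have "Y.sector l R' = V" using l' Y.sector_cong[OF R(2)] by metis
    then have "extends_to_definable_homeomorphism S (insert 0 (phi p ` X)) (g_map h p q)"
      using many(9) k l(2) V(3) by (intro g[OF R, of k l]) simp_all
    then show ?thesis using many(1) by simp
  qed
  show ?thesis
  proof (intro exI[of _ "max r0 s0"] allI impI)
    fix R R' P assume "max r0 s0 \<le> R" "max r0 s0 \<le> R'" "choice_pq S X h R R' P"
    then show "extends_to_definable_homeomorphism S X h \<longleftrightarrow>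
       (3 \<le> deg_infinity X \<longrightarrow> ord_infinity S X h \<in> {1, - 1}) \<and>
       (\<exists>(p, q) \<in> P. extends_to_definable_homeomorphism S (insert 0 (phi p ` X)) (g_map h p q))"
      using True main[of R R' P] ord X.deg_infinity_eq by simp
  qed
qed

end
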